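(* Let $A,H$ be self-adjoint operators on a Hilbert space $\mathcal{H}$ with $H$ of class $C^1(A)$ and $H'=\theta(H)$, where $H'=[H,\mathrm{i}A]$ and $\theta:\mathbb{R}\to\mathbb{R}$ is a real function of class $C^1$ with bounded derivative such that: (1) for every $\varepsilon>0$ there is $c_\varepsilon>0$ such that $|\theta(\lambda)|\ge c_\varepsilon$ whenever $|\lambda|\ge\varepsilon$; (2) the function $\lambda\mapsto\lambda/\theta(\lambda)$ extends to a $C^1$ function on $\mathbb{R}$. If $u\in D(A)$ and $u,Au\in\mathcal{E}(H)$, then there is a constant $C_u$ such that $|\psi_u(t)|\le C_u\langle t\rangle^{-1/2}$ for all $t\in\mathbb{R}$, where $\psi_u(t)=\langle u,\mathrm{e}^{\mathrm{i}tH}u\rangle$.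
   Context: Notation: $\langle t\rangle=(1+t^2)^{1/2}$. A bounded operator $S$ on $\mathcal{H}$ is of class $C^1(A)$ if the sesquilinear form $(u,v)\mapsto\langle Au,Sv\rangle-\langle u,SAv\rangle$ on $D(A)$ is continuous for the topology induced by $\mathcal{H}$. A self-adjoint operator $H$ is of class $C^1(A)$ if $(H-z)^{-1}$ is of class $C^1(A)$ for some (hence all) $z$ in the resolvent set of $H$. In that case $D(A)\cap D(H)$ is dense in $D(H)$ (graph topology) and the form $[A,H](u,v)=\langle Au,Hv\rangle-\langle Hu,Av\rangle$ on $D(A)\cap D(H)$ extends uniquely to a continuous sesquilinear form $[A,H]$ on $D(H)$, identified with a continuous operator $D(H)\to D(H)^*$ (where $D(H)\subset\mathcal{H}\subset D(H)^*$). One sets $[H,A]=-[A,H]$ and $H'=[H,\mathrm{i}A]=\mathrm{i}[H,A]$. The equality $H'=\theta(H)$ is an equality of forms on $D(H)$. The subspace $\mathcal{E}(H)$ is the set of $u\in\mathcal{H}$ such that $\int_{\mathbb{R}}|\langle u,\mathrm{e}^{\mathrm{i}tH}u\rangle|^2\,dt<\infty$. *)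

theory Defs
  imports "HOL-Analysis.Analysis"
begin

section \<open>Complex Hilbert spaces\<close>

text \<open>The inner product is antilinear in the first and linear in the second argument.  Norm,
  topology and completeness come from the underlying real Hilbert space, whose inner product is
  the real part of the complex one.\<close>

class complex_hilbert = real_inner + complete_space +
  fixes scaleC :: "complex \<Rightarrow> 'a \<Rightarrow> 'a"  (infixr \<open>*\<^sub>C\<close> 75)
    and cinner :: "'a \<Rightarrow> 'a \<Rightarrow> complex"
  assumes scaleC_add_right: "c *\<^sub>C (x + y) = c *\<^sub>C x + c *\<^sub>C y"
    and scaleC_add_left: "(c + d) *\<^sub>C x = c *\<^sub>C x + d *\<^sub>C x"
    and scaleC_scaleC: "c *\<^sub>C d *\<^sub>C x = (c * d) *\<^sub>C x"
    and scaleR_scaleC: "r *\<^sub>R x = complex_of_real r *\<^sub>C x"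
    and cinner_commute: "cinner x y = cnj (cinner y x)"
    and cinner_add_right: "cinner x (y + z) = cinner x y + cinner x z"
    and cinner_scaleC_right: "cinner x (c *\<^sub>C y) = c * cinner x y"
    and inner_eq_Re_cinner: "inner x y = Re (cinner x y)"

instantiation complex :: complex_hilbert
begin

definition "scaleC_complex (c::complex) x = c * x"
definition "cinner_complex (x::complex) y = cnj x * y"

instance
  by standard
    (auto simp: scaleC_complex_def cinner_complex_def inner_complex_def algebra_simps
      complex_eq_iff)

end

section \<open>Unbounded operators\<close>

text \<open>An operator is identified with its graph, so that its domain is the library's
  \<^const>\<open>Domain\<close>, and the graph topology of the domain is the topology which the graph inherits
  from the product space.\<close>

type_synonym 'a operator = "('a \<times> 'a) set"

definition app :: "'a operator \<Rightarrow> 'a \<Rightarrow> 'a"  (infixr \<open>\<cdot>\<close> 80) where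
  "T \<cdot> u = (THE w. (u, w) \<in> T)"

definition linear_operator :: "'a::complex_hilbert operator \<Rightarrow> bool" where
  "linear_operator T \<longleftrightarrow> single_valued T \<and> (0, 0) \<in> T \<and>
     (\<forall>u w u' w'. (u, w) \<in> T \<longrightarrow> (u', w') \<in> T \<longrightarrow> (u + u', w + w') \<in> T) \<and>
     (\<forall>c u w. (u, w) \<in> T \<longrightarrow> (c *\<^sub>C u, c *\<^sub>C w) \<in> T)"

definition adjoint_op :: "'a::complex_hilbert operator \<Rightarrow> 'a operator" where
  "adjoint_op T = {(v, w). \<forall>u\<in>Domain T. cinner v (T \<cdot> u) = cinner w u}"

definition selfadjoint :: "'a::complex_hilbert operator \<Rightarrow> bool" where
  "selfadjoint T \<longleftrightarrow> linear_operator T \<and> closure (Domain T) = UNIV \<and> adjoint_op T = T"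

definition resolvent :: "'a::complex_hilbert operator \<Rightarrow> complex \<Rightarrow> 'a \<Rightarrow> 'a" where
  "resolvent T z = inv_into (Domain T) (\<lambda>u. T \<cdot> u - z *\<^sub>C u)"

definition resolvent_set :: "'a::complex_hilbert operator \<Rightarrow> complex set" where
  "resolvent_set T = {z. bij_betw (\<lambda>u. T \<cdot> u - z *\<^sub>C u) (Domain T) UNIV \<and>
     bounded_linear (resolvent T z)}"

section \<open>Functional calculus\<close>

definition orthogonal_projection :: "('a::complex_hilbert \<Rightarrow> 'a) \<Rightarrow> bool" where
  "orthogonal_projection P \<longleftrightarrow> bounded_linear P \<and> (\<forall>c u. P (c *\<^sub>C u) = c *\<^sub>C P u) \<and>
     (\<forall>u. P (P u) = P u) \<and> (\<forall>u v. cinner (P u) v = cinner u (P v))"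

definition projection_valued_measure :: "(real set \<Rightarrow> 'a::complex_hilbert \<Rightarrow> 'a) \<Rightarrow> bool" where
  "projection_valued_measure E \<longleftrightarrow>
     (\<forall>S\<in>sets borel. orthogonal_projection (E S)) \<and>
     E {} = (\<lambda>u. 0) \<and> E UNIV = (\<lambda>u. u) \<and>
     (\<forall>S\<in>sets borel. \<forall>S'\<in>sets borel. E (S \<inter> S') = E S \<circ> E S') \<and>
     (\<forall>F. range F \<subseteq> sets borel \<longrightarrow> disjoint_family F \<longrightarrow>
        (\<forall>u. (\<lambda>n. E (F n) u) sums E (\<Union>n. F n) u))"

text \<open>The scalar measure of \<open>S\<close> is \<open>\<langle>v, E S v\<rangle> = (norm (E S v))\<^sup>2\<close>.\<close>

definition scalar_spectral_measure ::
    "(real set \<Rightarrow> 'a::complex_hilbert \<Rightarrow> 'a) \<Rightarrow> 'a \<Rightarrow> real measure" where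
  "scalar_spectral_measure E v =
     measure_of UNIV (sets borel) (\<lambda>S. ennreal ((norm (E S v))\<^sup>2))"

definition simple_integral_pvm ::
    "(real set \<Rightarrow> 'a::complex_hilbert \<Rightarrow> 'a) \<Rightarrow> (real \<Rightarrow> complex) \<Rightarrow> 'a \<Rightarrow> 'a" where
  "simple_integral_pvm E s v = (\<Sum>c\<in>range s. c *\<^sub>C E (s -` {c}) v)"

text \<open>The operator \<open>\<integral> f dE\<close>.  For simple \<open>s\<close>, the norm of \<open>(\<integral> s dE) v\<close> is the
  \<open>L\<^sup>2\<close>-norm of \<open>s\<close> with respect to the scalar measure of \<open>v\<close>, and \<open>(\<integral> f dE) v\<close> is obtained by
  approximating \<open>f\<close> by simple functions in this \<open>L\<^sup>2\<close>-space.  As simple functions are square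
  integrable, the domain consists of those \<open>v\<close> for which \<open>f\<close> is.\<close>

definition integral_pvm ::
    "(real set \<Rightarrow> 'a::complex_hilbert \<Rightarrow> 'a) \<Rightarrow> (real \<Rightarrow> complex) \<Rightarrow> 'a operator" where
  "integral_pvm E f = {(v, w). f \<in> borel_measurable borel \<and>
     (\<exists>s. (\<forall>n. simple_function borel (s n)) \<and>
        (\<lambda>n. \<integral>\<^sup>+x. ennreal ((cmod (s n x - f x))\<^sup>2) \<partial>scalar_spectral_measure E v) \<longlonglongrightarrow> 0 \<and>
        (\<lambda>n. simple_integral_pvm E (s n) v) \<longlonglongrightarrow> w)}"

definition spectral_measure_of ::
    "'a::complex_hilbert operator \<Rightarrow> (real set \<Rightarrow> 'a \<Rightarrow> 'a) \<Rightarrow> bool" where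
  "spectral_measure_of H E \<longleftrightarrow> projection_valued_measure E \<and> H = integral_pvm E complex_of_real"

text \<open>The operator \<open>f(H)\<close>.  The spectral measure of a self-adjoint operator is unique on Borel
  sets, so this graph is that of \<open>\<integral> f dE\<close> for the spectral measure \<open>E\<close> of \<open>H\<close>.\<close>

definition op_fun :: "(real \<Rightarrow> complex) \<Rightarrow> 'a::complex_hilbert operator \<Rightarrow> 'a operator" where
  "op_fun f H = {(v, w). \<exists>E. spectral_measure_of H E \<and> (v, w) \<in> integral_pvm E f}"

definition exp_i :: "real \<Rightarrow> 'a::complex_hilbert operator \<Rightarrow> 'a operator" where
  "exp_i t H = op_fun (\<lambda>x. exp (\<i> * complex_of_real (t * x))) H"

section \<open>Regularity with respect to an operator, commutators\<close>

definition bounded_class_C1 :: "'a::complex_hilbert operator \<Rightarrow> ('a \<Rightarrow> 'a) \<Rightarrow> bool" where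
  "bounded_class_C1 A S \<longleftrightarrow>
     continuous_on (Domain A \<times> Domain A)
       (\<lambda>(u, v). cinner (A \<cdot> u) (S v) - cinner u (S (A \<cdot> v)))"

definition class_C1 :: "'a::complex_hilbert operator \<Rightarrow> 'a operator \<Rightarrow> bool" where
  "class_C1 A H \<longleftrightarrow> (\<exists>z\<in>resolvent_set H. bounded_class_C1 A (resolvent H z))"

definition sesquilinear_on :: "'a::complex_hilbert set \<Rightarrow> ('a \<Rightarrow> 'a \<Rightarrow> complex) \<Rightarrow> bool" where
  "sesquilinear_on V B \<longleftrightarrow>
     (\<forall>u\<in>V. \<forall>v\<in>V. \<forall>w\<in>V. B u (v + w) = B u v + B u w \<and> B (u + v) w = B u w + B v w) \<and>
     (\<forall>c. \<forall>u\<in>V. \<forall>v\<in>V. B u (c *\<^sub>C v) = c * B u v \<and> B (c *\<^sub>C u) v = cnj c * B u v)"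

text \<open>\<open>[A, H]\<close> as a form on \<open>D(H)\<close>: the extension, continuous for the graph topology, of
  \<open>\<langle>Au, Hv\<rangle> - \<langle>Hu, Av\<rangle>\<close>.  It is meaningful when \<open>H\<close> is of class \<open>C\<^sup>1(A)\<close>, and then its values
  on \<open>D(H)\<close> are uniquely determined; outside \<open>D(H)\<close> they are arbitrary.\<close>

definition commutator_form ::
    "'a::complex_hilbert operator \<Rightarrow> 'a operator \<Rightarrow> 'a \<Rightarrow> 'a \<Rightarrow> complex" where
  "commutator_form A H = (SOME B. sesquilinear_on (Domain H) B \<and>
     continuous_on (H \<times> H) (\<lambda>(p, q). B (fst p) (fst q)) \<and>
     (\<forall>u\<in>Domain A \<inter> Domain H. \<forall>v\<in>Domain A \<inter> Domain H.
        B u v = cinner (A \<cdot> u) (H \<cdot> v) - cinner (H \<cdot> u) (A \<cdot> v)))"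

text \<open>\<open>H' = [H, iA] = i[H, A]\<close>, where \<open>[H, A] = -[A, H]\<close>.\<close>

definition derived_form ::
    "'a::complex_hilbert operator \<Rightarrow> 'a operator \<Rightarrow> 'a \<Rightarrow> 'a \<Rightarrow> complex" where
  "derived_form A H u v = \<i> * (- commutator_form A H u v)"

definition form_eq_operator_on ::
    "'a::complex_hilbert set \<Rightarrow> ('a \<Rightarrow> 'a \<Rightarrow> complex) \<Rightarrow> 'a operator \<Rightarrow> bool" where
  "form_eq_operator_on V B T \<longleftrightarrow>
     V \<subseteq> Domain T \<and> (\<forall>u\<in>V. \<forall>v\<in>V. B u v = cinner u (T \<cdot> v))"

section \<open>Time decay\<close>

definition psi :: "'a::complex_hilbert operator \<Rightarrow> 'a \<Rightarrow> real \<Rightarrow> complex" where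
  "psi H u t = cinner u (exp_i t H \<cdot> u)"

definition E_space :: "'a::complex_hilbert operator \<Rightarrow> 'a set" where
  "E_space H = {u. integrable lborel (\<lambda>t. (cmod (psi H u t))\<^sup>2)}"

definition bracket :: "real \<Rightarrow> real" where
  "bracket t = (1 + t\<^sup>2) powr (1 / 2)"

end

theory Submission
  imports Defs "HOL-Probability.Characteristic_Functions"
begin

text \<open>Write \<open>q\<^bsub>f\<^esub>(t) = \<langle>u, f(H) e\<^bsup>itH\<^esup> u\<rangle>\<close>.  The hypothesis \<open>[H, iA] = \<theta>(H)\<close> gives the chain rule
  \<open>[A, \<phi>(H)] = i \<phi>'(H) \<theta>(H)\<close>, first for the resolvent and then, by approximation, for every
  \<open>C\<^sup>1\<close> function with \<open>\<phi>\<close> and \<open>\<theta> \<phi>'\<close> bounded.  For \<open>\<phi>(x) = \<kappa>(x) e\<^bsup>itx\<^esup>\<close> and on the vector \<open>u\<close> it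
  expresses \<open>t q\<^bsub>\<theta>\<kappa>\<^esub>(t)\<close> through functions of \<open>t\<close> that are bounded, and square integrable if \<open>u\<close> and
  \<open>A u\<close> are in \<open>\<E>(H)\<close>.  Let \<open>\<chi>\<close> be a cutoff at \<open>0\<close>.  With \<open>\<kappa> = (1 - \<chi>) / \<theta>\<close> one gets
  \<open>q\<^bsub>1 - \<chi>\<^esub> = O(1/t)\<close>.  With \<open>\<kappa>(x) = \<chi>(x) x / \<theta>(x)\<close> one gets that \<open>F = q\<^bsub>\<chi>\<^esub>\<close> and \<open>t F'\<close> are
  square integrable, so the derivative of \<open>t |F|\<^sup>2\<close> is integrable and \<open>F = O(t\<^sup>-\<^sup>1\<^sup>/\<^sup>2)\<close>.\<close>

section \<open>Complex Hilbert spaces\<close>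

text \<open>What shapes the estimates is a possible zero of \<theta> at 0. Away from 0 the function
  \<open>1 / \<theta>\<close> is an admissible \<kappa> and gains a full power of t. Near 0 only
  \<open>x / \<theta>\<close> is admissible, so the commutator controls the transform with
  \<open>x * \<chi> x\<close> in place of \<chi>, which is \<open>F'\<close> up to the factor i; a
  power of t on \<open>F'\<close> buys only half a power on \<open>F\<close>. The commutator at u is
  the mixed expression \<open><Au, \<phi>(H) u> - <u, \<phi>(H) Au>\<close>, whereas the space E(H)
  speaks of diagonal matrix elements. Polarization brings in the vectors u, Au and
  \<open>u + i Au\<close>. Hence E(H) must be stable under sums, and square integrability must
  survive the insertion of a bounded function of H; both follow by comparing Gaussian averages of
  the scalar measures. In the chain rule \<theta> is unbounded, so the approximants must be close to
  \<phi> with a weighted bound on the derivatives. Laurent polynomials in the Cayley transform of H,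
  that is, polynomials in a resolvent and its adjoint, achieve this. The spectral measure of H is
  read off from the equality of forms, which forces \<open>op_fun\<close> to have a nonempty
  graph.\<close>

lemma scaleC_one [simp]: "1 *\<^sub>C x = x"
  using scaleR_scaleC[of 1 x] by simp

lemma scaleC_zero_left [simp]: "0 *\<^sub>C x = 0"
  using scaleR_scaleC[of 0 x] by simp

lemma scaleC_zero_right [simp]: "c *\<^sub>C 0 = 0"
  using scaleC_add_right[of c 0 0] by simp

lemma scaleC_minus_left: "(- c) *\<^sub>C x = - (c *\<^sub>C x)"
  using scaleC_add_left[of c "-c" x] by (simp add: eq_neg_iff_add_eq_0 add.commute)

lemma scaleC_minus_right: "c *\<^sub>C (- x) = - (c *\<^sub>C x)"
  using scaleC_add_right[of c x "-x"] by (simp add: eq_neg_iff_add_eq_0 add.commute)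

lemma scaleC_diff_right: "c *\<^sub>C (x - y) = c *\<^sub>C x - c *\<^sub>C y"
  using scaleC_add_right[of c x "-y"] by (simp add: scaleC_minus_right)

lemma scaleC_sum_right: "c *\<^sub>C (\<Sum>i\<in>I. f i) = (\<Sum>i\<in>I. c *\<^sub>C f i)"
  by (induction I rule: infinite_finite_induct) (auto simp: scaleC_add_right)

lemma cinner_add_left: "cinner (x + y) z = cinner x z + cinner y z"
  by (metis cinner_add_right cinner_commute complex_cnj_add)

lemma cinner_scaleC_left: "cinner (c *\<^sub>C x) y = cnj c * cinner x y"
  by (metis cinner_scaleC_right cinner_commute complex_cnj_mult)

lemma cinner_zero_right [simp]: "cinner x 0 = 0"
  using cinner_add_right[of x 0 0] by simp

lemma cinner_zero_left [simp]: "cinner 0 x = 0"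
  using cinner_add_left[of 0 0 x] by simp

lemma cinner_minus_right: "cinner x (- y) = - cinner x y"
  using cinner_add_right[of x y "-y"] by (simp add: eq_neg_iff_add_eq_0 add.commute)

lemma cinner_minus_left: "cinner (- x) y = - cinner x y"
  using cinner_add_left[of x "-x" y] by (simp add: eq_neg_iff_add_eq_0 add.commute)

lemma cinner_diff_right: "cinner x (y - z) = cinner x y - cinner x z"
  using cinner_add_right[of x y "-z"] by (simp add: cinner_minus_right)

lemma cinner_diff_left: "cinner (x - y) z = cinner x z - cinner y z"
  using cinner_add_left[of x "-y" z] by (simp add: cinner_minus_left)

lemma cinner_sum_right: "cinner x (\<Sum>i\<in>I. f i) = (\<Sum>i\<in>I. cinner x (f i))"
  by (induction I rule: infinite_finite_induct) (auto simp: cinner_add_right)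

lemma cinner_sum_left: "cinner (\<Sum>i\<in>I. f i) x = (\<Sum>i\<in>I. cinner (f i) x)"
  by (induction I rule: infinite_finite_induct) (auto simp: cinner_add_left)

lemma cinner_self: "cinner x x = complex_of_real ((norm x)\<^sup>2)"
proof -
  have "Im (cinner x x) = 0"
    using cinner_commute[of x x] by (metis complex_cnj_cancel_iff Reals_cnj_iff complex_is_Real_iff)
  moreover have "Re (cinner x x) = (norm x)\<^sup>2"
    by (simp add: inner_eq_Re_cinner[symmetric] power2_norm_eq_inner)
  ultimately show ?thesis by (simp add: complex_eq_iff)
qed

lemma norm_scaleC: "norm (c *\<^sub>C x) = cmod c * norm x"
proof -
  have "complex_of_real ((norm (c *\<^sub>C x))\<^sup>2) = (c * cnj c) * cinner x x"
    unfolding cinner_self[symmetric] cinner_scaleC_left cinner_scaleC_right by simp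
  also have "\<dots> = complex_of_real ((cmod c * norm x)\<^sup>2)"
    unfolding complex_norm_square[symmetric] cinner_self by (simp add: power_mult_distrib)
  finally have "complex_of_real ((norm (c *\<^sub>C x))\<^sup>2) = complex_of_real ((cmod c * norm x)\<^sup>2)" .
  hence "(norm (c *\<^sub>C x))\<^sup>2 = (cmod c * norm x)\<^sup>2"
    using of_real_eq_iff by blast
  thus ?thesis by (simp add: power2_eq_iff_nonneg)
qed

lemma cinner_norm: "cmod (cinner x y) \<le> norm x * norm y"
proof -
  \<comment> \<open>The phase that makes \<open>c * cinner x y\<close> real and nonnegative, so that
    the real Cauchy-Schwarz inequality applies. Its modulus is 0 if the inner product vanishes,
    hence only \<open>cmod c \<le> 1\<close>.\<close>
  define c where "c = cnj (sgn (cinner x y))"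
  have "cmod c \<le> 1" by (simp add: c_def norm_sgn)
  have "c * cinner x y = (cinner x y * cnj (cinner x y)) / complex_of_real (cmod (cinner x y))"
    unfolding c_def sgn_eq by simp
  also have "\<dots> = complex_of_real (cmod (cinner x y))"
    unfolding complex_norm_square[symmetric] by (simp add: power2_eq_square)
  finally have "c * cinner x y = complex_of_real (cmod (cinner x y))" .
  hence "cmod (cinner x y) = Re (cinner x (c *\<^sub>C y))" by (simp add: cinner_scaleC_right)
  also have "\<dots> = inner x (c *\<^sub>C y)" by (simp add: inner_eq_Re_cinner)
  also have "\<dots> \<le> norm x * norm (c *\<^sub>C y)" by (rule norm_cauchy_schwarz)
  also have "\<dots> \<le> norm x * (1 * norm y)"
    unfolding norm_scaleC by (intro mult_left_mono mult_right_mono \<open>cmod c \<le> 1\<close>) auto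
  finally show ?thesis by simp
qed

lemma cinner_scaleR_left: "cinner (r *\<^sub>R x) y = r *\<^sub>R cinner x y"
  unfolding scaleR_scaleC[of r x] cinner_scaleC_left by (simp add: scaleR_conv_of_real)

lemma cinner_scaleR_right: "cinner x (r *\<^sub>R y) = r *\<^sub>R cinner x y"
  unfolding scaleR_scaleC[of r y] cinner_scaleC_right by (simp add: scaleR_conv_of_real)

lemma bounded_bilinear_cinner: "bounded_bilinear (cinner :: 'a::complex_hilbert \<Rightarrow> _)"
proof
  show "\<exists>K. \<forall>a b::'a. norm (cinner a b) \<le> norm a * norm b * K"
    by (rule exI[of _ 1]) (simp add: cinner_norm)
qed (rule cinner_add_left cinner_add_right cinner_scaleR_left cinner_scaleR_right)+

lemmas tendsto_cinner = bounded_bilinear.tendsto[OF bounded_bilinear_cinner]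
lemmas continuous_on_cinner = bounded_bilinear.continuous_on[OF bounded_bilinear_cinner]

lemma bounded_linear_scaleC: "bounded_linear (\<lambda>x::'a::complex_hilbert. c *\<^sub>C x)"
  by (rule bounded_linear_intro[where K = "cmod c"])
    (simp_all add: scaleC_add_right scaleR_scaleC scaleC_scaleC norm_scaleC mult.commute)

lemmas tendsto_scaleC = bounded_linear.tendsto[OF bounded_linear_scaleC]

lemma cinner_eqI:
  fixes x y :: "'a::complex_hilbert"
  assumes "closure V = UNIV" "\<And>u. u \<in> V \<Longrightarrow> cinner u x = cinner u y"
  shows "x = y"
proof -
  have "x - y \<in> closure V" using assms(1) by simp
  then obtain f where f: "\<And>n. f n \<in> V" "f \<longlonglongrightarrow> x - y"
    unfolding closure_sequential by auto
  have "(\<lambda>n. cinner (f n) (x - y)) \<longlonglongrightarrow> cinner (x - y) (x - y)"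
    by (intro tendsto_cinner f tendsto_const)
  moreover have "cinner (f n) (x - y) = 0" for n
    using assms(2)[OF f(1)] by (simp add: cinner_diff_right)
  ultimately have "cinner (x - y) (x - y) = 0"
    using LIMSEQ_unique by (metis tendsto_const[of "0::complex"] ext)
  thus ?thesis by (simp add: cinner_self)
qed

text \<open>Along a sequence in V that tends to x itself the bound becomes
  \<open>norm x * norm x \<le> K * norm x\<close>.\<close>

lemma norm_le_of_cinner:
  fixes x :: "'a::complex_hilbert"
  assumes "closure V = UNIV" "\<And>u. u \<in> V \<Longrightarrow> cmod (cinner u x) \<le> K * norm u" "K \<ge> 0"
  shows "norm x \<le> K"
proof (cases "x = 0")
  case True
  thus ?thesis using assms(3) by simp
next
  case False
  have "x \<in> closure V" using assms(1) by simp
  then obtain f where f: "\<And>n. f n \<in> V" "f \<longlonglongrightarrow> x"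
    unfolding closure_sequential by auto
  have "(\<lambda>n. cmod (cinner (f n) x)) \<longlonglongrightarrow> cmod (cinner x x)"
    by (intro tendsto_norm tendsto_cinner f tendsto_const)
  moreover have "(\<lambda>n. K * norm (f n)) \<longlonglongrightarrow> K * norm x"
    by (intro tendsto_mult tendsto_norm f tendsto_const)
  ultimately have "cmod (cinner x x) \<le> K * norm x"
    by (rule LIMSEQ_le) (use assms(2)[OF f(1)] in auto)
  hence "norm x * norm x \<le> K * norm x" by (simp add: cinner_self power2_eq_square norm_mult)
  thus ?thesis using False by simp
qed

text \<open>The values of \<open>\<parallel>x\<parallel>\<^sup>2 - 2 Re f(x)\<close> on a minimizing sequence force it to be Cauchy by the
  parallelogram law.\<close>

lemma riesz_subspace:
  fixes f :: "'a::complex_hilbert \<Rightarrow> complex"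
  assumes V0: "0 \<in> V" and Vadd: "\<And>x y. x \<in> V \<Longrightarrow> y \<in> V \<Longrightarrow> x + y \<in> V"
    and Vsc: "\<And>c x. x \<in> V \<Longrightarrow> c *\<^sub>C x \<in> V"
    and fadd: "\<And>x y. x \<in> V \<Longrightarrow> y \<in> V \<Longrightarrow> f (x + y) = f x + f y"
    and fsc: "\<And>c x. x \<in> V \<Longrightarrow> f (c *\<^sub>C x) = c * f x"
    and bd: "\<And>x. x \<in> V \<Longrightarrow> cmod (f x) \<le> K * norm x"
  shows "\<exists>w\<in>closure V. \<forall>x\<in>V. cinner w x = f x"
proof -
  define J where "J x = (norm x)\<^sup>2 - 2 * Re (f x)" for x
  have Jlow: "J x \<ge> - K\<^sup>2" if "x \<in> V" for x
  proof -
    have "Re (f x) \<le> K * norm x" using bd[OF that] complex_Re_le_cmod[of "f x"] by linarith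
    moreover have "0 \<le> (norm x - K)\<^sup>2" by simp
    ultimately show ?thesis unfolding J_def by (simp add: power2_diff algebra_simps)
  qed
  define m where "m = Inf (J ` V)"
  have bddJ: "bdd_below (J ` V)" using Jlow by (intro bdd_belowI2)
  have mle: "m \<le> J x" if "x \<in> V" for x unfolding m_def using that bddJ by (auto intro: cInf_lower)
  have "\<exists>x\<in>V. J x < m + 1 / Suc n" for n :: nat
  proof -
    have "\<exists>y\<in>J ` V. y < m + 1 / Suc n"
      using cInf_lessD[of "J ` V" "m + 1 / Suc n"] V0 by (auto simp: m_def)
    thus ?thesis by auto
  qed
  then obtain x where x: "\<And>n. x n \<in> V" "\<And>n. J (x n) < m + 1 / Suc n" by metis
  have par: "(norm (y - z))\<^sup>2 \<le> 2 * (J y - m) + 2 * (J z - m)" if "y \<in> V" "z \<in> V" for y z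
  proof -
    have h: "(1/2) *\<^sub>C (y + z) \<in> V" by (intro Vsc Vadd that)
    have 1: "(norm (y - z))\<^sup>2 + (norm (y + z))\<^sup>2 = 2 * (norm y)\<^sup>2 + 2 * (norm z)\<^sup>2"
      by (simp add: power2_norm_eq_inner inner_simps inner_commute)
    have "(norm ((1/2) *\<^sub>C (y + z)))\<^sup>2 = (norm (y + z))\<^sup>2 / 4"
      by (simp add: norm_scaleC norm_divide power_divide)
    moreover have "f ((1/2) *\<^sub>C (y + z)) = (f y + f z) / 2"
      using that by (simp add: fsc fadd Vadd)
    ultimately have "J ((1/2) *\<^sub>C (y + z)) = (norm (y + z))\<^sup>2 / 4 - (Re (f y) + Re (f z))"
      unfolding J_def by (simp only:) (simp add: field_simps)
    with mle[OF h] have "4 * m \<le> (norm (y + z))\<^sup>2 - 4 * (Re (f y) + Re (f z))" by simp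
    thus ?thesis using 1 unfolding J_def by simp
  qed
  have "Cauchy x"
  proof (rule metric_CauchyI)
    fix e :: real assume "e > 0"
    then obtain N where N: "4 / e\<^sup>2 < real N" using reals_Archimedean2 by blast
    have "dist (x k) (x l) < e" if kl: "k \<ge> N" "l \<ge> N" for k l
    proof -
      have "0 < real N" using N \<open>e > 0\<close> by (metis divide_pos_pos less_trans zero_less_numeral zero_less_power)
      have "1 / Suc k \<le> 1 / real N" "1 / Suc l \<le> 1 / real N"
        using kl \<open>0 < real N\<close> by (auto intro!: divide_left_mono)
      hence "(norm (x k - x l))\<^sup>2 < 4 * (1 / N)"
        using par[OF x(1) x(1), of k l] x(2)[of k] x(2)[of l] by simp
      also have "4 * (1 / N) < e\<^sup>2" using N \<open>e > 0\<close> \<open>0 < real N\<close> by (simp add: field_simps)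
      finally show ?thesis using \<open>e > 0\<close> by (simp add: dist_norm power2_less_imp_less)
    qed
    thus "\<exists>M. \<forall>k\<ge>M. \<forall>l\<ge>M. dist (x k) (x l) < e" by blast
  qed
  then obtain w where w: "x \<longlonglongrightarrow> w" using Cauchy_convergent convergent_def by blast
  have Re_eq: "Re (cinner w h) = Re (f h)" if h: "h \<in> V" for h
  proof -
    have key: "2 * t * (Re (cinner w h) - Re (f h)) + t\<^sup>2 * (norm h)\<^sup>2 \<ge> 0" for t :: real
    proof -
      \<comment> \<open>The variation is made at \<open>x n\<close>, not at the limit: f is
        controlled on V only, while w lies in the closure. The defect \<open>1 / Suc n\<close>
        disappears in the limit.\<close>
      have *: "- (1 / Suc n) \<le> 2 * t * (inner (x n) h - Re (f h)) + t\<^sup>2 * (norm h)\<^sup>2" for n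
      proof -
        have e: "J (x n + complex_of_real t *\<^sub>C h) = J (x n) + 2 * t * (inner (x n) h - Re (f h)) + t\<^sup>2 * (norm h)\<^sup>2"
        proof -
          have "f (x n + complex_of_real t *\<^sub>C h) = f (x n) + t * f h"
            using x(1)[of n] h by (simp add: fadd fsc Vsc)
          moreover have "(norm (x n + complex_of_real t *\<^sub>C h))\<^sup>2
              = (norm (x n))\<^sup>2 + 2 * t * inner (x n) h + t\<^sup>2 * (norm h)\<^sup>2"
            unfolding scaleR_scaleC[symmetric] power2_norm_eq_inner
            by (simp add: inner_simps inner_commute algebra_simps power2_eq_square)
          ultimately show ?thesis unfolding J_def by (simp only:) (simp add: algebra_simps)
        qed
        have "m \<le> J (x n + complex_of_real t *\<^sub>C h)" by (intro mle Vadd Vsc x h)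
        thus ?thesis using x(2)[of n] unfolding e by simp
      qed
      have l1: "(\<lambda>n. - (1 / real (Suc n))) \<longlonglongrightarrow> - 0"
        by (intro tendsto_minus LIMSEQ_Suc lim_1_over_n)
      have l2: "(\<lambda>n. 2 * t * (inner (x n) h - Re (f h)) + t\<^sup>2 * (norm h)\<^sup>2) \<longlonglongrightarrow> 2 * t * (inner w h - Re (f h)) + t\<^sup>2 * (norm h)\<^sup>2"
        by (intro tendsto_intros w)
      show ?thesis using LIMSEQ_le[OF l1 l2] * by (auto simp: inner_eq_Re_cinner)
    qed
    define a where "a = Re (cinner w h) - Re (f h)"
    \<comment> \<open>The choice \<open>t = - a / q\<close> nearly minimizes the quadratic
      \<open>key\<close>; the added 1 keeps q positive when \<open>h = 0\<close>.\<close>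
    define q where "q = (norm h)\<^sup>2 + 1"
    have "q > 0" by (simp add: q_def add_nonneg_pos)
    have "0 \<le> 2 * (- a / q) * a + (- a / q)\<^sup>2 * (norm h)\<^sup>2" using key[of "- a / q"] by (simp add: a_def)
    also have "\<dots> \<le> 2 * (- a / q) * a + (- a / q)\<^sup>2 * q" by (simp add: q_def mult_left_mono)
    also have "\<dots> = - (a\<^sup>2 / q)" using \<open>q > 0\<close> by (simp add: field_simps power2_eq_square)
    finally have "a\<^sup>2 / q \<le> 0" by simp
    hence "a\<^sup>2 \<le> 0" using \<open>q > 0\<close> by (simp add: divide_le_0_iff)
    thus ?thesis by (simp add: a_def)
  qed
  have "cinner w h = f h" if h: "h \<in> V" for h
  proof -
    \<comment> \<open>By linearity, the real part at \<open>-i h\<close> is the imaginary part at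
      h.\<close>
    have "Re (cinner w ((-\<i>) *\<^sub>C h)) = Re (f ((-\<i>) *\<^sub>C h))" by (intro Re_eq Vsc h)
    hence "Im (cinner w h) = Im (f h)" using h by (simp add: cinner_scaleC_right fsc)
    with Re_eq[OF h] show ?thesis by (simp add: complex_eq_iff)
  qed
  moreover have "w \<in> closure V" using w x(1) unfolding closure_sequential by blast
  ultimately show ?thesis by blast
qed

section \<open>Functional calculus of a projection-valued measure\<close>

definition bounded_borel :: "(real \<Rightarrow> complex) \<Rightarrow> bool" where
  "bounded_borel f \<longleftrightarrow> f \<in> borel_measurable borel \<and> bounded (range f)"

lemma bounded_borelI:
  "f \<in> borel_measurable borel \<Longrightarrow> (\<And>x. cmod (f x) \<le> K) \<Longrightarrow> bounded_borel f"
  by (auto simp: bounded_borel_def intro!: boundedI[where B = K])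

lemma bounded_borelE:
  assumes "bounded_borel f"
  obtains K where "f \<in> borel_measurable borel" "\<And>x. cmod (f x) \<le> K" "K \<ge> 0"
proof -
  obtain K where K: "\<forall>y\<in>range f. norm y \<le> K"
    using assms by (auto simp: bounded_borel_def bounded_iff)
  hence "cmod (f 0) \<le> K" by blast
  hence "0 \<le> K" using norm_ge_zero order_trans by blast
  thus thesis using that[of K] K assms by (auto simp: bounded_borel_def)
qed

lemma bounded_borel_meas: "bounded_borel f \<Longrightarrow> f \<in> borel_measurable borel"
  by (simp add: bounded_borel_def)

lemma bounded_borel_const [simp]: "bounded_borel (\<lambda>x. c)"
  by (rule bounded_borelI[where K = "cmod c"]) auto

lemma bounded_borel_add:
  assumes "bounded_borel f" "bounded_borel g" shows "bounded_borel (\<lambda>x. f x + g x)"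
proof -
  obtain K where K: "f \<in> borel_measurable borel" "\<And>x. cmod (f x) \<le> K" "K \<ge> 0"
    using bounded_borelE[OF assms(1)] by blast
  obtain L where L: "g \<in> borel_measurable borel" "\<And>x. cmod (g x) \<le> L" "L \<ge> 0"
    using bounded_borelE[OF assms(2)] by blast
  show ?thesis
    by (rule bounded_borelI[where K = "K + L"])
      (use K L in \<open>auto intro!: order_trans[OF norm_triangle_ineq] add_mono\<close>)
qed

lemma bounded_borel_mult:
  assumes "bounded_borel f" "bounded_borel g" shows "bounded_borel (\<lambda>x. f x * g x)"
proof -
  obtain K where K: "f \<in> borel_measurable borel" "\<And>x. cmod (f x) \<le> K" "K \<ge> 0"
    using bounded_borelE[OF assms(1)] by blast
  obtain L where L: "g \<in> borel_measurable borel" "\<And>x. cmod (g x) \<le> L" "L \<ge> 0"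
    using bounded_borelE[OF assms(2)] by blast
  show ?thesis
    by (rule bounded_borelI[where K = "K * L"])
      (use K L in \<open>auto simp: norm_mult intro!: mult_mono\<close>)
qed

lemma bounded_borel_cnj: "bounded_borel f \<Longrightarrow> bounded_borel (\<lambda>x. cnj (f x))"
  by (erule bounded_borelE, rule bounded_borelI)
    (auto intro!: measurable_compose[OF _ borel_measurable_continuous_onI[OF continuous_on_cnj[OF continuous_on_id]]])

lemma bounded_borel_cmult: "bounded_borel f \<Longrightarrow> bounded_borel (\<lambda>x. c * f x)"
  by (intro bounded_borel_mult bounded_borel_const)

lemma bounded_borel_minus: "bounded_borel f \<Longrightarrow> bounded_borel (\<lambda>x. - f x)"
  using bounded_borel_cmult[of f "-1"] by simp

lemma bounded_borel_diff:
  "bounded_borel f \<Longrightarrow> bounded_borel g \<Longrightarrow> bounded_borel (\<lambda>x. f x - g x)"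
  using bounded_borel_add[of f "\<lambda>x. - g x"] bounded_borel_minus[of g] by simp

lemma bounded_borel_indicator [simp]: "S \<in> sets borel \<Longrightarrow> bounded_borel (indicator S)"
  by (rule bounded_borelI[where K = 1]) (auto simp: indicator_def)

lemmas bounded_borel_intros = bounded_borel_const bounded_borel_add bounded_borel_mult
  bounded_borel_cnj bounded_borel_minus bounded_borel_diff

lemma simple_function_bounded_borel:
  assumes "simple_function borel s" shows "bounded_borel s"
  using assms borel_measurable_simple_function[OF assms]
  by (auto simp: bounded_borel_def simple_function_def intro: finite_imp_bounded)

lemma simple_function_borelD:
  assumes "simple_function borel (h :: real \<Rightarrow> 'b)"
  shows "finite (range h)" "h -` {y} \<in> sets borel"
proof -
  show "finite (range h)" using assms by (simp add: simple_function_def)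
  show "h -` {y} \<in> sets borel"
  proof (cases "y \<in> range h")
    case True thus ?thesis using assms by (auto simp: simple_function_def)
  next
    case False
    hence "h -` {y} = {}" by auto
    thus ?thesis by simp
  qed
qed

lemma bounded_borel_simple_approx:
  assumes "bounded_borel f"
  obtains s K where "\<And>n. simple_function borel (s n)" "\<And>n x. cmod (s n x) \<le> K"
    "\<And>x. (\<lambda>n. s n x) \<longlonglongrightarrow> f x"
proof -
  obtain K where K: "f \<in> borel_measurable borel" "\<And>x. cmod (f x) \<le> K" "K \<ge> 0"
    using bounded_borelE[OF assms] by blast
  obtain s where s: "\<And>i. simple_function borel (s i)" "\<And>x. (\<lambda>i. s i x) \<longlonglongrightarrow> f x"
    "\<And>i x. dist (s i x) 0 \<le> 2 * dist (f x) 0"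
    using borel_measurable_implies_sequence_metric[OF K(1), of 0] by auto
  show thesis
  proof (rule that[of s "2 * K"])
    show "cmod (s n x) \<le> 2 * K" for n x using s(3)[of n x] K(2)[of x] by simp
  qed (use s in auto)
qed

lemma ennreal_power2_tendsto_0D:
  assumes "(\<lambda>n. ennreal ((a n)\<^sup>2)) \<longlonglongrightarrow> 0"
  shows "(a :: nat \<Rightarrow> real) \<longlonglongrightarrow> 0"
proof -
  have "(\<lambda>n. (a n)\<^sup>2) \<longlonglongrightarrow> 0"
  proof -
    have "(\<lambda>n. ennreal ((a n)\<^sup>2)) \<longlonglongrightarrow> ennreal 0" using assms by simp
    thus ?thesis by (subst (asm) tendsto_ennreal_iff) auto
  qed
  hence "(\<lambda>n. sqrt ((a n)\<^sup>2)) \<longlonglongrightarrow> sqrt 0" by (rule tendsto_real_sqrt)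
  thus ?thesis by (simp add: tendsto_rabs_zero_iff)
qed

section \<open>Projection-valued measures and their scalar measures\<close>

locale pvm =
  fixes E :: "real set \<Rightarrow> 'a::complex_hilbert \<Rightarrow> 'a"
  assumes pvm: "projection_valued_measure E"
begin

lemma E_proj: "S \<in> sets borel \<Longrightarrow> orthogonal_projection (E S)"
  using pvm by (simp add: projection_valued_measure_def)

lemma E_bounded_linear: "S \<in> sets borel \<Longrightarrow> bounded_linear (E S)"
  using E_proj by (simp add: orthogonal_projection_def)

lemma E_scaleC: "S \<in> sets borel \<Longrightarrow> E S (c *\<^sub>C u) = c *\<^sub>C E S u"
  using E_proj by (simp add: orthogonal_projection_def)

lemma E_idem: "S \<in> sets borel \<Longrightarrow> E S (E S u) = E S u"
  using E_proj by (simp add: orthogonal_projection_def)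

lemma E_sym: "S \<in> sets borel \<Longrightarrow> cinner (E S u) v = cinner u (E S v)"
  using E_proj by (simp add: orthogonal_projection_def)

lemma E_empty [simp]: "E {} u = 0"
  using pvm by (simp add: projection_valued_measure_def)

lemma E_UNIV [simp]: "E UNIV u = u"
  using pvm by (simp add: projection_valued_measure_def)

lemma E_Int: "S \<in> sets borel \<Longrightarrow> S' \<in> sets borel \<Longrightarrow> E S (E S' u) = E (S \<inter> S') u"
  using pvm by (simp add: projection_valued_measure_def)

lemma E_sums:
  "range F \<subseteq> sets borel \<Longrightarrow> disjoint_family F \<Longrightarrow> (\<lambda>n. E (F n) u) sums E (\<Union>n. F n) u"
  using pvm by (simp add: projection_valued_measure_def)

lemma E_Un:
  assumes "A \<in> sets borel" "B \<in> sets borel" "A \<inter> B = {}"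
  shows "E (A \<union> B) u = E A u + E B u"
proof -
  have "(\<lambda>n. E (binaryset A B n) u) sums E (\<Union>n. binaryset A B n) u"
    using assms by (intro E_sums) (auto simp: range_binaryset_eq disjoint_family_on_def binaryset_def)
  moreover have "(\<lambda>n. E (binaryset A B n) u) sums (E A u + E B u)"
    using binaryset_sums[of "\<lambda>S. E S u" A B] by simp
  ultimately show ?thesis by (simp add: UN_binaryset_eq sums_unique2)
qed

lemma E_finite_Union:
  assumes "finite I" "\<And>i. i \<in> I \<Longrightarrow> A i \<in> sets borel" "disjoint_family_on A I"
  shows "E (\<Union>i\<in>I. A i) u = (\<Sum>i\<in>I. E (A i) u)"
  using assms
proof (induction I)
  case (insert i I)
  have "A i \<inter> (\<Union>i\<in>I. A i) = {}"
    using insert.hyps insert.prems by (fastforce simp: disjoint_family_on_def)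
  moreover have "disjoint_family_on A I"
    using insert.prems by (auto simp: disjoint_family_on_def)
  moreover have "(\<Union>i\<in>I. A i) \<in> sets borel"
    using insert.hyps insert.prems by (intro sets.finite_UN) auto
  ultimately show ?case using insert by (simp add: E_Un)
qed simp

lemma cinner_E: "S \<in> sets borel \<Longrightarrow> cinner v (E S v) = complex_of_real ((norm (E S v))\<^sup>2)"
  by (metis E_idem E_sym cinner_self)

abbreviation mu :: "'a \<Rightarrow> real measure" where "mu \<equiv> scalar_spectral_measure E"

lemma space_mu [simp]: "space (mu v) = UNIV"
  by (simp add: scalar_spectral_measure_def)

lemma sets_mu [simp, measurable_cong]: "sets (mu v) = sets borel"
  using sets.sigma_sets_eq[of "borel :: real measure"]
  by (simp add: scalar_spectral_measure_def)

text \<open>The quadratic expression is linear in the projection, as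
  \<open>(norm (E S v))\<^sup>2 = inner v (E S v)\<close>; countable additivity is therefore
  inherited from the strong convergence in \<open>E_sums\<close>.\<close>

lemma emeasure_mu:
  assumes "S \<in> sets borel"
  shows "emeasure (mu v) S = ennreal ((norm (E S v))\<^sup>2)"
proof (rule emeasure_measure_of[OF scalar_spectral_measure_def])
  show "positive (sets (mu v)) (\<lambda>S. ennreal ((norm (E S v))\<^sup>2))"
    by (simp add: positive_def)
  show "countably_additive (sets (mu v)) (\<lambda>S. ennreal ((norm (E S v))\<^sup>2))"
  proof (rule countably_additiveI)
    fix F :: "nat \<Rightarrow> real set"
    assume F: "range F \<subseteq> sets (mu v)" "disjoint_family F" "\<Union> (range F) \<in> sets (mu v)"
    have Fm: "F n \<in> sets borel" for n using F(1) by auto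
    have "(\<lambda>n. inner v (E (F n) v)) sums inner v (E (\<Union>n. F n) v)"
      using F by (intro bounded_linear.sums[OF bounded_linear_inner_right] E_sums) auto
    hence "(\<lambda>n. (norm (E (F n) v))\<^sup>2) sums (norm (E (\<Union>n. F n) v))\<^sup>2"
      using Fm F(3) by (simp add: inner_eq_Re_cinner cinner_E)
    thus "(\<Sum>n. ennreal ((norm (E (F n) v))\<^sup>2)) = ennreal ((norm (E (\<Union> (range F)) v))\<^sup>2)"
      by (intro suminf_ennreal_eq) auto
  qed
qed (use assms in auto)

lemma finite_measure_mu: "finite_measure (mu v)"
  by (rule finite_measureI) (simp add: emeasure_mu)

lemma measure_mu: "S \<in> sets borel \<Longrightarrow> measure (mu v) S = (norm (E S v))\<^sup>2"
  by (simp add: measure_def emeasure_mu)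

lemma integrable_mu: "bounded_borel f \<Longrightarrow> integrable (mu v) f"
  by (erule bounded_borelE, rule finite_measure.integrable_const_bound[OF finite_measure_mu])
    (auto simp: measurable_cong_sets[OF sets_mu refl])

section \<open>Integration of simple functions\<close>

abbreviation T :: "(real \<Rightarrow> complex) \<Rightarrow> 'a \<Rightarrow> 'a" where "T \<equiv> simple_integral_pvm E"

text \<open>Allows the integral to be computed over any finer partition. With h the pair of two
  simple functions, both are expressed over common level sets, and sums and products become
  coordinatewise.\<close>

lemma T_comp:
  fixes h :: "real \<Rightarrow> 'b" and k :: "'b \<Rightarrow> complex"
  assumes h: "simple_function borel h"
  shows "T (\<lambda>x. k (h x)) v = (\<Sum>y\<in>range h. k y *\<^sub>C E (h -` {y}) v)"
proof -
  note hD = simple_function_borelD[OF h]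
  have "T (\<lambda>x. k (h x)) v = (\<Sum>c\<in>k ` range h. c *\<^sub>C E ((\<lambda>x. k (h x)) -` {c}) v)"
    unfolding simple_integral_pvm_def by (simp add: image_image)
  also have "\<dots> = (\<Sum>c\<in>k ` range h. \<Sum>y\<in>{y\<in>range h. k y = c}. k y *\<^sub>C E (h -` {y}) v)"
  proof (rule sum.cong[OF refl])
    fix c assume "c \<in> k ` range h"
    have "(\<lambda>x. k (h x)) -` {c} = (\<Union>y\<in>{y\<in>range h. k y = c}. h -` {y})" by auto
    also have "E \<dots> v = (\<Sum>y\<in>{y\<in>range h. k y = c}. E (h -` {y}) v)"
      using hD by (intro E_finite_Union) (auto simp: disjoint_family_on_def)
    finally show "c *\<^sub>C E ((\<lambda>x. k (h x)) -` {c}) v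
        = (\<Sum>y\<in>{y\<in>range h. k y = c}. k y *\<^sub>C E (h -` {y}) v)"
      by (simp add: scaleC_sum_right)
  qed
  also have "\<dots> = (\<Sum>y\<in>range h. k y *\<^sub>C E (h -` {y}) v)"
    by (rule sum.image_gen[OF hD(1), symmetric])
  finally show ?thesis .
qed

lemma T_add:
  assumes "simple_function borel s" "simple_function borel t"
  shows "T (\<lambda>x. s x + t x) v = T s v + T t v"
proof -
  have h: "simple_function borel (\<lambda>x. (s x, t x))" by (intro simple_function_Pair assms)
  show ?thesis
    using T_comp[OF h, of "\<lambda>p. fst p + snd p" v] T_comp[OF h, of fst v] T_comp[OF h, of snd v]
    by (simp add: scaleC_add_left sum.distrib)
qed

lemma T_scale: "simple_function borel s \<Longrightarrow> T (\<lambda>x. c * s x) v = c *\<^sub>C T s v"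
  using T_comp[of s "\<lambda>y. c * y" v] T_comp[of s "\<lambda>y. y" v]
  by (simp add: scaleC_sum_right scaleC_scaleC)

lemma T_diff:
  assumes "simple_function borel s" "simple_function borel t"
  shows "T (\<lambda>x. s x - t x) v = T s v - T t v"
proof -
  have "simple_function borel (\<lambda>x. -1 * t x)"
    using assms(2) by (rule simple_function_compose1)
  from T_add[OF assms(1) this, of v] T_scale[OF assms(2), of "-1" v]
  show ?thesis by (simp add: scaleC_minus_left)
qed

lemma T_mult:
  assumes "simple_function borel s" "simple_function borel t"
  shows "T (\<lambda>x. s x * t x) v = T s (T t v)"
proof -
  define h where "h = (\<lambda>x. (s x, t x))"
  have h: "simple_function borel h" unfolding h_def by (intro simple_function_Pair assms)
  note hD = simple_function_borelD[OF h]
  have s: "s = (\<lambda>x. fst (h x))" and t: "t = (\<lambda>x. snd (h x))" by (auto simp: h_def)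
  \<comment> \<open>Distinct level sets are disjoint, so the double sum over \<open>range h\<close>
    collapses to its diagonal.\<close>
  have EE: "E (h -` {y}) (E (h -` {z}) v) = (if y = z then E (h -` {y}) v else 0)" for y z
  proof -
    have "h -` {y} \<inter> h -` {z} = (if y = z then h -` {y} else {})" by auto
    thus ?thesis using hD(2) by (simp add: E_Int split: if_splits)
  qed
  have "T s (T t v) = (\<Sum>y\<in>range h. fst y *\<^sub>C E (h -` {y}) (\<Sum>z\<in>range h. snd z *\<^sub>C E (h -` {z}) v))"
    unfolding s t by (simp only: T_comp[OF h, of fst] T_comp[OF h, of snd])
  also have "\<dots> = (\<Sum>y\<in>range h. \<Sum>z\<in>range h. (fst y * snd z) *\<^sub>C E (h -` {y}) (E (h -` {z}) v))"
    using hD(2)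
    by (simp add: linear_sum[OF bounded_linear.linear[OF E_bounded_linear]] E_scaleC
        scaleC_sum_right scaleC_scaleC)
  also have "\<dots> = (\<Sum>y\<in>range h. (fst y * snd y) *\<^sub>C E (h -` {y}) v)"
  proof (rule sum.cong[OF refl])
    fix y assume y: "y \<in> range h"
    have "(\<Sum>z\<in>range h. (fst y * snd z) *\<^sub>C E (h -` {y}) (E (h -` {z}) v)) =
        (\<Sum>z\<in>range h. if y = z then (fst y * snd z) *\<^sub>C E (h -` {y}) v else 0)"
      by (intro sum.cong) (auto simp: EE)
    thus "(\<Sum>z\<in>range h. (fst y * snd z) *\<^sub>C E (h -` {y}) (E (h -` {z}) v)) =
        (fst y * snd y) *\<^sub>C E (h -` {y}) v"
      using y hD(1) by simp
  qed
  also have "\<dots> = T (\<lambda>x. s x * t x) v"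
    unfolding s t by (rule T_comp[OF h, of "\<lambda>p. fst p * snd p", symmetric])
  finally show ?thesis by simp
qed

lemma T_linear:
  assumes "simple_function borel s"
  shows "T s (u + v) = T s u + T s v" "T s (c *\<^sub>C u) = c *\<^sub>C T s u"
  using simple_function_borelD(2)[OF assms] unfolding simple_integral_pvm_def
  by (simp_all add: linear_add[OF bounded_linear.linear[OF E_bounded_linear]] scaleC_add_right
      sum.distrib E_scaleC scaleC_sum_right scaleC_scaleC mult.commute)

lemma T_adj:
  assumes "simple_function borel s"
  shows "cinner u (T s v) = cinner (T (\<lambda>x. cnj (s x)) u) v"
  using simple_function_borelD(2)[OF assms]
  unfolding T_comp[OF assms, of cnj] T_comp[OF assms, of "\<lambda>y. y", simplified]
  by (simp add: cinner_sum_left cinner_sum_right cinner_scaleC_left cinner_scaleC_right E_sym)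

lemma T_integral:
  assumes "simple_function borel s"
  shows "cinner v (T s v) = integral\<^sup>L (mu v) s"
proof -
  note sD = simple_function_borelD[OF assms]
  have "s x = (\<Sum>y\<in>range s. y * indicator (s -` {y}) x)" for x
  proof -
    have "(\<Sum>y\<in>range s. y * indicator (s -` {y}) x) = (\<Sum>y\<in>range s. if s x = y then y else 0)"
      by (intro sum.cong) (auto simp: indicator_def)
    thus ?thesis using sD(1) by simp
  qed
  hence "integral\<^sup>L (mu v) s = (\<integral>x. (\<Sum>y\<in>range s. y * indicator (s -` {y}) x) \<partial>mu v)"
    by (rule Bochner_Integration.integral_cong[OF refl])
  also have "\<dots> = (\<Sum>y\<in>range s. \<integral>x. y * indicator (s -` {y}) x \<partial>mu v)"
    using sD(2) by (intro Bochner_Integration.integral_sum integrable_mu bounded_borel_mult) auto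
  also have "\<dots> = (\<Sum>y\<in>range s. y * complex_of_real (measure (mu v) (s -` {y})))"
  proof (rule sum.cong[OF refl])
    fix y
    have "(\<integral>x. y * indicator (s -` {y}) x \<partial>mu v) = (\<integral>x. indicator (s -` {y}) x *\<^sub>R y \<partial>mu v)"
      by (intro Bochner_Integration.integral_cong) (auto simp: indicator_def)
    also have "\<dots> = measure (mu v) (s -` {y}) *\<^sub>R y"
      using sD(2)[of y] finite_measure.emeasure_finite[OF finite_measure_mu, of v "s -` {y}"]
      by (subst integral_scaleR_left) (auto simp: less_top)
    finally show "(\<integral>x. y * indicator (s -` {y}) x \<partial>mu v) = y * complex_of_real (measure (mu v) (s -` {y}))"
      by (simp add: scaleR_conv_of_real mult.commute)
  qed
  also have "\<dots> = cinner v (T s v)"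
    using sD(2) by (simp add: simple_integral_pvm_def cinner_sum_right cinner_scaleC_right
        cinner_E measure_mu)
  finally show ?thesis by simp
qed

text \<open>Adjoint, multiplicativity and \<open>T_integral\<close> combine to the isometry between
  the L2-space of \<open>mu v\<close> and the Hilbert space; every limit below rests on it.\<close>

lemma T_norm:
  assumes "simple_function borel s"
  shows "(norm (T s v))\<^sup>2 = (\<integral>x. (cmod (s x))\<^sup>2 \<partial>mu v)"
proof -
  have s': "simple_function borel (\<lambda>x. cnj (s x))"
    using assms by (rule simple_function_compose1)
  have s'': "simple_function borel (\<lambda>x. cnj (s x) * s x)"
    using assms by (rule simple_function_compose1)
  have "complex_of_real ((norm (T s v))\<^sup>2) = cinner (T s v) (T s v)" by (simp add: cinner_self)
  also have "\<dots> = cinner v (T (\<lambda>x. cnj (s x)) (T s v))"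
    by (simp add: T_adj[OF s'])
  also have "\<dots> = (\<integral>x. cnj (s x) * s x \<partial>mu v)"
    by (simp add: T_mult[OF s' assms, symmetric] T_integral[OF s''])
  also have "\<dots> = (\<integral>x. complex_of_real ((cmod (s x))\<^sup>2) \<partial>mu v)"
    by (intro Bochner_Integration.integral_cong refl) (simp only: complex_norm_square mult.commute)
  also have "\<dots> = complex_of_real (\<integral>x. (cmod (s x))\<^sup>2 \<partial>mu v)"
    by (rule integral_complex_of_real)
  finally show ?thesis using of_real_eq_iff by blast
qed

lemma T_nn_norm:
  assumes "simple_function borel s" "simple_function borel t"
  shows "ennreal ((norm (T s v - T t v))\<^sup>2) = (\<integral>\<^sup>+x. ennreal ((cmod (s x - t x))\<^sup>2) \<partial>mu v)"
proof -
  have d: "simple_function borel (\<lambda>x. s x - t x)" by (intro simple_function_diff assms)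
  have "bounded_borel (\<lambda>x. complex_of_real ((cmod (s x - t x))\<^sup>2))"
    using d by (intro simple_function_bounded_borel) (rule simple_function_compose1)
  hence "integrable (mu v) (\<lambda>x. complex_of_real ((cmod (s x - t x))\<^sup>2))"
    by (rule integrable_mu)
  hence "integrable (mu v) (\<lambda>x. (cmod (s x - t x))\<^sup>2)"
    by (simp only: complex_of_real_integrable_eq)
  thus ?thesis by (simp add: T_diff[OF assms, symmetric] T_norm[OF d] nn_integral_eq_integral)
qed

text \<open>Compares two approximations of f through f itself, by
  \<open>(a + b)\<^sup>2 \<le> 2 * a\<^sup>2 + 2 * b\<^sup>2\<close>. Stated in the extended reals,
  it presupposes no square integrability. It yields both the uniqueness of the limit and the Cauchy
  property.\<close>

lemma T_close:
  assumes s: "\<And>n. simple_function borel (s n)" and t: "\<And>n. simple_function borel (t n)"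
    and f: "f \<in> borel_measurable borel"
  shows "ennreal ((norm (T (s m) v - T (t n) v))\<^sup>2) \<le>
     2 * (\<integral>\<^sup>+x. ennreal ((cmod (s m x - f x))\<^sup>2) \<partial>mu v) +
     2 * (\<integral>\<^sup>+x. ennreal ((cmod (t n x - f x))\<^sup>2) \<partial>mu v)"
proof -
  note [measurable] = borel_measurable_simple_function[OF s] borel_measurable_simple_function[OF t] f
  have "(\<integral>\<^sup>+x. ennreal ((cmod (s m x - t n x))\<^sup>2) \<partial>mu v) \<le>
    (\<integral>\<^sup>+x. 2 * ennreal ((cmod (s m x - f x))\<^sup>2) + 2 * ennreal ((cmod (t n x - f x))\<^sup>2) \<partial>mu v)"
  proof (rule nn_integral_mono)
    fix x
    define a where "a = cmod (s m x - f x)"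
    define b where "b = cmod (t n x - f x)"
    have "cmod (s m x - t n x) \<le> a + b"
      unfolding a_def b_def using norm_triangle_ineq4[of "s m x - f x" "t n x - f x"] by simp
    hence "(cmod (s m x - t n x))\<^sup>2 \<le> (a + b)\<^sup>2" by (intro power_mono) auto
    also have "\<dots> \<le> 2 * a\<^sup>2 + 2 * b\<^sup>2" using zero_le_power2[of "a - b"] by (simp add: power2_sum power2_diff)
    finally have "ennreal ((cmod (s m x - t n x))\<^sup>2) \<le> ennreal (2 * a\<^sup>2 + 2 * b\<^sup>2)" by (rule ennreal_leI)
    also have "\<dots> = 2 * ennreal (a\<^sup>2) + 2 * ennreal (b\<^sup>2)"
      by (simp add: ennreal_plus ennreal_mult)
    finally show "ennreal ((cmod (s m x - t n x))\<^sup>2) \<le>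
       2 * ennreal ((cmod (s m x - f x))\<^sup>2) + 2 * ennreal ((cmod (t n x - f x))\<^sup>2)"
      unfolding a_def b_def .
  qed
  also have "\<dots> = 2 * (\<integral>\<^sup>+x. ennreal ((cmod (s m x - f x))\<^sup>2) \<partial>mu v) +
     2 * (\<integral>\<^sup>+x. ennreal ((cmod (t n x - f x))\<^sup>2) \<partial>mu v)"
    by (subst nn_integral_add) (auto simp: nn_integral_cmult)
  finally show ?thesis by (simp add: T_nn_norm[OF s t])
qed

lemma single_valued_integral_pvm: "single_valued (integral_pvm E f)"
proof (rule single_valuedI)
  fix v w w' assume "(v, w) \<in> integral_pvm E f" "(v, w') \<in> integral_pvm E f"
  then obtain s t where f: "f \<in> borel_measurable borel"
    and s: "\<And>n. simple_function borel (s n)" "(\<lambda>n. \<integral>\<^sup>+x. ennreal ((cmod (s n x - f x))\<^sup>2) \<partial>mu v) \<longlonglongrightarrow> 0"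
      "(\<lambda>n. T (s n) v) \<longlonglongrightarrow> w"
    and t: "\<And>n. simple_function borel (t n)" "(\<lambda>n. \<integral>\<^sup>+x. ennreal ((cmod (t n x - f x))\<^sup>2) \<partial>mu v) \<longlonglongrightarrow> 0"
      "(\<lambda>n. T (t n) v) \<longlonglongrightarrow> w'"
    unfolding integral_pvm_def by auto
  have "(\<lambda>n. ennreal ((norm (T (s n) v - T (t n) v))\<^sup>2)) \<longlonglongrightarrow> 0"
  proof (rule tendsto_sandwich[OF _ _ tendsto_const])
    show "(\<lambda>n. 2 * (\<integral>\<^sup>+x. ennreal ((cmod (s n x - f x))\<^sup>2) \<partial>mu v) +
       2 * (\<integral>\<^sup>+x. ennreal ((cmod (t n x - f x))\<^sup>2) \<partial>mu v)) \<longlonglongrightarrow> 0"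
      using tendsto_add[OF ennreal_tendsto_cmult[OF _ s(2), of 2] ennreal_tendsto_cmult[OF _ t(2), of 2]] by simp
    show "\<forall>\<^sub>F n in sequentially. ennreal ((norm (T (s n) v - T (t n) v))\<^sup>2) \<le>
       2 * (\<integral>\<^sup>+x. ennreal ((cmod (s n x - f x))\<^sup>2) \<partial>mu v) +
       2 * (\<integral>\<^sup>+x. ennreal ((cmod (t n x - f x))\<^sup>2) \<partial>mu v)"
      by (intro always_eventually allI T_close s t f)
  qed simp
  hence "(\<lambda>n. norm (T (s n) v - T (t n) v)) \<longlonglongrightarrow> 0" by (rule ennreal_power2_tendsto_0D)
  moreover have "(\<lambda>n. norm (T (s n) v - T (t n) v)) \<longlonglongrightarrow> norm (w - w')"
    by (intro tendsto_intros s t)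
  ultimately have "norm (w - w') = 0" using LIMSEQ_unique by blast
  thus "w = w'" by simp
qed

text \<open>Dominated convergence with the constant \<open>(2 * K)\<^sup>2\<close>, integrable
  because \<open>mu v\<close> is finite.\<close>

lemma nn_integral_sq_tendsto_0:
  assumes s: "\<And>n. s n \<in> borel_measurable borel" and f: "f \<in> borel_measurable borel"
    and b: "\<And>n x. cmod (s n x) \<le> K" and l: "\<And>x. (\<lambda>n. s n x) \<longlonglongrightarrow> f x"
  shows "(\<lambda>n. \<integral>\<^sup>+x. ennreal ((cmod (s n x - f x))\<^sup>2) \<partial>mu v) \<longlonglongrightarrow> 0"
proof -
  note [measurable] = s f
  have bf: "cmod (f x) \<le> K" for x
    by (rule LIMSEQ_le_const2[OF tendsto_norm[OF l]]) (use b in auto)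
  have "(\<lambda>n. \<integral>\<^sup>+x. ennreal ((cmod (s n x - f x))\<^sup>2) \<partial>mu v) \<longlonglongrightarrow> (\<integral>\<^sup>+x. 0 \<partial>mu v)"
  proof (rule nn_integral_dominated_convergence[where w = "\<lambda>x. ennreal ((2 * K)\<^sup>2)"])
    show "AE x in mu v. ennreal ((cmod (s n x - f x))\<^sup>2) \<le> ennreal ((2 * K)\<^sup>2)" for n
    proof (intro AE_I2 ennreal_leI power_mono)
      fix x show "cmod (s n x - f x) \<le> 2 * K"
        using norm_triangle_ineq4[of "s n x" "f x"] b[of n x] bf[of x] by simp
    qed simp
    show "(\<integral>\<^sup>+x. ennreal ((2 * K)\<^sup>2) \<partial>mu v) < \<infinity>"
      by (simp add: emeasure_mu ennreal_mult_less_top)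
    show "AE x in mu v. (\<lambda>n. ennreal ((cmod (s n x - f x))\<^sup>2)) \<longlonglongrightarrow> 0"
    proof (rule AE_I2)
      fix x
      have "(\<lambda>n. (cmod (s n x - f x))\<^sup>2) \<longlonglongrightarrow> (cmod (f x - f x))\<^sup>2" by (intro tendsto_intros l)
      thus "(\<lambda>n. ennreal ((cmod (s n x - f x))\<^sup>2)) \<longlonglongrightarrow> 0"
        using tendsto_ennrealI by fastforce
    qed
  qed auto
  thus ?thesis by simp
qed

section \<open>The bounded Borel functional calculus\<close>

definition Phi :: "(real \<Rightarrow> complex) \<Rightarrow> 'a \<Rightarrow> 'a" where "Phi f v = integral_pvm E f \<cdot> v"

text \<open>The isometry makes the simple integrals Cauchy, and single-valuedness identifies their
  limit with \<open>Phi f v\<close>. In particular every vector lies in the domain, and any bounded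
  approximating sequence may be used to compute \<open>Phi\<close>.\<close>

lemma T_tendsto_Phi_aux:
  assumes s: "\<And>n. simple_function borel (s n)" and f: "f \<in> borel_measurable borel"
    and b: "\<And>n x. cmod (s n x) \<le> K" and l: "\<And>x. (\<lambda>n. s n x) \<longlonglongrightarrow> f x"
  shows "(\<lambda>n. T (s n) v) \<longlonglongrightarrow> Phi f v \<and> (v, Phi f v) \<in> integral_pvm E f"
proof -
  note lim = nn_integral_sq_tendsto_0[OF borel_measurable_simple_function[OF s] f b l, of v]
  have "Cauchy (\<lambda>n. T (s n) v)"
  proof (rule metric_CauchyI)
    fix e :: real assume "e > 0"
    \<comment> \<open>\<open>T_close\<close> doubles each of the two errors, hence a quarter of
      \<open>e\<^sup>2\<close>.\<close>
    have "eventually (\<lambda>n. (\<integral>\<^sup>+x. ennreal ((cmod (s n x - f x))\<^sup>2) \<partial>mu v) < ennreal (e\<^sup>2 / 4)) sequentially"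
      using \<open>e > 0\<close> by (intro order_tendstoD(2)[OF lim]) auto
    then obtain N where N: "\<And>n. n \<ge> N \<Longrightarrow> (\<integral>\<^sup>+x. ennreal ((cmod (s n x - f x))\<^sup>2) \<partial>mu v) < ennreal (e\<^sup>2 / 4)"
      by (auto simp: eventually_sequentially)
    have "dist (T (s m) v) (T (s n) v) < e" if "m \<ge> N" "n \<ge> N" for m n
    proof -
      have "ennreal ((norm (T (s m) v - T (s n) v))\<^sup>2) < ennreal (e\<^sup>2/2) + ennreal (e\<^sup>2/2)"
      proof (rule le_less_trans[OF T_close[OF s s f]], rule add_strict_mono)
        have two: "ennreal (e\<^sup>2/2) = 2 * ennreal (e\<^sup>2 / 4)" by (simp add: ennreal_mult'[symmetric] flip: ennreal_numeral)
        show "2 * (\<integral>\<^sup>+x. ennreal ((cmod (s m x - f x))\<^sup>2) \<partial>mu v) < ennreal (e\<^sup>2/2)"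
          unfolding two using N[OF that(1)] by (intro ennreal_mult_strict_left_mono) auto
        show "2 * (\<integral>\<^sup>+x. ennreal ((cmod (s n x - f x))\<^sup>2) \<partial>mu v) < ennreal (e\<^sup>2/2)"
          unfolding two using N[OF that(2)] by (intro ennreal_mult_strict_left_mono) auto
      qed
      also have "\<dots> = ennreal (e\<^sup>2)" by (simp add: ennreal_plus[symmetric])
      finally have "(norm (T (s m) v - T (s n) v))\<^sup>2 < e\<^sup>2" by (simp add: ennreal_less_iff)
      thus ?thesis using \<open>e > 0\<close> by (simp add: dist_norm power2_less_imp_less)
    qed
    thus "\<exists>M. \<forall>m\<ge>M. \<forall>n\<ge>M. dist (T (s m) v) (T (s n) v) < e" by blast
  qed
  then obtain w where w: "(\<lambda>n. T (s n) v) \<longlonglongrightarrow> w" using Cauchy_convergent convergent_def by blast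
  have "(v, w) \<in> integral_pvm E f" unfolding integral_pvm_def using f s lim w by auto
  moreover from this have "Phi f v = w"
    unfolding Phi_def app_def using single_valued_integral_pvm by (auto dest: single_valuedD)
  ultimately show ?thesis using w by simp
qed

lemma T_tendsto_Phi:
  assumes "\<And>n. simple_function borel (s n)" "bounded_borel f"
    and "\<And>n x. cmod (s n x) \<le> K" "\<And>x. (\<lambda>n. s n x) \<longlonglongrightarrow> f x"
  shows "(\<lambda>n. T (s n) v) \<longlonglongrightarrow> Phi f v"
  using T_tendsto_Phi_aux[OF assms(1) bounded_borel_meas[OF assms(2)] assms(3,4)] by blast

lemma Phi_simple: "simple_function borel s \<Longrightarrow> Phi s v = T s v"
proof -
  assume s: "simple_function borel s"
  obtain K where "\<And>x. cmod (s x) \<le> K" using bounded_borelE[OF simple_function_bounded_borel[OF s]] by blast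
  from T_tendsto_Phi[OF s simple_function_bounded_borel[OF s] this, of v]
  have "(\<lambda>n::nat. T s v) \<longlonglongrightarrow> Phi s v" by simp
  thus "Phi s v = T s v" using LIMSEQ_unique tendsto_const by blast
qed

lemma Phi_add:
  assumes "bounded_borel f" "bounded_borel g"
  shows "Phi (\<lambda>x. f x + g x) v = Phi f v + Phi g v"
proof -
  obtain s K where s: "\<And>n. simple_function borel (s n)" "\<And>n x. cmod (s n x) \<le> K"
    "\<And>x. (\<lambda>n. s n x) \<longlonglongrightarrow> f x" using bounded_borel_simple_approx[OF assms(1)] by metis
  obtain t L where t: "\<And>n. simple_function borel (t n)" "\<And>n x. cmod (t n x) \<le> L"
    "\<And>x. (\<lambda>n. t n x) \<longlonglongrightarrow> g x" using bounded_borel_simple_approx[OF assms(2)] by metis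
  have "(\<lambda>n. T (\<lambda>x. s n x + t n x) v) \<longlonglongrightarrow> Phi (\<lambda>x. f x + g x) v"
    by (rule T_tendsto_Phi[where K = "K + L"])
      (auto intro!: simple_function_add s t bounded_borel_add assms tendsto_add
        order_trans[OF norm_triangle_ineq] add_mono)
  moreover have "(\<lambda>n. T (\<lambda>x. s n x + t n x) v) \<longlonglongrightarrow> Phi f v + Phi g v"
    unfolding T_add[OF s(1) t(1)]
    by (intro tendsto_add T_tendsto_Phi[OF s(1) assms(1) s(2,3)] T_tendsto_Phi[OF t(1) assms(2) t(2,3)])
  ultimately show ?thesis using LIMSEQ_unique by blast
qed

lemma Phi_linear:
  assumes "bounded_borel f"
  shows "Phi f (u + v) = Phi f u + Phi f v" "Phi f (c *\<^sub>C u) = c *\<^sub>C Phi f u"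
proof -
  obtain s K where s: "\<And>n. simple_function borel (s n)" "\<And>n x. cmod (s n x) \<le> K"
    "\<And>x. (\<lambda>n. s n x) \<longlonglongrightarrow> f x" using bounded_borel_simple_approx[OF assms(1)] by metis
  note lim = T_tendsto_Phi[OF s(1) assms s(2,3)]
  show "Phi f (u + v) = Phi f u + Phi f v"
    using tendsto_add[OF lim[of u] lim[of v]] lim[of "u + v"] LIMSEQ_unique
    unfolding T_linear(1)[OF s(1)] by blast
  show "Phi f (c *\<^sub>C u) = c *\<^sub>C Phi f u"
    using tendsto_scaleC[OF lim[of u]] lim[of "c *\<^sub>C u"] LIMSEQ_unique
    unfolding T_linear(2)[OF s(1)] by blast
qed

lemma Phi_adj:
  assumes "bounded_borel f"
  shows "cinner u (Phi f v) = cinner (Phi (\<lambda>x. cnj (f x)) u) v"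
proof -
  obtain s K where s: "\<And>n. simple_function borel (s n)" "\<And>n x. cmod (s n x) \<le> K"
    "\<And>x. (\<lambda>n. s n x) \<longlonglongrightarrow> f x" using bounded_borel_simple_approx[OF assms(1)] by metis
  have 1: "(\<lambda>n. cinner u (T (s n) v)) \<longlonglongrightarrow> cinner u (Phi f v)"
    by (intro tendsto_cinner tendsto_const T_tendsto_Phi[OF s(1) assms s(2,3)])
  have "(\<lambda>n. T (\<lambda>x. cnj (s n x)) u) \<longlonglongrightarrow> Phi (\<lambda>x. cnj (f x)) u"
    by (rule T_tendsto_Phi[where K = K])
      (auto intro!: s simple_function_compose1[OF s(1), of cnj] bounded_borel_cnj assms tendsto_cnj)
  hence "(\<lambda>n. cinner (T (\<lambda>x. cnj (s n x)) u) v) \<longlonglongrightarrow> cinner (Phi (\<lambda>x. cnj (f x)) u) v"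
    by (intro tendsto_cinner tendsto_const)
  with 1 show ?thesis unfolding T_adj[OF s(1)] using LIMSEQ_unique by blast
qed

lemma Phi_integral:
  assumes "bounded_borel f"
  shows "cinner v (Phi f v) = integral\<^sup>L (mu v) f"
proof -
  obtain s K where s: "\<And>n. simple_function borel (s n)" "\<And>n x. cmod (s n x) \<le> K"
    "\<And>x. (\<lambda>n. s n x) \<longlonglongrightarrow> f x" using bounded_borel_simple_approx[OF assms(1)] by metis
  have 1: "(\<lambda>n. cinner v (T (s n) v)) \<longlonglongrightarrow> cinner v (Phi f v)"
    by (intro tendsto_cinner tendsto_const T_tendsto_Phi[OF s(1) assms s(2,3)])
  have 2: "(\<lambda>n. integral\<^sup>L (mu v) (s n)) \<longlonglongrightarrow> integral\<^sup>L (mu v) f"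
  proof (rule integral_dominated_convergence[where w = "\<lambda>x. K"])
    show "integrable (mu v) (\<lambda>x. K)"
      using finite_measure.integrable_const[OF finite_measure_mu] .
  qed (use s bounded_borel_meas[OF assms] borel_measurable_simple_function[OF s(1)] in \<open>auto simp: measurable_cong_sets[OF sets_mu refl]\<close>)
  show ?thesis using 1 2 unfolding T_integral[OF s(1)] using LIMSEQ_unique by blast
qed

lemma T_bound:
  assumes "simple_function borel s" "\<And>x. cmod (s x) \<le> K" "K \<ge> 0"
  shows "norm (T s v) \<le> K * norm v"
proof -
  have "(norm (T s v))\<^sup>2 \<le> (\<integral>x. K\<^sup>2 \<partial>mu v)"
    unfolding T_norm[OF assms(1)]
  proof (rule integral_mono)
    have "bounded_borel (\<lambda>x. complex_of_real ((cmod (s x))\<^sup>2))"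
      using assms(1) by (intro simple_function_bounded_borel) (rule simple_function_compose1)
    from integrable_mu[OF this] show "integrable (mu v) (\<lambda>x. (cmod (s x))\<^sup>2)"
      by (simp only: complex_of_real_integrable_eq)
    show "integrable (mu v) (\<lambda>x. K\<^sup>2)" using finite_measure.integrable_const[OF finite_measure_mu] .
    show "(cmod (s x))\<^sup>2 \<le> K\<^sup>2" for x using assms by (intro power_mono) auto
  qed
  also have "\<dots> = (K * norm v)\<^sup>2" by (simp add: measure_mu power_mult_distrib)
  finally show ?thesis by (rule power2_le_imp_le) (use assms(3) in simp)
qed

text \<open>The factor 2 stems from the simple approximants, whose modulus may be twice that of f.
  It does no harm, since only boundedness is at stake; \<open>Phi_norm\<close> below is
  exact.\<close>

lemma Phi_bound:
  assumes "bounded_borel f" "\<And>x. cmod (f x) \<le> K" "K \<ge> 0"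
  shows "norm (Phi f v) \<le> 2 * K * norm v"
proof -
  obtain s where s: "\<And>i. simple_function borel (s i)" "\<And>x. (\<lambda>i. s i x) \<longlonglongrightarrow> f x"
    "\<And>i x. dist (s i x) 0 \<le> 2 * dist (f x) 0"
    using borel_measurable_implies_sequence_metric[OF bounded_borel_meas[OF assms(1)], of 0] by auto
  have b: "cmod (s n x) \<le> 2 * K" for n x using s(3)[of n x] assms(2)[of x] by simp
  have "(\<lambda>n. norm (T (s n) v)) \<longlonglongrightarrow> norm (Phi f v)"
    by (intro tendsto_norm T_tendsto_Phi[OF s(1) assms(1) b s(2)])
  thus ?thesis
    by (rule LIMSEQ_le_const2) (use T_bound[OF s(1) b] assms(3) in auto)
qed

lemma Phi_bounded_linear: "bounded_borel f \<Longrightarrow> bounded_linear (Phi f)"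
proof -
  assume f: "bounded_borel f"
  then obtain K where K: "\<And>x. cmod (f x) \<le> K" "K \<ge> 0" using bounded_borelE by metis
  show ?thesis
    by (rule bounded_linear_intro[where K = "2 * K"])
      (use Phi_linear[OF f] Phi_bound[OF f K] in \<open>simp_all add: scaleR_scaleC mult.commute\<close>)
qed

lemma Phi_mult:
  assumes "bounded_borel f" "bounded_borel g"
  shows "Phi (\<lambda>x. f x * g x) v = Phi f (Phi g v)"
proof -
  obtain s K where s: "\<And>n. simple_function borel (s n)" "\<And>n x. cmod (s n x) \<le> K"
    "\<And>x. (\<lambda>n. s n x) \<longlonglongrightarrow> f x" using bounded_borel_simple_approx[OF assms(1)] by metis
  obtain t L where t: "\<And>n. simple_function borel (t n)" "\<And>n x. cmod (t n x) \<le> L"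
    "\<And>x. (\<lambda>n. t n x) \<longlonglongrightarrow> g x" using bounded_borel_simple_approx[OF assms(2)] by metis
  have K0: "K \<ge> 0" using s(2)[of 0 0] norm_ge_zero order_trans by blast
  have "(\<lambda>n. T (\<lambda>x. s n x * t n x) v) \<longlonglongrightarrow> Phi (\<lambda>x. f x * g x) v"
    by (rule T_tendsto_Phi[where K = "K * L"])
      (auto intro!: simple_function_mult s t bounded_borel_mult assms tendsto_mult mult_mono K0
       simp: norm_mult)
  hence 1: "(\<lambda>n. T (s n) (T (t n) v)) \<longlonglongrightarrow> Phi (\<lambda>x. f x * g x) v"
    unfolding T_mult[OF s(1) t(1)] .
  note lt = T_tendsto_Phi[OF t(1) assms(2) t(2,3), of v]
  \<comment> \<open>Both factors vary with n. The uniform bound K on the operators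
    \<open>T (s n)\<close> lets the inner factor be replaced by its limit first.\<close>
  have "(\<lambda>n. T (s n) (T (t n) v - Phi g v)) \<longlonglongrightarrow> 0"
  proof (rule Lim_null_comparison)
    show "\<forall>\<^sub>F n in sequentially. norm (T (s n) (T (t n) v - Phi g v)) \<le> K * norm (T (t n) v - Phi g v)"
      by (intro always_eventually allI T_bound s K0)
    show "(\<lambda>n. K * norm (T (t n) v - Phi g v)) \<longlonglongrightarrow> 0"
      using tendsto_mult[OF tendsto_const[of K] tendsto_norm[OF tendsto_diff[OF lt tendsto_const[of "Phi g v"]]]] by simp
  qed
  from tendsto_add[OF this T_tendsto_Phi[OF s(1) assms(1) s(2,3), of "Phi g v"]]
  have "(\<lambda>n. T (s n) (T (t n) v)) \<longlonglongrightarrow> Phi f (Phi g v)"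
    unfolding T_linear(1)[OF s(1), symmetric] by simp
  with 1 show ?thesis using LIMSEQ_unique by blast
qed

lemma Phi_const: "Phi (\<lambda>x. c) v = c *\<^sub>C v"
proof -
  have "T (\<lambda>x. c) v = (\<Sum>y\<in>range (\<lambda>x::real. 0::nat). c *\<^sub>C E ((\<lambda>x. 0::nat) -` {y}) v)"
    using T_comp[of "\<lambda>x::real. 0::nat" "\<lambda>_. c" v] by simp
  hence "T (\<lambda>x. c) v = c *\<^sub>C v" by (simp add: vimage_def)
  thus ?thesis by (simp add: Phi_simple)
qed

lemma Phi_indicator: assumes "S \<in> sets borel" shows "Phi (indicator S) v = E S v"
proof -
  have s: "simple_function borel (indicator S :: real \<Rightarrow> complex)"
    using assms by (simp add: simple_function_indicator)
  have h: "simple_function borel (\<lambda>x. x \<in> S)"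
    unfolding simple_function_def using assms
    by (auto simp: vimage_def Compl_eq[symmetric] intro: finite_subset[of _ UNIV])
  have "T (\<lambda>x. of_bool (x \<in> S)) v = (\<Sum>y\<in>range (\<lambda>x. x \<in> S). of_bool y *\<^sub>C E ((\<lambda>x. x \<in> S) -` {y}) v)"
    by (rule T_comp[OF h])
  also have "\<dots> = (\<Sum>y\<in>UNIV. of_bool y *\<^sub>C E ((\<lambda>x. x \<in> S) -` {y}) v)"
  \<comment> \<open>If S is empty or the whole line, one truth value is not attained; its level set
    is empty and contributes 0.\<close>
  proof (rule sum.mono_neutral_left)
    show "\<forall>i\<in>UNIV - range (\<lambda>x. x \<in> S). of_bool i *\<^sub>C E ((\<lambda>x. x \<in> S) -` {i}) v = 0"
    proof
      fix i assume "i \<in> UNIV - range (\<lambda>x. x \<in> S)"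
      hence "(\<lambda>x. x \<in> S) -` {i} = {}" by auto
      thus "of_bool i *\<^sub>C E ((\<lambda>x. x \<in> S) -` {i}) v = 0" by simp
    qed
  qed auto
  also have "\<dots> = E S v" by (simp add: UNIV_bool vimage_def)
  finally have "T (\<lambda>x. of_bool (x \<in> S)) v = E S v" .
  moreover have "indicator S = (\<lambda>x. of_bool (x \<in> S) :: complex)" by (auto simp: indicator_def)
  ultimately show ?thesis using Phi_simple[OF s] by simp
qed

lemma Phi_cmult: "bounded_borel f \<Longrightarrow> Phi (\<lambda>x. c * f x) v = c *\<^sub>C Phi f v"
  using Phi_mult[of "\<lambda>x. c" f v] by (simp add: Phi_const)

lemma Phi_minus: "bounded_borel f \<Longrightarrow> Phi (\<lambda>x. - f x) v = - Phi f v"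
  using Phi_cmult[of f "-1" v] by (simp add: scaleC_minus_left)

lemma Phi_diff:
  "bounded_borel f \<Longrightarrow> bounded_borel g \<Longrightarrow> Phi (\<lambda>x. f x - g x) v = Phi f v - Phi g v"
  using Phi_add[of f "\<lambda>x. - g x" v] by (simp add: Phi_minus bounded_borel_minus)

lemma Phi_norm:
  assumes "bounded_borel f"
  shows "(norm (Phi f v))\<^sup>2 = (\<integral>x. (cmod (f x))\<^sup>2 \<partial>mu v)"
proof -
  have "complex_of_real ((norm (Phi f v))\<^sup>2) = cinner (Phi f v) (Phi f v)" by (simp add: cinner_self)
  also have "\<dots> = cinner v (Phi (\<lambda>x. cnj (f x)) (Phi f v))"
    using Phi_adj[OF bounded_borel_cnj[OF assms], of v "Phi f v"] by simp
  also have "\<dots> = (\<integral>x. cnj (f x) * f x \<partial>mu v)"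
    using assms by (simp add: Phi_mult[symmetric] Phi_integral bounded_borel_intros)
  also have "\<dots> = (\<integral>x. complex_of_real ((cmod (f x))\<^sup>2) \<partial>mu v)"
    by (intro Bochner_Integration.integral_cong refl) (simp only: complex_norm_square mult.commute)
  also have "\<dots> = complex_of_real (\<integral>x. (cmod (f x))\<^sup>2 \<partial>mu v)"
    by (rule integral_complex_of_real)
  finally show ?thesis using of_real_eq_iff by blast
qed

lemma Phi_nn_norm:
  assumes "bounded_borel f"
  shows "ennreal ((norm (Phi f v))\<^sup>2) = (\<integral>\<^sup>+x. ennreal ((cmod (f x))\<^sup>2) \<partial>mu v)"
proof -
  have "bounded_borel (\<lambda>x. f x * cnj (f x))" using assms by (intro bounded_borel_intros)
  hence "bounded_borel (\<lambda>x. complex_of_real ((cmod (f x))\<^sup>2))" by (simp only: complex_norm_square)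
  hence "integrable (mu v) (\<lambda>x. complex_of_real ((cmod (f x))\<^sup>2))" by (rule integrable_mu)
  hence "integrable (mu v) (\<lambda>x. (cmod (f x))\<^sup>2)" by (simp only: complex_of_real_integrable_eq)
  thus ?thesis by (simp add: Phi_norm[OF assms] nn_integral_eq_integral)
qed

lemma Phi_tendsto:
  assumes "\<And>n. bounded_borel (f n)" "bounded_borel g" "\<And>n x. cmod (f n x) \<le> K"
    "\<And>x. (\<lambda>n. f n x) \<longlonglongrightarrow> g x"
  shows "(\<lambda>n. Phi (f n) v) \<longlonglongrightarrow> Phi g v"
proof -
  have "(\<lambda>n. ennreal ((norm (Phi (f n) v - Phi g v))\<^sup>2)) \<longlonglongrightarrow> 0"
    unfolding Phi_diff[OF assms(1,2), symmetric] Phi_nn_norm[OF bounded_borel_diff[OF assms(1,2)]]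
    by (rule nn_integral_sq_tendsto_0[OF bounded_borel_meas[OF assms(1)] bounded_borel_meas[OF assms(2)] assms(3,4)])
  hence "(\<lambda>n. norm (Phi (f n) v - Phi g v)) \<longlonglongrightarrow> 0" by (rule ennreal_power2_tendsto_0D)
  thus ?thesis using LIM_zero_iff tendsto_norm_zero_iff by blast
qed

text \<open>The way back from the possibly unbounded \<open>\<integral> f dE\<close> to the bounded
  calculus: after multiplication by a g with \<open>g * f\<close> bounded, the simple approximants
  of f in L2 become approximants of \<open>g * f\<close>, with errors multiplied by at most
  K.\<close>

lemma Phi_integral_pvm:
  assumes vw: "(v, w) \<in> integral_pvm E f" and g: "bounded_borel g" and gf: "bounded_borel (\<lambda>x. g x * f x)"
  shows "Phi (\<lambda>x. g x * f x) v = Phi g w"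
proof -
  obtain s where f: "f \<in> borel_measurable borel"
    and s: "\<And>n. simple_function borel (s n)" "(\<lambda>n. \<integral>\<^sup>+x. ennreal ((cmod (s n x - f x))\<^sup>2) \<partial>mu v) \<longlonglongrightarrow> 0"
      "(\<lambda>n. T (s n) v) \<longlonglongrightarrow> w"
    using vw unfolding integral_pvm_def by auto
  note sb = simple_function_bounded_borel[OF s(1)]
  note [measurable] = f bounded_borel_meas[OF sb] bounded_borel_meas[OF g]
  obtain K where K: "\<And>x. cmod (g x) \<le> K" "K \<ge> 0" using bounded_borelE[OF g] by metis
  have "(\<lambda>n. ennreal ((norm (Phi (\<lambda>x. g x * s n x) v - Phi (\<lambda>x. g x * f x) v))\<^sup>2)) \<longlonglongrightarrow> 0"
  proof (rule tendsto_sandwich[OF _ _ tendsto_const])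
    show "\<forall>\<^sub>F n in sequentially. ennreal ((norm (Phi (\<lambda>x. g x * s n x) v - Phi (\<lambda>x. g x * f x) v))\<^sup>2)
       \<le> ennreal (K\<^sup>2) * (\<integral>\<^sup>+x. ennreal ((cmod (s n x - f x))\<^sup>2) \<partial>mu v)"
    proof (intro always_eventually allI)
      fix n
      have gs: "bounded_borel (\<lambda>x. g x * s n x)" by (intro bounded_borel_mult g sb)
      have "ennreal ((norm (Phi (\<lambda>x. g x * s n x) v - Phi (\<lambda>x. g x * f x) v))\<^sup>2)
          = (\<integral>\<^sup>+x. ennreal ((cmod (g x * s n x - g x * f x))\<^sup>2) \<partial>mu v)"
        using gs gf by (simp add: Phi_diff[symmetric] Phi_nn_norm bounded_borel_diff)
      also have "\<dots> \<le> (\<integral>\<^sup>+x. ennreal (K\<^sup>2) * ennreal ((cmod (s n x - f x))\<^sup>2) \<partial>mu v)"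
      proof (rule nn_integral_mono)
        fix x
        have "(cmod (g x * s n x - g x * f x))\<^sup>2 = (cmod (g x))\<^sup>2 * (cmod (s n x - f x))\<^sup>2"
          by (simp add: right_diff_distrib[symmetric] norm_mult power_mult_distrib)
        also have "\<dots> \<le> K\<^sup>2 * (cmod (s n x - f x))\<^sup>2"
          using K by (intro mult_right_mono power_mono) auto
        finally show "ennreal ((cmod (g x * s n x - g x * f x))\<^sup>2) \<le> ennreal (K\<^sup>2) * ennreal ((cmod (s n x - f x))\<^sup>2)"
          by (simp add: ennreal_mult[symmetric] ennreal_leI)
      qed
      also have "\<dots> = ennreal (K\<^sup>2) * (\<integral>\<^sup>+x. ennreal ((cmod (s n x - f x))\<^sup>2) \<partial>mu v)"
        by (rule nn_integral_cmult) measurable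
      finally show "ennreal ((norm (Phi (\<lambda>x. g x * s n x) v - Phi (\<lambda>x. g x * f x) v))\<^sup>2)
       \<le> ennreal (K\<^sup>2) * (\<integral>\<^sup>+x. ennreal ((cmod (s n x - f x))\<^sup>2) \<partial>mu v)" .
    qed
    show "(\<lambda>n. ennreal (K\<^sup>2) * (\<integral>\<^sup>+x. ennreal ((cmod (s n x - f x))\<^sup>2) \<partial>mu v)) \<longlonglongrightarrow> 0"
      using ennreal_tendsto_cmult[OF _ s(2), of "ennreal (K\<^sup>2)"] by simp
  qed auto
  hence "(\<lambda>n. norm (Phi (\<lambda>x. g x * s n x) v - Phi (\<lambda>x. g x * f x) v)) \<longlonglongrightarrow> 0"
    by (rule ennreal_power2_tendsto_0D)
  hence "(\<lambda>n. Phi (\<lambda>x. g x * s n x) v) \<longlonglongrightarrow> Phi (\<lambda>x. g x * f x) v"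
    using LIM_zero_iff tendsto_norm_zero_iff by blast
  moreover have "(\<lambda>n. Phi (\<lambda>x. g x * s n x) v) \<longlonglongrightarrow> Phi g w"
    unfolding Phi_mult[OF g sb] Phi_simple[OF s(1)]
    by (intro bounded_linear.tendsto[OF Phi_bounded_linear[OF g]] s)
  ultimately show ?thesis using LIMSEQ_unique by blast
qed

text \<open>As \<open>E S\<close> is multiplication by an indicator, the isometry exhibits
  \<open>(cmod (g x))\<^sup>2\<close> as the density of \<open>mu (Phi g v)\<close> with respect to
  \<open>mu v\<close>. Integrability of f on the range of \<open>Phi g\<close> thus turns into that
  of \<open>f * g\<close> at v.\<close>

lemma nn_integral_mu_Phi:
  assumes g: "bounded_borel g" and f: "f \<in> borel_measurable borel"
  shows "(\<integral>\<^sup>+x. f x \<partial>mu (Phi g v)) = (\<integral>\<^sup>+x. ennreal ((cmod (g x))\<^sup>2) * f x \<partial>mu v)"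
proof -
  note [measurable] = f bounded_borel_meas[OF g]
  have "mu (Phi g v) = density (mu v) (\<lambda>x. ennreal ((cmod (g x))\<^sup>2))"
  proof (rule measure_eqI)
    fix S assume "S \<in> sets (mu (Phi g v))"
    hence S[measurable]: "S \<in> sets borel" by simp
    have "emeasure (mu (Phi g v)) S = ennreal ((norm (Phi (\<lambda>x. indicator S x * g x) v))\<^sup>2)"
      using S g by (simp add: emeasure_mu Phi_mult Phi_indicator)
    also have "\<dots> = (\<integral>\<^sup>+x. ennreal ((cmod (indicator S x * g x))\<^sup>2) \<partial>mu v)"
      using S g by (simp add: Phi_nn_norm bounded_borel_intros)
    also have "\<dots> = (\<integral>\<^sup>+x. ennreal ((cmod (g x))\<^sup>2) * indicator S x \<partial>mu v)"
      by (intro nn_integral_cong) (auto simp: indicator_def)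
    also have "\<dots> = emeasure (density (mu v) (\<lambda>x. ennreal ((cmod (g x))\<^sup>2))) S"
      by (rule emeasure_density[symmetric]) (auto simp: measurable_cong_sets[OF sets_mu refl])
    finally show "emeasure (mu (Phi g v)) S = emeasure (density (mu v) (\<lambda>x. ennreal ((cmod (g x))\<^sup>2))) S" .
  qed simp
  thus ?thesis by (simp add: nn_integral_density measurable_cong_sets[OF sets_mu refl])
qed

text \<open>Supplies domain vectors of an unbounded \<open>\<integral> f dE\<close>: g must decay
  enough to compensate f. It is applied with g a resolvent and f the identity or \<theta>.\<close>

lemma Phi_mem_integral_pvm:
  assumes f: "f \<in> borel_measurable borel" and g: "bounded_borel g" and fg: "bounded_borel (\<lambda>x. f x * g x)"
  shows "(Phi g v, Phi (\<lambda>x. f x * g x) v) \<in> integral_pvm E f"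
proof -
  obtain s where s: "\<And>i. simple_function borel (s i)" "\<And>x. (\<lambda>i. s i x) \<longlonglongrightarrow> f x"
    "\<And>i x. dist (s i x) 0 \<le> 2 * dist (f x) 0"
    using borel_measurable_implies_sequence_metric[OF f, of 0] by auto
  note sb = simple_function_bounded_borel[OF s(1)]
  note [measurable] = f bounded_borel_meas[OF sb] bounded_borel_meas[OF g]
  obtain K where K: "\<And>x. cmod (f x * g x) \<le> K" "K \<ge> 0" using bounded_borelE[OF fg] by metis
  have sg: "bounded_borel (\<lambda>x. s n x * g x)" for n by (intro bounded_borel_mult g sb)
  have bd: "cmod (s n x * g x) \<le> 2 * K" for n x
  proof -
    have "cmod (s n x * g x) \<le> (2 * cmod (f x)) * cmod (g x)"
      unfolding norm_mult using s(3)[of n x] by (intro mult_right_mono) auto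
    thus ?thesis using K(1)[of x] by (simp add: norm_mult)
  qed
  have lim: "(\<lambda>n. s n x * g x) \<longlonglongrightarrow> f x * g x" for x by (intro tendsto_intros s)
  have "(\<integral>\<^sup>+x. ennreal ((cmod (s n x - f x))\<^sup>2) \<partial>mu (Phi g v)) =
      (\<integral>\<^sup>+x. ennreal ((cmod (s n x * g x - f x * g x))\<^sup>2) \<partial>mu v)" for n
  proof -
    have "ennreal ((cmod (g x))\<^sup>2) * ennreal ((cmod (s n x - f x))\<^sup>2)
        = ennreal ((cmod (s n x * g x - f x * g x))\<^sup>2)" for x
      unfolding left_diff_distrib[symmetric] norm_mult power_mult_distrib
      by (simp add: ennreal_mult mult.commute)
    thus ?thesis by (subst nn_integral_mu_Phi[OF g]) simp_all
  qed
  hence "(\<lambda>n. \<integral>\<^sup>+x. ennreal ((cmod (s n x - f x))\<^sup>2) \<partial>mu (Phi g v)) \<longlonglongrightarrow> 0"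
    using nn_integral_sq_tendsto_0[OF bounded_borel_meas[OF sg] bounded_borel_meas[OF fg] bd lim, of v] by simp
  moreover have "(\<lambda>n. T (s n) (Phi g v)) \<longlonglongrightarrow> Phi (\<lambda>x. f x * g x) v"
    using Phi_tendsto[OF sg fg bd lim, of v] unfolding Phi_mult[OF sb g] Phi_simple[OF s(1)] .
  ultimately show ?thesis unfolding integral_pvm_def using f s(1) by auto
qed

end

section \<open>Approximation by rational functions of the real line\<close>

inductive laurent :: "(complex \<Rightarrow> complex) \<Rightarrow> bool" where
  zero: "laurent (\<lambda>_. 0)"
| monom: "laurent f \<Longrightarrow> laurent (\<lambda>w. f w + c * w powi k)"

lemma laurent_add:
  assumes "laurent f" "laurent g" shows "laurent (\<lambda>w. f w + g w)"
  using assms(2)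
proof induction
  case (monom g c k)
  have "(\<lambda>w. f w + (g w + c * w powi k)) = (\<lambda>w. (f w + g w) + c * w powi k)"
    by (simp add: add.assoc)
  thus ?case using laurent.monom[OF monom.IH] by simp
qed (simp add: assms(1))

lemma laurent_monom: "laurent (\<lambda>w. c * w powi k)"
  using laurent.monom[OF laurent.zero] by simp

text \<open>Agreement is asked on the circle only: there w is nonzero, so exponents add in products,
  and \<open>cnj w = 1 / w\<close>, so conjugation stays in the class.\<close>

definition circle_laurent :: "(complex \<Rightarrow> complex) \<Rightarrow> bool" where
  "circle_laurent f \<longleftrightarrow> (\<exists>h. laurent h \<and> (\<forall>w. cmod w = 1 \<longrightarrow> f w = h w))"

lemma circle_laurent_add:
  assumes "circle_laurent f" "circle_laurent g" shows "circle_laurent (\<lambda>w. f w + g w)"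
proof -
  obtain h k where "laurent h" "laurent k" "\<forall>w. cmod w = 1 \<longrightarrow> f w = h w" "\<forall>w. cmod w = 1 \<longrightarrow> g w = k w"
    using assms unfolding circle_laurent_def by blast
  thus ?thesis unfolding circle_laurent_def by (intro exI[of _ "\<lambda>w. h w + k w"]) (auto intro: laurent_add)
qed

lemma circle_laurent_monom: "circle_laurent (\<lambda>w. c * w powi k)"
  unfolding circle_laurent_def using laurent_monom by blast

lemma circle_laurent_cong:
  "circle_laurent f \<Longrightarrow> (\<And>w. cmod w = 1 \<Longrightarrow> g w = f w) \<Longrightarrow> circle_laurent g"
  unfolding circle_laurent_def by metis

lemma circle_laurent_mult:
  assumes "circle_laurent f" "circle_laurent g" shows "circle_laurent (\<lambda>w. f w * g w)"
proof -
  have mono: "circle_laurent (\<lambda>w. c * w powi k * h w)" if "laurent h" for h c k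
    using that
  proof induction
    case zero
    show ?case using circle_laurent_monom[of 0 0] by simp
  next
    case (monom h d l)
    have e: "c * w powi k * (h w + d * w powi l) = c * w powi k * h w + (c * d) * w powi (k + l)"
      if "cmod w = 1" for w
    proof -
      have "w \<noteq> 0" using that by auto
      hence "w powi (k + l) = w powi k * w powi l" by (simp add: power_int_add)
      thus ?thesis by (simp add: algebra_simps)
    qed
    show ?case
      by (rule circle_laurent_cong[OF circle_laurent_add[OF monom.IH circle_laurent_monom] e])
  qed
  obtain h where h: "laurent h" "\<And>w. cmod w = 1 \<Longrightarrow> f w = h w"
    using assms(1) unfolding circle_laurent_def by blast
  obtain k where k: "laurent k" "\<And>w. cmod w = 1 \<Longrightarrow> g w = k w"
    using assms(2) unfolding circle_laurent_def by blast
  have "circle_laurent (\<lambda>w. h w * k w)"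
    using h(1)
  proof induction
    case zero
    show ?case using circle_laurent_monom[of 0 0] by simp
  next
    case (monom h c l)
    show ?case
      by (rule circle_laurent_cong[OF circle_laurent_add[OF monom.IH mono[OF k(1), of c l]]])
        (simp add: algebra_simps)
  qed
  thus ?thesis by (rule circle_laurent_cong) (simp add: h k)
qed

lemma circle_laurent_const: "circle_laurent (\<lambda>w. c)"
  using circle_laurent_monom[of c 0] by simp

lemma circle_laurent_cmult: "circle_laurent f \<Longrightarrow> circle_laurent (\<lambda>w. c * f w)"
  by (intro circle_laurent_mult circle_laurent_const)

lemma circle_laurent_ident: "circle_laurent (\<lambda>w. w)"
  using circle_laurent_monom[of 1 1] by simp

lemma circle_laurent_cnj: "circle_laurent cnj"
proof (rule circle_laurent_cong[OF circle_laurent_monom[of 1 "-1"]])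
  fix w :: complex assume w: "cmod w = 1"
  have "w * cnj w = complex_of_real (1\<^sup>2)" by (simp only: complex_norm_square[symmetric] w)
  hence "w * cnj w = 1" by (simp only: of_real_1 power_one)
  hence "inverse w = cnj w" by (rule inverse_unique)
  thus "cnj w = 1 * w powi - 1" by (simp only: power_int_minus1_right mult_1)
qed

lemma circle_laurent_Re: "circle_laurent (\<lambda>w. complex_of_real (Re w))"
proof -
  have "circle_laurent (\<lambda>w. 1/2 * (w + cnj w))"
    by (rule circle_laurent_cmult, rule circle_laurent_add, rule circle_laurent_ident, rule circle_laurent_cnj)
  thus ?thesis by (rule circle_laurent_cong) (simp add: complex_add_cnj)
qed

lemma circle_laurent_Im: "circle_laurent (\<lambda>w. complex_of_real (Im w))"
proof -
  have "circle_laurent (\<lambda>w. (-\<i>/2) * (w + (-1) * cnj w))"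
    by (rule circle_laurent_cmult, rule circle_laurent_add, rule circle_laurent_ident,
        rule circle_laurent_cmult, rule circle_laurent_cnj)
  thus ?thesis by (rule circle_laurent_cong) (simp add: complex_eq_iff)
qed

lemma circle_laurent_real_polynomial:
  fixes p :: "complex \<Rightarrow> real"
  assumes "real_polynomial_function p" shows "circle_laurent (\<lambda>w. complex_of_real (p w))"
  using assms
proof induction
  case (linear f)
  have "f w = Re w * f 1 + Im w * f \<i>" for w
  proof -
    have "f w = f (Re w *\<^sub>R 1 + Im w *\<^sub>R \<i>)" by (rule arg_cong[of _ _ f]) (simp add: complex_eq_iff)
    thus ?thesis using bounded_linear.linear[OF linear] by (simp add: linear_add linear_scale)
  qed
  hence eq: "complex_of_real (f w) = complex_of_real (Re w * f 1 + Im w * f \<i>)" for w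
    by (rule arg_cong)
  have "circle_laurent (\<lambda>w. f 1 * complex_of_real (Re w) + f \<i> * complex_of_real (Im w))"
    by (rule circle_laurent_add; rule circle_laurent_cmult, rule circle_laurent_Re circle_laurent_Im)
  thus ?case
  proof (rule circle_laurent_cong)
    show "complex_of_real (f w) = f 1 * complex_of_real (Re w) + f \<i> * complex_of_real (Im w)" for w
      by (subst eq) (simp add: mult.commute)
  qed
qed (auto intro: circle_laurent_const circle_laurent_add circle_laurent_mult)

text \<open>Stone-Weierstrass gives a polynomial in \<open>Re w\<close> and \<open>Im w\<close>. On
  the circle these are combinations of w and \<open>1 / w\<close>, which makes the polynomial a
  Laurent polynomial.\<close>

lemma laurent_dense:
  fixes f :: "complex \<Rightarrow> complex"
  assumes "continuous_on (sphere 0 1) f" "e > 0"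
  shows "\<exists>h. laurent h \<and> (\<forall>w. cmod w = 1 \<longrightarrow> cmod (f w - h w) < e)"
proof -
  obtain g where g: "polynomial_function g" "\<And>w. w \<in> sphere 0 1 \<Longrightarrow> norm (f w - g w) < e"
    using Stone_Weierstrass_polynomial_function[OF compact_sphere assms] by blast
  have "real_polynomial_function (\<lambda>w. Re (g w))" "real_polynomial_function (\<lambda>w. Im (g w))"
    using g(1)[unfolded polynomial_function_def o_def, rule_format, OF bounded_linear_Re]
      g(1)[unfolded polynomial_function_def o_def, rule_format, OF bounded_linear_Im] by this
  hence "circle_laurent (\<lambda>w. complex_of_real (Re (g w)) + \<i> * complex_of_real (Im (g w)))"
    by (rule circle_laurent_add[OF circle_laurent_real_polynomial[of "\<lambda>w. Re (g w)"]
          circle_laurent_cmult[OF circle_laurent_real_polynomial[of "\<lambda>w. Im (g w)"]]])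
  moreover have "(\<lambda>w. complex_of_real (Re (g w)) + \<i> * complex_of_real (Im (g w))) = g"
    by (rule ext) (rule complex_eq[symmetric])
  ultimately have "circle_laurent g" by (simp only:)
  then obtain h where h: "laurent h" "\<And>w. cmod w = 1 \<Longrightarrow> g w = h w"
    unfolding circle_laurent_def by blast
  have "cmod (f w - h w) < e" if "cmod w = 1" for w
    using g(2)[of w] h(2)[OF that] that by simp
  thus ?thesis using h(1) by blast
qed

text \<open>The Cayley transform, which carries the line to the circle without the point 1 and
  infinity to 1. As it is affine in the resolvent, see \<open>cay_res\<close>, Laurent polynomials
  in it are polynomials in the resolvent and its adjoint.\<close>

definition cay :: "complex \<Rightarrow> real \<Rightarrow> complex" where
  "cay z x = (complex_of_real x - cnj z) / (complex_of_real x - z)"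

lemma real_minus_nonreal: "Im z \<noteq> 0 \<Longrightarrow> complex_of_real x - z \<noteq> 0"
  by (auto simp: complex_eq_iff)

lemma norm_cay: "Im z \<noteq> 0 \<Longrightarrow> cmod (cay z x) = 1"
proof -
  assume "Im z \<noteq> 0"
  have "cmod (complex_of_real x - cnj z) = cmod (cnj (complex_of_real x - z))" by simp
  also have "\<dots> = cmod (complex_of_real x - z)" by (rule complex_mod_cnj)
  finally show ?thesis
    using real_minus_nonreal[OF \<open>Im z \<noteq> 0\<close>, of x] by (simp add: cay_def norm_divide del: right_minus_eq)
qed

lemma continuous_on_laurent:
  assumes "laurent h" shows "continuous_on (-{0}) h"
  using assms by induction (auto intro!: continuous_intros)

lemma cay_minus_one:
  assumes "Im z \<noteq> 0"
  shows "cay z x - 1 = (z - cnj z) / (complex_of_real x - z)"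
  using real_minus_nonreal[OF assms, of x] unfolding cay_def by (simp add: field_simps)

lemma cay_inverse:
  assumes "Im z \<noteq> 0"
  shows "(cay z x * z - cnj z) / (cay z x - 1) = complex_of_real x"
proof -
  have d: "complex_of_real x - z \<noteq> 0" "z - cnj z \<noteq> 0"
    using real_minus_nonreal[OF assms] assms by (auto simp: complex_eq_iff)
  have "cay z x * z - cnj z = complex_of_real x * (z - cnj z) / (complex_of_real x - z)"
    using d(1) unfolding cay_def by (simp add: field_simps)
  thus ?thesis using d unfolding cay_minus_one[OF assms] by simp
qed

lemma cay_tendsto:
  assumes "Im z \<noteq> 0"
  shows "(cay z \<longlongrightarrow> 1) at_top" "(cay z \<longlongrightarrow> 1) at_bot"
proof -
  have aux: "(cay z \<longlongrightarrow> 1) F" if F: "filterlim (\<lambda>x::real. complex_of_real x - z) at_infinity F" for F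
  proof -
    have "((\<lambda>x. (z - cnj z) / (complex_of_real x - z)) \<longlongrightarrow> 0) F"
      by (rule tendsto_divide_0[OF tendsto_const F])
    hence "((\<lambda>x. (cay z x - 1) + 1) \<longlongrightarrow> 0 + 1) F"
      unfolding cay_minus_one[OF assms, symmetric] by (intro tendsto_add tendsto_const)
    thus ?thesis by simp
  qed
  have s: "filterlim (\<lambda>x::real. complex_of_real x - z) at_infinity F"
    if "filterlim (\<lambda>x::real. \<bar>x\<bar>) at_top F" for F
  proof -
    have "filterlim (\<lambda>x::real. complex_of_real x) at_infinity F"
      using that by (simp add: filterlim_at_infinity_conv_norm_at_top)
    from tendsto_add_filterlim_at_infinity'[OF this tendsto_const[of "-z"]] show ?thesis by simp
  qed
  show "(cay z \<longlongrightarrow> 1) at_top"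
    by (intro aux s filterlim_at_top_mono[OF filterlim_ident]) (auto intro: always_eventually)
  show "(cay z \<longlongrightarrow> 1) at_bot"
    by (intro aux s filterlim_at_top_mono[OF filterlim_uminus_at_top_at_bot]) (auto intro: always_eventually)
qed

text \<open>The function \<open>\<eta>\<close> is extended to a compactly supported function on the plane, and carried to
  the circle by the inverse of the Cayley transform.\<close>

lemma cayley_laurent_dense:
  fixes \<eta> :: "real \<Rightarrow> complex"
  assumes z: "Im z \<noteq> 0" and c: "continuous_on UNIV \<eta>" and supp: "\<And>x. \<bar>x\<bar> > R \<Longrightarrow> \<eta> x = 0" and e: "e > 0"
  shows "\<exists>h. laurent h \<and> (\<forall>x. cmod (\<eta> x - h (cay z x)) < e)"
proof -
  define q where "q w = (w * z - cnj z) / (w - 1)" for w :: complex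
  define F where "F p = \<eta> (Re p) * complex_of_real (max 0 (1 - \<bar>Im p\<bar>))" for p
  define f where "f w = (if w = 1 then 0 else F (q w))" for w
  have F0: "F p = 0" if "cmod p > R + 1" for p
  proof (cases "\<bar>Im p\<bar> < 1")
    case True
    have "cmod p \<le> \<bar>Re p\<bar> + \<bar>Im p\<bar>" by (rule cmod_le)
    hence "\<bar>Re p\<bar> > R" using that True by linarith
    thus ?thesis using supp by (simp add: F_def)
  qed (simp add: F_def)
  have cF: "continuous_on UNIV F" unfolding F_def
    by (intro continuous_intros continuous_on_compose2[OF c]) auto
  define V where "V = - {1 :: complex}"
  \<comment> \<open>A neighbourhood of 1, written without the division in q. On it
    \<open>cmod (q w)\<close> exceeds \<open>\<bar>R + 1\<bar>\<close> for w other than 1, so f is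
    identically 0 there, which settles continuity at the image of infinity.\<close>
  define U where "U = {w. \<bar>R + 1\<bar> * cmod (w - 1) < cmod (w * z - cnj z)}"
  have oV: "open V" unfolding V_def by auto
  have oU: "open U" unfolding U_def by (intro open_Collect_less continuous_intros)
  have UV: "U \<union> V = UNIV"
  proof -
    have "1 \<in> U" using z by (auto simp: U_def complex_eq_iff)
    thus ?thesis by (auto simp: V_def)
  qed
  have cV: "continuous_on V f"
  proof -
    have "continuous_on V (\<lambda>w. F (q w))"
      by (intro continuous_on_compose2[OF cF] continuous_intros) (auto simp: V_def q_def intro!: continuous_intros)
    thus ?thesis by (rule continuous_on_eq) (simp add: f_def V_def)
  qed
  have "f w = 0" if "w \<in> U" for w
  proof (cases "w = 1")
    case False
    hence "\<bar>R + 1\<bar> < cmod (q w)" using that by (simp add: U_def q_def norm_divide pos_less_divide_eq)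
    thus ?thesis using F0 by (simp add: f_def)
  qed (simp add: f_def)
  hence cU: "continuous_on U f" by (intro continuous_on_eq[OF continuous_on_const[of U 0]]) auto
  have "continuous_on (U \<union> V) f" by (rule continuous_on_open_Un[OF oU oV cU cV])
  hence "continuous_on (sphere 0 1) f" by (rule continuous_on_subset) (simp add: UV)
  then obtain h where h: "laurent h" "\<And>w. cmod w = 1 \<Longrightarrow> cmod (f w - h w) < e"
    using laurent_dense[OF _ e] by blast
  have "f (cay z x) = \<eta> x" for x
  proof -
    have "z - cnj z \<noteq> 0" using z by (simp add: complex_eq_iff)
    hence "cay z x - 1 \<noteq> 0"
      unfolding cay_minus_one[OF z] using real_minus_nonreal[OF z, of x] by simp
    thus ?thesis unfolding f_def q_def cay_inverse[OF z] by (simp add: F_def)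
  qed
  thus ?thesis using h norm_cay[OF z] by metis
qed

text \<open>The squared modulus of \<open>x - z\<close>, kept as a product so that it cancels
  against resolvents. Its inverse is the weight carried by the derivatives of functions of
  \<open>cay z\<close>.\<close>

abbreviation rsq :: "complex \<Rightarrow> real \<Rightarrow> complex" where
  "rsq z x \<equiv> (complex_of_real x - z) * (complex_of_real x - cnj z)"

lemma rsq_eq: "rsq z x = complex_of_real ((x - Re z)\<^sup>2 + (Im z)\<^sup>2)"
  by (simp add: complex_eq_iff power2_eq_square)

text \<open>The logarithmic derivative of \<open>cay z\<close> is
  \<open>(cnj z - z) / rsq z x\<close>; this covers negative exponents as well.\<close>

lemma cay_has_derivative:
  assumes "Im z \<noteq> 0"
  shows "((\<lambda>x. cay z x powi k) has_vector_derivative (of_int k * (cnj z - z) * cay z x powi k / rsq z x)) (at x)"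
proof -
  note d = real_minus_nonreal[OF assms, of x] real_minus_nonreal[of "cnj z" x]
  have nz: "complex_of_real x - z \<noteq> 0" "complex_of_real x - cnj z \<noteq> 0" using d assms by auto
  define G where "G y = ((y - cnj z) / (y - z)) powi k" for y :: complex
  have w: "(complex_of_real x - cnj z) / (complex_of_real x - z) \<noteq> 0" using nz by simp
  have 1: "((\<lambda>y. (y - cnj z) / (y - z)) has_field_derivative
      ((complex_of_real x - z) - (complex_of_real x - cnj z)) / (complex_of_real x - z)\<^sup>2) (at (complex_of_real x))"
    using nz by (auto intro!: derivative_eq_intros simp: power2_eq_square)
  have "(G has_field_derivative of_int k * ((complex_of_real x - cnj z) / (complex_of_real x - z)) powi (k - 1) *
      (((complex_of_real x - z) - (complex_of_real x - cnj z)) / (complex_of_real x - z)\<^sup>2)) (at (complex_of_real x))"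
    unfolding G_def using w by (intro DERIV_power_int 1) auto
  moreover have "of_int k * ((complex_of_real x - cnj z) / (complex_of_real x - z)) powi (k - 1) *
      (((complex_of_real x - z) - (complex_of_real x - cnj z)) / (complex_of_real x - z)\<^sup>2)
     = of_int k * (cnj z - z) * cay z x powi k / rsq z x"
  proof -
    have "((complex_of_real x - cnj z) / (complex_of_real x - z)) powi (k - 1) =
       cay z x powi k / ((complex_of_real x - cnj z) / (complex_of_real x - z))"
      unfolding cay_def using w by (simp add: power_int_diff)
    thus ?thesis using nz by (simp add: power2_eq_square mult_ac)
  qed
  ultimately have "(G has_field_derivative (of_int k * (cnj z - z) * cay z x powi k / rsq z x)) (at (complex_of_real x))"
    by simp
  from has_vector_derivative_real_field[OF this] show ?thesis
    unfolding G_def cay_def .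
qed

text \<open>Antiderivatives: only the constant coefficient obstructs integrating \<open>h (cay z x) / rsq z x\<close>
  within the Laurent polynomials.\<close>

lemma laurent_antiderivative:
  assumes "laurent h" "Im z \<noteq> 0"
  shows "\<exists>g c0. laurent g \<and> (\<forall>x. ((\<lambda>x. g (cay z x)) has_vector_derivative ((h (cay z x) - c0) / rsq z x)) (at x))"
  using assms(1)
proof induction
  case zero
  show ?case by (intro exI[of _ "\<lambda>_. 0"] exI[of _ 0]) (auto intro: laurent.zero)
next
  case (monom h c k)
  then obtain g c0 where g: "laurent g"
    "\<And>x. ((\<lambda>x. g (cay z x)) has_vector_derivative ((h (cay z x) - c0) / rsq z x)) (at x)" by blast
  show ?case
  proof (cases "k = 0")
    case True
    show ?thesis
      by (intro exI[of _ g] exI[of _ "c0 + c"] conjI allI g(1)) (use g(2) True in simp)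
  next
    case False
    define d where "d = c / (of_int k * (cnj z - z))"
    have nz: "of_int k * (cnj z - z) \<noteq> 0" using False assms(2) by (auto simp: complex_eq_iff)
    have "((\<lambda>x. g (cay z x) + d * cay z x powi k) has_vector_derivative
        ((h (cay z x) + c * cay z x powi k - c0) / rsq z x)) (at x)" for x
    proof -
      have "((\<lambda>x. g (cay z x) + d * cay z x powi k) has_vector_derivative
        ((h (cay z x) - c0) / rsq z x + d * (of_int k * (cnj z - z) * cay z x powi k / rsq z x))) (at x)"
        by (intro has_vector_derivative_add has_vector_derivative_mult_right cay_has_derivative g assms(2))
      moreover have "(h (cay z x) - c0) / rsq z x + d * (of_int k * (cnj z - z) * cay z x powi k / rsq z x)
         = (h (cay z x) + c * cay z x powi k - c0) / rsq z x"
      proof -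
        have "d * (of_int k * (cnj z - z) * cay z x powi k / rsq z x)
          = (d * (of_int k * (cnj z - z))) * cay z x powi k / rsq z x" by simp
        also have "d * (of_int k * (cnj z - z)) = c" using nz by (simp add: d_def)
        finally show ?thesis by (simp add: add_divide_distrib[symmetric] algebra_simps)
      qed
      ultimately show ?thesis by simp
    qed
    thus ?thesis using laurent.monom[OF g(1), of d k] by blast
  qed
qed

text \<open>The unwanted constant \<open>c0\<close> of the antiderivative is small, because \<open>g \<circ> cay z\<close> and \<open>\<phi>\<close> have
  equal limits at \<open>\<plusminus>\<infinity>\<close>, whereas the antiderivative \<open>S\<close> of \<open>1 / rsq z\<close> has not.\<close>

lemma laurent_C1_dense:
  fixes \<phi> \<phi>' :: "real \<Rightarrow> complex"
  assumes z: "Im z \<noteq> 0" and der: "\<And>x. (\<phi> has_vector_derivative \<phi>' x) (at x)"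
    and c: "continuous_on UNIV \<phi>'" and supp: "\<And>x. \<bar>x\<bar> > R \<Longrightarrow> \<phi> x = 0" and e: "e > 0"
  shows "\<exists>g g'. laurent g \<and> (\<forall>x. ((\<lambda>x. g (cay z x)) has_vector_derivative g' x) (at x)) \<and>
    (\<forall>x. cmod (g (cay z x) - g 1 - \<phi> x) \<le> e) \<and> (\<forall>x. cmod (rsq z x * (g' x - \<phi>' x)) \<le> e)"
proof -
  define a b where "a = Re z" and "b = Im z"
  have b0: "b \<noteq> 0" using z by (simp add: b_def)
  \<comment> \<open>The integral of \<open>1 / rsq z\<close> over the line, which is the difference
    of the limits of S at both ends.\<close>
  define \<tau> where "\<tau> = pi / \<bar>b\<bar>"
  have "\<tau> > 0" using b0 by (simp add: \<tau>_def)
  \<comment> \<open>Both the error of h and the constant \<open>c0\<close> will be at most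
    \<epsilon>, hence the factor 2; the factor \<tau> enters where these errors are integrated
    against \<open>1 / rsq z\<close>.\<close>
  define \<epsilon> where "\<epsilon> = min (e / 2) (e / (2 * \<tau>))"
  have \<epsilon>: "\<epsilon> > 0" "2 * \<epsilon> \<le> e" "2 * \<epsilon> * \<tau> \<le> e"
  proof -
    show "\<epsilon> > 0" using e \<open>\<tau> > 0\<close> by (simp add: \<epsilon>_def)
    show "2 * \<epsilon> \<le> e" by (simp add: \<epsilon>_def)
    have "\<epsilon> \<le> e / (2 * \<tau>)" by (simp add: \<epsilon>_def)
    thus "2 * \<epsilon> * \<tau> \<le> e" using \<open>\<tau> > 0\<close> by (simp add: field_simps)
  qed
  have rnz: "rsq z x \<noteq> 0" for x using real_minus_nonreal[OF z, of x] real_minus_nonreal[of "cnj z" x] z by simp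
  \<comment> \<open>Since derivatives of Laurent polynomials in \<open>cay z\<close> carry the
    weight \<open>1 / rsq z\<close>, the function to approximate uniformly is \<phi>' freed of this
    weight.\<close>
  define \<eta> where "\<eta> x = rsq z x * \<phi>' x" for x
  have "\<phi>' x = 0" if "\<bar>x\<bar> > R" for x
  proof -
    have "open {x. \<bar>x\<bar> > R}" by (intro open_Collect_less continuous_intros)
    hence "((\<lambda>_. 0) has_vector_derivative \<phi>' x) (at x)"
      by (rule has_vector_derivative_transform_within_open[OF der]) (use that supp in auto)
    thus ?thesis using has_vector_derivative_const vector_derivative_unique_at by blast
  qed
  hence \<eta>0: "\<eta> x = 0" if "\<bar>x\<bar> > R" for x using that by (simp add: \<eta>_def)
  have c\<eta>: "continuous_on UNIV \<eta>" unfolding \<eta>_def by (intro continuous_intros c)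
  obtain h where h: "laurent h" "\<And>x. cmod (\<eta> x - h (cay z x)) < \<epsilon>"
    using cayley_laurent_dense[OF z c\<eta> \<eta>0 \<epsilon>(1)] by blast
  obtain g c0 where g: "laurent g"
    and gd: "\<And>x. ((\<lambda>x. g (cay z x)) has_vector_derivative ((h (cay z x) - c0) / rsq z x)) (at x)"
    using laurent_antiderivative[OF h(1) z] by blast
  define S where "S x = arctan ((x - a) / b) / b" for x
  have rr: "rsq z x = complex_of_real ((x - a)\<^sup>2 + b\<^sup>2)" for x unfolding rsq_eq a_def b_def ..
  have pos: "(x - a)\<^sup>2 + b\<^sup>2 > 0" for x using b0 by (simp add: add_nonneg_pos)
  have S': "(S has_real_derivative (1 / ((x - a)\<^sup>2 + b\<^sup>2))) (at x)" for x
  proof -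
    have d1: "(S has_real_derivative (inverse (1 + ((x - a) / b)\<^sup>2) * (1 / b) / b)) (at x)"
      unfolding S_def using b0 by (auto intro!: derivative_eq_intros)
    have d2: "inverse (1 + ((x - a) / b)\<^sup>2) * (1 / b) / b = 1 / ((x - a)\<^sup>2 + b\<^sup>2)"
    proof -
      have "(1 + ((x - a) / b)\<^sup>2) * b\<^sup>2 = (x - a)\<^sup>2 + b\<^sup>2"
        using b0 by (simp add: power_divide distrib_right)
      hence "1 / ((x - a)\<^sup>2 + b\<^sup>2) = 1 / ((1 + ((x - a) / b)\<^sup>2) * b\<^sup>2)" by simp
      also have "\<dots> = inverse (1 + ((x - a) / b)\<^sup>2) * (1 / b) / b" by (simp add: power2_eq_square divide_inverse)
      finally show ?thesis by simp
    qed
    show ?thesis using d1 unfolding d2 .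
  qed
  note S'v = S'[unfolded has_real_derivative_iff_has_vector_derivative]
  have Sc: "continuous_on X S" for X unfolding S_def by (intro continuous_intros ballI b0)
  have Sb: "\<bar>S x\<bar> \<le> \<tau> / 2" for x
    using arctan_bounded[of "(x - a) / b"] b0 by (auto simp: S_def \<tau>_def abs_if field_simps)
  \<comment> \<open>Written with \<open>\<bar>b\<bar>\<close>, so that the limits at the two ends
    have the same sign whether z lies in the upper or in the lower half plane.\<close>
  have Sabs: "S x = 1 / \<bar>b\<bar> * arctan (1 / \<bar>b\<bar> * (- a + x))" for x
  proof (cases "b > 0")
    case False
    hence "1 / \<bar>b\<bar> * (- a + x) = - ((x - a) / b)" using b0 by (simp add: field_simps)
    hence "arctan (1 / \<bar>b\<bar> * (- a + x)) = - arctan ((x - a) / b)" by (simp only: arctan_minus)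
    thus ?thesis using False by (simp add: S_def)
  qed (simp add: S_def)
  have ib: "1 / \<bar>b\<bar> > 0" using b0 by simp
  have "(S \<longlongrightarrow> 1 / \<bar>b\<bar> * (pi / 2)) at_top"
    unfolding Sabs
    by (intro tendsto_mult tendsto_const filterlim_compose[OF tendsto_arctan_at_top]
        filterlim_tendsto_pos_mult_at_top[OF tendsto_const ib] filterlim_tendsto_add_at_top[OF tendsto_const] filterlim_ident)
  hence Stop: "(S \<longlongrightarrow> \<tau> / 2) at_top" by (simp add: \<tau>_def)
  have "(S \<longlongrightarrow> 1 / \<bar>b\<bar> * (- (pi / 2))) at_bot"
    unfolding Sabs
  proof (intro tendsto_mult tendsto_const filterlim_compose[OF tendsto_arctan_at_bot]
        filterlim_tendsto_pos_mult_at_bot[OF tendsto_const ib])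
    have "filterlim (\<lambda>x. a + - x) at_top at_bot"
      by (intro filterlim_tendsto_add_at_top[OF tendsto_const] filterlim_uminus_at_top_at_bot)
    thus "filterlim (\<lambda>x. - a + x) at_bot at_bot" by (simp add: filterlim_uminus_at_bot)
  qed
  hence Sbot: "(S \<longlongrightarrow> - \<tau> / 2) at_bot" by (simp add: \<tau>_def)
  \<comment> \<open>The term with S cancels \<open>c0\<close> in the derivative; what remains is the
    approximation error of \<eta> over \<open>rsq z\<close>, so D varies by at most \<epsilon> times
    S.\<close>
  define D where "D x = g (cay z x) - \<phi> x + c0 * complex_of_real (S x)" for x
  have D': "(D has_vector_derivative ((h (cay z x) - \<eta> x) / rsq z x)) (at x)" for x
  proof -
    have "(D has_vector_derivative ((h (cay z x) - c0) / rsq z x - \<phi>' x + c0 * complex_of_real (1 / ((x - a)\<^sup>2 + b\<^sup>2)))) (at x)"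
      unfolding D_def
      by (intro has_vector_derivative_add has_vector_derivative_diff has_vector_derivative_mult_right
          has_vector_derivative_of_real gd der S')
    moreover have "(h (cay z x) - c0) / rsq z x - \<phi>' x + c0 * complex_of_real (1 / ((x - a)\<^sup>2 + b\<^sup>2))
       = (h (cay z x) - \<eta> x) / rsq z x"
    proof -
      have "c0 * complex_of_real (1 / ((x - a)\<^sup>2 + b\<^sup>2)) = c0 / rsq z x" by (simp add: rr)
      moreover have "\<phi>' x = \<eta> x / rsq z x" using rnz[of x] by (simp add: \<eta>_def)
      ultimately show ?thesis by (simp add: diff_divide_distrib)
    qed
    ultimately show ?thesis by simp
  qed
  have Dlip: "cmod (D y - D x) \<le> \<epsilon> * S y - \<epsilon> * S x" if "x < y" for x y
  proof (rule differentiable_bound_general[OF that])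
    show "continuous_on {x..y} D"
      by (rule continuous_on_vector_derivative[OF has_vector_derivative_at_within[OF D']])
    show "continuous_on {x..y} (\<lambda>x. \<epsilon> * S x)" by (intro continuous_intros Sc)
    show "(D has_vector_derivative ((h (cay z t) - \<eta> t) / rsq z t)) (at t)" for t by (rule D')
    show "((\<lambda>x. \<epsilon> * S x) has_vector_derivative (\<epsilon> * (1 / ((t - a)\<^sup>2 + b\<^sup>2)))) (at t)" for t
      by (intro has_vector_derivative_mult_right S'v)
    show "cmod ((h (cay z t) - \<eta> t) / rsq z t) \<le> \<epsilon> * (1 / ((t - a)\<^sup>2 + b\<^sup>2))" for t
    proof -
      have "cmod (rsq z t) = (t - a)\<^sup>2 + b\<^sup>2" unfolding rr using pos[of t] by (simp only: norm_of_real abs_of_pos)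
      hence "cmod ((h (cay z t) - \<eta> t) / rsq z t) = cmod (h (cay z t) - \<eta> t) / ((t - a)\<^sup>2 + b\<^sup>2)"
        by (simp only: norm_divide)
      also have "\<dots> \<le> \<epsilon> / ((t - a)\<^sup>2 + b\<^sup>2)"
        using h(2)[of t] pos[of t] by (intro divide_right_mono) (auto simp: norm_minus_commute)
      finally show ?thesis by simp
    qed
  qed
  have g1: "((\<lambda>x. g (cay z x)) \<longlongrightarrow> g 1) F" if "(cay z \<longlongrightarrow> 1) F" for F
  proof -
    have "isCont g 1"
      using continuous_on_laurent[OF g] continuous_on_eq_continuous_at[of "- {0::complex}" g] by (auto simp: open_Compl)
    thus ?thesis using that by (rule isCont_tendsto_compose)
  qed
  have \<phi>top: "(\<phi> \<longlongrightarrow> 0) at_top"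
    by (rule tendsto_eventually) (use supp in \<open>auto simp: eventually_at_top_dense intro!: exI[of _ "\<bar>R\<bar>"]\<close>)
  have \<phi>bot: "(\<phi> \<longlongrightarrow> 0) at_bot"
    by (rule tendsto_eventually) (use supp in \<open>auto simp: eventually_at_bot_dense intro!: exI[of _ "- \<bar>R\<bar>"]\<close>)
  have Dtop: "(D \<longlongrightarrow> g 1 - 0 + c0 * complex_of_real (\<tau> / 2)) at_top"
    unfolding D_def by (intro tendsto_intros g1 cay_tendsto z \<phi>top Stop)
  have Dbot: "(D \<longlongrightarrow> g 1 - 0 + c0 * complex_of_real (- \<tau> / 2)) at_bot"
    unfolding D_def by (intro tendsto_intros g1 cay_tendsto z \<phi>bot Sbot)
  have Dd: "cmod (D y - D x) \<le> \<epsilon> * \<tau>" if "x < y" for x y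
  proof -
    have "\<epsilon> * S y - \<epsilon> * S x = \<epsilon> * (S y - S x)" by (simp add: algebra_simps)
    also have "\<dots> \<le> \<epsilon> * \<tau>" using Sb[of x] Sb[of y] \<epsilon>(1) by (intro mult_left_mono) auto
    finally show ?thesis using Dlip[OF that] by simp
  qed
  have Db: "cmod (D y - (g 1 - 0 + c0 * complex_of_real (- \<tau> / 2))) \<le> \<epsilon> * \<tau>" for y
  proof (rule tendsto_upperbound)
    show "((\<lambda>x. cmod (D y - D x)) \<longlongrightarrow> cmod (D y - (g 1 - 0 + c0 * complex_of_real (- \<tau> / 2)))) at_bot"
      by (intro tendsto_intros Dbot)
    show "\<forall>\<^sub>F x in at_bot. cmod (D y - D x) \<le> \<epsilon> * \<tau>"
      by (rule eventually_mono[OF eventually_gt_at_bot[of y]]) (rule Dd)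
  qed simp
  \<comment> \<open>The limits of D at the two ends differ by exactly \<open>c0 * \<tau>\<close>,
    while D varies by at most \<open>\<epsilon> * \<tau>\<close>; this bounds
    \<open>c0\<close>.\<close>
  have "cmod ((g 1 - 0 + c0 * complex_of_real (\<tau> / 2)) - (g 1 - 0 + c0 * complex_of_real (- \<tau> / 2))) \<le> \<epsilon> * \<tau>"
  proof (rule tendsto_upperbound)
    show "((\<lambda>y. cmod (D y - (g 1 - 0 + c0 * complex_of_real (- \<tau> / 2)))) \<longlongrightarrow>
      cmod ((g 1 - 0 + c0 * complex_of_real (\<tau> / 2)) - (g 1 - 0 + c0 * complex_of_real (- \<tau> / 2)))) at_top"
      by (intro tendsto_intros Dtop)
  qed (use Db in auto)
  also have "(g 1 - 0 + c0 * complex_of_real (\<tau> / 2)) - (g 1 - 0 + c0 * complex_of_real (- \<tau> / 2)) = c0 * complex_of_real \<tau>"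
    by (simp add: algebra_simps)
  finally have "cmod c0 * \<tau> \<le> \<epsilon> * \<tau>" using \<open>\<tau> > 0\<close> by (simp add: norm_mult)
  hence c0: "cmod c0 \<le> \<epsilon>" using \<open>\<tau> > 0\<close> by simp
  have bnd1: "cmod (g (cay z x) - g 1 - \<phi> x) \<le> e" for x
  proof -
    have "g (cay z x) - g 1 - \<phi> x = (D x - (g 1 - 0 + c0 * complex_of_real (- \<tau> / 2))) - c0 * complex_of_real (S x + \<tau> / 2)"
      by (simp add: D_def algebra_simps)
    hence "cmod (g (cay z x) - g 1 - \<phi> x) \<le> cmod (D x - (g 1 - 0 + c0 * complex_of_real (- \<tau> / 2))) + cmod (c0 * complex_of_real (S x + \<tau> / 2))"
      using norm_triangle_ineq4 by metis
    also have "cmod (c0 * complex_of_real (S x + \<tau> / 2)) = cmod c0 * \<bar>S x + \<tau> / 2\<bar>" by (simp only: norm_mult norm_of_real)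
    also have "\<dots> \<le> \<epsilon> * \<tau>" using c0 Sb[of x] \<epsilon>(1) by (intro mult_mono) auto
    finally show ?thesis using Db[of x] \<epsilon>(3) by simp
  qed
  have bnd2: "cmod (rsq z x * ((h (cay z x) - c0) / rsq z x - \<phi>' x)) \<le> e" for x
  proof -
    have "q * ((y - c0) / q - p) = - (q * p - y) - c0" if "q \<noteq> 0" for q y p :: complex
      using that by (simp add: field_simps)
    from this[OF rnz] have "rsq z x * ((h (cay z x) - c0) / rsq z x - \<phi>' x) = - (\<eta> x - h (cay z x)) - c0"
      unfolding \<eta>_def .
    also have "cmod \<dots> \<le> cmod (- (\<eta> x - h (cay z x))) + cmod c0" by (rule norm_triangle_ineq4)
    also have "\<dots> \<le> e" using h(2)[of x] c0 \<epsilon>(2) by (simp only: norm_minus_cancel)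
    finally show ?thesis .
  qed
  show ?thesis
    by (intro exI[of _ g] exI[of _ "\<lambda>x. (h (cay z x) - c0) / rsq z x"] conjI allI g gd bnd1 bnd2)
qed

section \<open>Uniqueness of the spectral measure\<close>

abbreviation res :: "complex \<Rightarrow> real \<Rightarrow> complex" where
  "res z x \<equiv> 1 / (complex_of_real x - z)"

lemma norm_res_le: "Im z \<noteq> 0 \<Longrightarrow> cmod (res z x) \<le> 1 / \<bar>Im z\<bar>"
proof -
  assume z: "Im z \<noteq> 0"
  have "\<bar>Im z\<bar> \<le> cmod (complex_of_real x - z)"
    using abs_Im_le_cmod[of "complex_of_real x - z"] by simp
  thus ?thesis using z by (simp add: norm_divide frac_le)
qed

lemma bounded_borel_res:
  assumes "Im z \<noteq> 0" shows "bounded_borel (res z)"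
proof (rule bounded_borelI[OF _ norm_res_le[OF assms]])
  show "res z \<in> borel_measurable borel"
    by (intro borel_measurable_continuous_onI continuous_intros ballI real_minus_nonreal assms)
qed

lemma cay_res: "Im z \<noteq> 0 \<Longrightarrow> cay z x = 1 + (z - cnj z) * res z x"
  using cay_minus_one[of z x] by (simp add: algebra_simps)

lemma cnj_cay: "Im z \<noteq> 0 \<Longrightarrow> cnj (cay z x) = inverse (cay z x)"
proof -
  assume z: "Im z \<noteq> 0"
  have "cay z x * cnj (cay z x) = complex_of_real (1\<^sup>2)"
    by (simp only: complex_norm_square[symmetric] norm_cay[OF z])
  hence "cay z x * cnj (cay z x) = 1" by (simp only: of_real_1 power_one)
  thus ?thesis using inverse_unique by metis
qed

context pvm
begin

text \<open>The identity \<open>x / (x - z) = 1 + z / (x - z)\<close> bounds the product of x with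
  the resolvent function. Together with \<open>res_inverse\<close> it makes
  \<open>Phi (res z)\<close> the two-sided inverse of \<open>\<integral> x dE - z\<close>.\<close>

lemma res_mem:
  assumes "Im z \<noteq> 0"
  shows "(Phi (res z) v, v + z *\<^sub>C Phi (res z) v) \<in> integral_pvm E complex_of_real"
proof -
  note r = bounded_borel_res[OF assms]
  have e: "(\<lambda>x. complex_of_real x * res z x) = (\<lambda>x. 1 + z * res z x)"
    using real_minus_nonreal[OF assms] by (auto simp: field_simps)
  have "bounded_borel (\<lambda>x. complex_of_real x * res z x)"
    unfolding e by (intro bounded_borel_add bounded_borel_const bounded_borel_mult r)
  from Phi_mem_integral_pvm[OF _ r this, of v]
  have "(Phi (res z) v, Phi (\<lambda>x. complex_of_real x * res z x) v) \<in> integral_pvm E complex_of_real"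
    by simp
  moreover have "Phi (\<lambda>x. complex_of_real x * res z x) v = v + z *\<^sub>C Phi (res z) v"
    unfolding e by (simp only: Phi_add[OF bounded_borel_const bounded_borel_cmult[OF r]]
        Phi_const Phi_cmult[OF r] scaleC_one)
  ultimately show ?thesis by simp
qed

lemma res_inverse:
  assumes "Im z \<noteq> 0" "(u, w) \<in> integral_pvm E complex_of_real"
  shows "Phi (res z) (w - z *\<^sub>C u) = u"
proof -
  note r = bounded_borel_res[OF assms(1)]
  have e: "(\<lambda>x. res z x * complex_of_real x) = (\<lambda>x. 1 + z * res z x)"
    using real_minus_nonreal[OF assms(1)] by (auto simp: field_simps)
  have "bounded_borel (\<lambda>x. res z x * complex_of_real x)"
    unfolding e by (intro bounded_borel_add bounded_borel_const bounded_borel_mult r)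
  from Phi_integral_pvm[OF assms(2) r this]
  have "Phi (res z) w = u + z *\<^sub>C Phi (res z) u"
    unfolding e by (simp only: Phi_add[OF bounded_borel_const bounded_borel_cmult[OF r]]
        Phi_const Phi_cmult[OF r] scaleC_one)
  thus ?thesis
    by (simp add: linear_diff[OF bounded_linear.linear[OF Phi_bounded_linear[OF r]]] Phi_linear[OF r])
qed

end

text \<open>A class of functions closed under sums, products, conjugation and bounded pointwise
  limits, through which agreement spreads from one resolvent to the indicators of intervals.\<close>

definition Phi_agree where
  "Phi_agree E F f \<longleftrightarrow> bounded_borel f \<and> (\<forall>v. pvm.Phi E f v = pvm.Phi F f v)"

lemma Phi_agree_const:
  "pvm E \<Longrightarrow> pvm F \<Longrightarrow> Phi_agree E F (\<lambda>x. c)"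
  by (simp add: Phi_agree_def pvm.Phi_const)

lemma Phi_agree_add:
  "pvm E \<Longrightarrow> pvm F \<Longrightarrow> Phi_agree E F f \<Longrightarrow> Phi_agree E F g \<Longrightarrow> Phi_agree E F (\<lambda>x. f x + g x)"
  by (simp add: Phi_agree_def pvm.Phi_add bounded_borel_add)

lemma Phi_agree_mult:
  "pvm E \<Longrightarrow> pvm F \<Longrightarrow> Phi_agree E F f \<Longrightarrow> Phi_agree E F g \<Longrightarrow> Phi_agree E F (\<lambda>x. f x * g x)"
  by (simp add: Phi_agree_def pvm.Phi_mult bounded_borel_mult)

lemma Phi_agree_cnj:
  assumes E: "pvm E" and F: "pvm F" and f: "Phi_agree E F f"
  shows "Phi_agree E F (\<lambda>x. cnj (f x))"
proof -
  have b: "bounded_borel f" "\<And>v. pvm.Phi E f v = pvm.Phi F f v" using f by (auto simp: Phi_agree_def)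
  have "pvm.Phi E (\<lambda>x. cnj (f x)) v = pvm.Phi F (\<lambda>x. cnj (f x)) v" for v
  proof (rule cinner_eqI[of UNIV])
    fix u
    show "cinner u (pvm.Phi E (\<lambda>x. cnj (f x)) v) = cinner u (pvm.Phi F (\<lambda>x. cnj (f x)) v)"
      using b by (simp add: pvm.Phi_adj[OF E bounded_borel_cnj] pvm.Phi_adj[OF F bounded_borel_cnj])
  qed simp
  thus ?thesis using b by (simp add: Phi_agree_def bounded_borel_cnj)
qed

lemma Phi_agree_tendsto:
  assumes E: "pvm E" and F: "pvm F" and f: "\<And>n. Phi_agree E F (f n)" and g: "g \<in> borel_measurable borel"
    and K: "\<And>n x. cmod (f n x) \<le> K" and lim: "\<And>x. (\<lambda>n. f n x) \<longlonglongrightarrow> g x"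
  shows "Phi_agree E F g"
proof -
  have "cmod (g x) \<le> K" for x by (rule LIMSEQ_le_const2[OF tendsto_norm[OF lim]]) (use K in auto)
  hence bg: "bounded_borel g" using g by (intro bounded_borelI)
  have b: "\<And>n. bounded_borel (f n)" "\<And>n v. pvm.Phi E (f n) v = pvm.Phi F (f n) v"
    using f by (auto simp: Phi_agree_def)
  have "pvm.Phi E g v = pvm.Phi F g v" for v
    using pvm.Phi_tendsto[OF E b(1) bg K lim, of v] pvm.Phi_tendsto[OF F b(1) bg K lim, of v]
    unfolding b(2) by (rule LIMSEQ_unique)
  thus ?thesis using bg by (simp add: Phi_agree_def)
qed

text \<open>\<open>cay z\<close> is affine in the resolvent, and as it has modulus 1 its negative
  powers are powers of its conjugate.\<close>

lemma Phi_agree_laurent: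
  assumes E: "pvm E" and F: "pvm F" and r: "Phi_agree E F (res z)" and z: "Im z \<noteq> 0" and h: "laurent h"
  shows "Phi_agree E F (\<lambda>x. h (cay z x))"
proof -
  have cay: "Phi_agree E F (cay z)"
    unfolding cay_res[OF z, abs_def]
    by (rule Phi_agree_add[OF E F Phi_agree_const[OF E F] Phi_agree_mult[OF E F Phi_agree_const[OF E F] r]])
  have pw: "Phi_agree E F (\<lambda>x. f x ^ n)" if "Phi_agree E F f" for f and n :: nat
    by (induction n) (simp_all add: Phi_agree_const Phi_agree_mult E F that)
  have powi: "Phi_agree E F (\<lambda>x. cay z x powi k)" for k
  proof (cases "k \<ge> 0")
    case True
    thus ?thesis using pw[OF cay, of "nat k"] by (simp add: power_int_def)
  next
    case False
    thus ?thesis using pw[OF Phi_agree_cnj[OF E F cay], of "nat (- k)"]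
      by (simp add: power_int_def cnj_cay[OF z])
  qed
  show ?thesis
    using h by induction (auto intro!: Phi_agree_add Phi_agree_mult Phi_agree_const E F powi)
qed

lemma Phi_agree_compact_support:
  assumes E: "pvm E" and F: "pvm F" and r: "Phi_agree E F (res z)" and z: "Im z \<noteq> 0"
    and c: "continuous_on UNIV \<eta>" and supp: "\<And>x. \<bar>x\<bar> > R \<Longrightarrow> \<eta> x = 0"
    and K: "\<And>x. cmod (\<eta> x) \<le> K"
  shows "Phi_agree E F \<eta>"
proof -
  have "\<exists>h. laurent h \<and> (\<forall>x. cmod (\<eta> x - h (cay z x)) < 1 / Suc n)" for n
    by (rule cayley_laurent_dense[OF z c supp]) simp_all
  then obtain h where h: "\<And>n. laurent (h n)" "\<And>n x. cmod (\<eta> x - h n (cay z x)) < 1 / Suc n" by metis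
  show ?thesis
  proof (rule Phi_agree_tendsto[OF E F])
    show "Phi_agree E F (\<lambda>x. h n (cay z x))" for n by (intro Phi_agree_laurent[OF E F r z] h)
    show "\<eta> \<in> borel_measurable borel" by (rule borel_measurable_continuous_onI[OF c])
    show "cmod (h n (cay z x)) \<le> K + 1" for n x
    proof -
      have "cmod (h n (cay z x)) \<le> cmod (\<eta> x) + cmod (\<eta> x - h n (cay z x))"
        using norm_triangle_ineq4[of "\<eta> x" "\<eta> x - h n (cay z x)"] by simp
      moreover have "1 / real (Suc n) \<le> 1" by simp
      ultimately show ?thesis using h(2)[of x n] K[of x] by linarith
    qed
    show "(\<lambda>n. h n (cay z x)) \<longlonglongrightarrow> \<eta> x" for x
    proof -
      have "(\<lambda>n. \<eta> x - h n (cay z x)) \<longlonglongrightarrow> 0"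
        by (rule Lim_null_comparison[OF _ LIMSEQ_Suc[OF lim_1_over_n]])
          (use h(2)[of x] in \<open>auto intro!: always_eventually less_imp_le\<close>)
      from tendsto_diff[OF tendsto_const[of "\<eta> x"] this] show ?thesis by simp
    qed
  qed
qed

lemma Phi_agree_interval:
  assumes E: "pvm E" and F: "pvm F" and r: "Phi_agree E F (res z)" and z: "Im z \<noteq> 0"
  shows "Phi_agree E F (indicator {a<..<b})"
proof (rule Phi_agree_tendsto[OF E F])
  \<comment> \<open>Continuous functions between 0 and 1 that rise with slope n from both endpoints.
    They vanish off the open interval and are eventually 1 at each of its points.\<close>
  define t where "t n x = min 1 (real n * max 0 (min (x - a) (b - x)))" for n :: nat and x :: real
  have t: "0 \<le> t n x" "t n x \<le> 1" for n x by (auto simp: t_def)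
  show "Phi_agree E F (\<lambda>x. complex_of_real (t n x))" for n
  proof (rule Phi_agree_compact_support[OF E F r z, where R = "\<bar>a\<bar> + \<bar>b\<bar>" and K = 1])
    show "continuous_on UNIV (\<lambda>x. complex_of_real (t n x))"
      unfolding t_def by (intro continuous_intros)
    show "complex_of_real (t n x) = 0" if "\<bar>x\<bar> > \<bar>a\<bar> + \<bar>b\<bar>" for x
    proof -
      have "min (x - a) (b - x) \<le> 0" using that by (auto simp: min_def abs_if split: if_splits)
      hence "max 0 (min (x - a) (b - x)) = 0" by (simp only: max_absorb1)
      thus ?thesis by (simp only: t_def) simp
    qed
    show "cmod (complex_of_real (t n x)) \<le> 1" for x using t[of n x] by simp
  qed
  show "cmod (complex_of_real (t n x)) \<le> 1" for n x using t[of n x] by simp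
  show "(\<lambda>n. complex_of_real (t n x)) \<longlonglongrightarrow> indicator {a<..<b} x" for x
  proof (cases "x \<in> {a<..<b}")
    case True
    define d where "d = min (x - a) (b - x)"
    have "d > 0" using True by (simp add: d_def)
    obtain N :: nat where N: "1 / d < N" using reals_Archimedean2 by blast
    have "t n x = 1" if "n \<ge> N" for n
    proof -
      have "1 / d \<le> n" using N that by linarith
      hence "1 \<le> n * d" using \<open>d > 0\<close> by (simp add: field_simps)
      thus ?thesis using \<open>d > 0\<close> by (simp add: t_def d_def[symmetric])
    qed
    hence "\<forall>\<^sub>F n in sequentially. complex_of_real (t n x) = 1"
      by (auto simp: eventually_sequentially)
    thus ?thesis using True by (simp add: tendsto_eventually)
  next
    case False
    hence "min (x - a) (b - x) \<le> 0" by (auto simp: min_def)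
    hence "max 0 (min (x - a) (b - x)) = 0" by (simp only: max_absorb1)
    hence "t n x = 0" for n by (simp add: t_def del: max_less_iff_conj)
    thus ?thesis using False by simp
  qed
qed simp

text \<open>Open intervals form an intersection-stable generator of the Borel sets; additivity
  carries the equality to complements and disjoint unions.\<close>

lemma pvm_eq_of_res:
  assumes E: "pvm E" and F: "pvm F" and r: "Phi_agree E F (res z)" and z: "Im z \<noteq> 0"
    and S: "S \<in> sets borel"
  shows "E S = F S"
proof -
  define G where "G = range (\<lambda>(a, b). {a<..<b :: real})"
  have "sets borel = sigma_sets UNIV G"
    unfolding G_def by (subst borel_eq_box) (simp add: box_real case_prod_unfold)
  hence S': "S \<in> sigma_sets UNIV G" using S by (simp only:)
  have bor: "A \<in> sets borel" if "A \<in> sigma_sets UNIV G" for A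
    using that unfolding \<open>sets borel = sigma_sets UNIV G\<close> .
  have "Int_stable G"
  proof (rule Int_stableI)
    fix A B assume "A \<in> G" "B \<in> G"
    then obtain a b c d where "A = {a<..<b}" "B = {c<..<d}" by (auto simp: G_def)
    hence "A \<inter> B = (\<lambda>(a, b). {a<..<b}) (max a c, min b d)" by auto
    thus "A \<inter> B \<in> G" unfolding G_def by (rule image_eqI) simp
  qed
  moreover have "G \<subseteq> Pow UNIV" by simp
  ultimately show ?thesis using S'
  proof (induction rule: sigma_sets_induct_disjoint)
    case (basic A)
    then obtain a b where "A = {a<..<b}" by (auto simp: G_def)
    thus ?case
      using Phi_agree_interval[OF E F r z, of a b]
      by (auto simp: Phi_agree_def pvm.Phi_indicator[OF E] pvm.Phi_indicator[OF F])
  next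
    case empty
    show ?case by (rule ext) (simp add: pvm.E_empty[OF E] pvm.E_empty[OF F])
  next
    case (compl A)
    have A: "A \<in> sets borel" "- A \<in> sets borel" using bor[OF compl.hyps] by auto
    have "E (- A) v = F (- A) v" for v
    proof -
      have "E A v + E (- A) v = v" "F A v + F (- A) v = v"
        using pvm.E_Un[OF E A, of v] pvm.E_Un[OF F A, of v]
        by (simp_all add: pvm.E_UNIV[OF E] pvm.E_UNIV[OF F])
      thus ?thesis using compl.IH by (metis add_left_cancel)
    qed
    hence "E (- A) = F (- A)" by (rule ext)
    thus ?case by (simp only: Compl_eq_Diff_UNIV)
  next
    case (union A)
    have "range A \<subseteq> sets borel" using union.hyps(2) bor by auto
    note EF = pvm.E_sums[OF E this union.hyps(1)] pvm.E_sums[OF F this union.hyps(1)]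
    show ?case
    proof (rule ext)
      fix v show "E (\<Union> (range A)) v = F (\<Union> (range A)) v"
        using EF(1)[of v] EF(2)[of v] unfolding union.IH by (rule sums_unique2)
    qed
  qed
qed

lemma integral_pvm_cong:
  assumes E: "pvm E" and F: "pvm F" and eq: "\<And>S. S \<in> sets borel \<Longrightarrow> E S = F S"
  shows "integral_pvm E f = integral_pvm F f"
proof -
  have m: "scalar_spectral_measure E v = scalar_spectral_measure F v" for v
    by (rule measure_eqI) (auto simp: pvm.sets_mu[OF E] pvm.sets_mu[OF F] pvm.emeasure_mu[OF E]
        pvm.emeasure_mu[OF F] eq)
  have "simple_integral_pvm E s v = simple_integral_pvm F s v" if "simple_function borel s" for s v
    unfolding simple_integral_pvm_def using simple_function_borelD(2)[OF that] eq by simp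
  note si = this
  show ?thesis
  proof (intro set_eqI iffI; clarify)
    fix v w assume "(v, w) \<in> integral_pvm E f"
    then obtain s where s: "f \<in> borel_measurable borel" "\<And>n. simple_function borel (s n)"
      "(\<lambda>n. \<integral>\<^sup>+x. ennreal ((cmod (s n x - f x))\<^sup>2) \<partial>scalar_spectral_measure E v) \<longlonglongrightarrow> 0"
      "(\<lambda>n. simple_integral_pvm E (s n) v) \<longlonglongrightarrow> w"
      unfolding integral_pvm_def by auto
    thus "(v, w) \<in> integral_pvm F f" unfolding integral_pvm_def m si[OF s(2)] by auto
  next
    fix v w assume "(v, w) \<in> integral_pvm F f"
    then obtain s where s: "f \<in> borel_measurable borel" "\<And>n. simple_function borel (s n)"
      "(\<lambda>n. \<integral>\<^sup>+x. ennreal ((cmod (s n x - f x))\<^sup>2) \<partial>scalar_spectral_measure F v) \<longlonglongrightarrow> 0"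
      "(\<lambda>n. simple_integral_pvm F (s n) v) \<longlonglongrightarrow> w"
      unfolding integral_pvm_def by auto
    thus "(v, w) \<in> integral_pvm E f" unfolding integral_pvm_def m[symmetric] si[OF s(2), symmetric] by auto
  qed
qed

text \<open>For both measures the function \<open>res \<i>\<close> is sent to the inverse of the
  same operator \<open>H - i\<close>, so they agree on one resolvent and hence everywhere.\<close>

lemma spectral_measure_of_unique:
  assumes E: "spectral_measure_of H E" and F: "spectral_measure_of H F" and S: "S \<in> sets borel"
  shows "E S = F S"
proof -
  have pE: "pvm E" and pF: "pvm F" and H: "H = integral_pvm E complex_of_real" "H = integral_pvm F complex_of_real"
    using E F by (auto simp: spectral_measure_of_def pvm_def)
  have i: "Im \<i> \<noteq> 0" by simp
  have "pvm.Phi E (res \<i>) v = pvm.Phi F (res \<i>) v" for v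
  proof -
    have "(pvm.Phi E (res \<i>) v, v + \<i> *\<^sub>C pvm.Phi E (res \<i>) v) \<in> integral_pvm F complex_of_real"
      using pvm.res_mem[OF pE i, of v] unfolding H(1)[symmetric] H(2)[symmetric] .
    from pvm.res_inverse[OF pF i this] show ?thesis by simp
  qed
  hence "Phi_agree E F (res \<i>)" using bounded_borel_res[OF i] by (simp add: Phi_agree_def)
  thus ?thesis using pvm_eq_of_res[OF pE pF _ i S] by blast
qed

text \<open>The definition of \<open>op_fun\<close> is a union over all spectral measures of H; by
  uniqueness all members of this union coincide.\<close>

lemma op_fun_eq_integral_pvm:
  assumes E: "spectral_measure_of H E" shows "op_fun f H = integral_pvm E f"
proof -
  have "integral_pvm F f = integral_pvm E f" if F: "spectral_measure_of H F" for F
  proof (rule integral_pvm_cong)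
    show "pvm F" "pvm E" using E F by (simp_all add: spectral_measure_of_def pvm_def)
  qed (rule spectral_measure_of_unique[OF F E])
  note eq = this
  show ?thesis
  proof (intro set_eqI iffI; clarify)
    fix v w assume "(v, w) \<in> op_fun f H"
    then obtain F where "spectral_measure_of H F" "(v, w) \<in> integral_pvm F f" unfolding op_fun_def by blast
    thus "(v, w) \<in> integral_pvm E f" using eq by blast
  next
    fix v w assume "(v, w) \<in> integral_pvm E f"
    thus "(v, w) \<in> op_fun f H" using E unfolding op_fun_def by blast
  qed
qed

section \<open>Self-adjoint operators\<close>

lemma app_eq: "single_valued T \<Longrightarrow> (u, w) \<in> T \<Longrightarrow> T \<cdot> u = w"
  unfolding app_def by (rule the_equality) (auto dest: single_valuedD)

locale selfadjoint_op =
  fixes A :: "'a::complex_hilbert operator"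
  assumes sa: "selfadjoint A"
begin

lemma lin: "linear_operator A" using sa by (simp add: selfadjoint_def)

lemma sv: "single_valued A" using lin by (simp add: linear_operator_def)

lemma dense: "closure (Domain A) = UNIV" using sa by (simp add: selfadjoint_def)

lemma appI: "(u, w) \<in> A \<Longrightarrow> A \<cdot> u = w" by (rule app_eq[OF sv])

lemma app_mem: "u \<in> Domain A \<Longrightarrow> (u, A \<cdot> u) \<in> A" using appI by auto

lemma zero_mem: "(0, 0) \<in> A" using lin by (simp add: linear_operator_def)

lemma add_mem: "(u, w) \<in> A \<Longrightarrow> (u', w') \<in> A \<Longrightarrow> (u + u', w + w') \<in> A"
  using lin by (simp add: linear_operator_def)

lemma scaleC_mem: "(u, w) \<in> A \<Longrightarrow> (c *\<^sub>C u, c *\<^sub>C w) \<in> A"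
  using lin by (simp add: linear_operator_def)

lemma diff_mem: "(u, w) \<in> A \<Longrightarrow> (u', w') \<in> A \<Longrightarrow> (u - u', w - w') \<in> A"
  using add_mem[of u w "- u'" "- w'"] scaleC_mem[of u' w' "-1"] by (simp add: scaleC_minus_left)

lemma Domain_zero [simp]: "0 \<in> Domain A" using zero_mem by auto

lemma Domain_add: "u \<in> Domain A \<Longrightarrow> v \<in> Domain A \<Longrightarrow> u + v \<in> Domain A"
  using add_mem by blast

lemma Domain_scaleC: "u \<in> Domain A \<Longrightarrow> c *\<^sub>C u \<in> Domain A" using scaleC_mem by blast

lemma app_add: "u \<in> Domain A \<Longrightarrow> v \<in> Domain A \<Longrightarrow> A \<cdot> (u + v) = A \<cdot> u + A \<cdot> v"
  by (intro appI add_mem app_mem)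

lemma app_scaleC: "u \<in> Domain A \<Longrightarrow> A \<cdot> (c *\<^sub>C u) = c *\<^sub>C (A \<cdot> u)"
  by (intro appI scaleC_mem app_mem)

lemma symm:
  assumes "u \<in> Domain A" "v \<in> Domain A" shows "cinner (A \<cdot> u) v = cinner u (A \<cdot> v)"
proof -
  have "(u, A \<cdot> u) \<in> adjoint_op A" using app_mem[OF assms(1)] sa by (simp add: selfadjoint_def)
  thus ?thesis using assms(2) by (simp add: adjoint_op_def)
qed

lemma memI: "(\<And>u. u \<in> Domain A \<Longrightarrow> cinner v (A \<cdot> u) = cinner w u) \<Longrightarrow> (v, w) \<in> A"
proof -
  assume "\<And>u. u \<in> Domain A \<Longrightarrow> cinner v (A \<cdot> u) = cinner w u"
  hence "(v, w) \<in> adjoint_op A" by (simp add: adjoint_op_def)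
  thus "(v, w) \<in> A" using sa by (simp add: selfadjoint_def)
qed

lemma closed_op:
  assumes "\<And>n. (x n, y n) \<in> A" "x \<longlonglongrightarrow> a" "y \<longlonglongrightarrow> b" shows "(a, b) \<in> A"
proof (rule memI)
  fix u assume u: "u \<in> Domain A"
  have "(\<lambda>n. cinner (x n) (A \<cdot> u)) \<longlonglongrightarrow> cinner a (A \<cdot> u)" by (intro tendsto_cinner assms tendsto_const)
  moreover have eq: "cinner (x n) (A \<cdot> u) = cinner (y n) u" for n
    using symm[OF DomainI[OF assms(1)] u, of n] appI[OF assms(1)] by simp
  moreover have "(\<lambda>n. cinner (y n) u) \<longlonglongrightarrow> cinner b u" by (intro tendsto_cinner assms tendsto_const)
  ultimately show "cinner a (A \<cdot> u) = cinner b u" unfolding eq by (blast intro: LIMSEQ_unique)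
qed

text \<open>The cross terms cancel because \<open>cinner x (A \<cdot> x)\<close> is real while its
  coefficient is purely imaginary.\<close>

lemma norm_shift:
  assumes "x \<in> Domain A"
  shows "(norm (x + (\<i> * complex_of_real \<epsilon>) *\<^sub>C (A \<cdot> x)))\<^sup>2 = (norm x)\<^sup>2 + \<epsilon>\<^sup>2 * (norm (A \<cdot> x))\<^sup>2"
proof -
  have "complex_of_real ((norm (x + (\<i> * complex_of_real \<epsilon>) *\<^sub>C (A \<cdot> x)))\<^sup>2)
     = cinner x x + \<epsilon>\<^sup>2 * cinner (A \<cdot> x) (A \<cdot> x)"
    unfolding cinner_self[symmetric] using symm[OF assms assms]
    by (simp add: cinner_add_left cinner_add_right cinner_scaleC_left cinner_scaleC_right
        algebra_simps power2_eq_square)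
  also have "\<dots> = complex_of_real ((norm x)\<^sup>2 + \<epsilon>\<^sup>2 * (norm (A \<cdot> x))\<^sup>2)" by (simp add: cinner_self)
  finally show ?thesis using of_real_eq_iff by blast
qed

lemma norm_le_shift:
  assumes "x \<in> Domain A" shows "norm x \<le> norm (x + (\<i> * complex_of_real \<epsilon>) *\<^sub>C (A \<cdot> x))"
  by (rule power2_le_imp_le) (use norm_shift[OF assms, of \<epsilon>] in auto)

text \<open>By \<open>norm_le_shift\<close> and closedness of A the range V is closed. A vector
  orthogonal to V lies in the domain of the adjoint, hence of A, and is annihilated by the shift
  with \<open>- \<epsilon>\<close>, which is injective.\<close>

lemma shift_surj:
  assumes "\<epsilon> \<noteq> 0"
  shows "\<exists>x\<in>Domain A. x + (\<i> * complex_of_real \<epsilon>) *\<^sub>C (A \<cdot> x) = y"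
proof -
  define c where "c = \<i> * complex_of_real \<epsilon>"
  have c0: "c \<noteq> 0" using assms by (simp add: c_def)
  define V where "V = (\<lambda>x. x + c *\<^sub>C (A \<cdot> x)) ` Domain A"
  have "closure V \<subseteq> V"
  proof
    fix w assume "w \<in> closure V"
    then obtain g where g: "\<And>n. g n \<in> V" "g \<longlonglongrightarrow> w" unfolding closure_sequential by auto
    from g(1) have "\<exists>x. x \<in> Domain A \<and> g n = x + c *\<^sub>C (A \<cdot> x)" for n unfolding V_def by blast
    then obtain x where x: "\<And>n. x n \<in> Domain A" "\<And>n. g n = x n + c *\<^sub>C (A \<cdot> x n)" by metis
    have xd: "norm (x m - x n) \<le> norm (g m - g n)" for m n
    proof -
      have m: "(x m - x n, A \<cdot> x m - A \<cdot> x n) \<in> A" by (intro diff_mem app_mem x)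
      hence "norm (x m - x n) \<le> norm ((x m - x n) + c *\<^sub>C (A \<cdot> (x m - x n)))"
        unfolding c_def by (intro norm_le_shift) auto
      also have "(x m - x n) + c *\<^sub>C (A \<cdot> (x m - x n)) = g m - g n"
        using appI[OF m] by (simp add: x(2) scaleC_diff_right)
      finally show ?thesis .
    qed
    have "Cauchy x"
    proof (rule metric_CauchyI)
      fix e :: real assume "e > 0"
      with LIMSEQ_imp_Cauchy[OF g(2)] obtain M where "\<And>m n. m \<ge> M \<Longrightarrow> n \<ge> M \<Longrightarrow> dist (g m) (g n) < e"
        unfolding Cauchy_def by blast
      thus "\<exists>M. \<forall>m\<ge>M. \<forall>n\<ge>M. dist (x m) (x n) < e"
        using xd unfolding dist_norm by (meson le_less_trans)
    qed
    then obtain a where a: "x \<longlonglongrightarrow> a" using Cauchy_convergent convergent_def by blast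
    have "(\<lambda>n. (1 / c) *\<^sub>C (g n - x n)) \<longlonglongrightarrow> (1 / c) *\<^sub>C (w - a)"
      by (intro tendsto_scaleC tendsto_diff g a)
    moreover have "(1 / c) *\<^sub>C (g n - x n) = A \<cdot> x n" for n using c0 by (simp add: x(2) scaleC_scaleC)
    ultimately have l: "(\<lambda>n. A \<cdot> x n) \<longlonglongrightarrow> (1 / c) *\<^sub>C (w - a)" by simp
    have "(a, (1 / c) *\<^sub>C (w - a)) \<in> A" by (rule closed_op[OF app_mem[OF x(1)] a l])
    hence "a \<in> Domain A" "a + c *\<^sub>C (A \<cdot> a) = w" using c0 by (auto simp: appI scaleC_scaleC)
    thus "w \<in> V" unfolding V_def by blast
  qed
  \<comment> \<open>Riesz representation of \<open>cinner y\<close> on V produces the orthogonal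
    projection w of y; it lies in V because V is closed.\<close>
  have "\<exists>w\<in>closure V. \<forall>x\<in>V. cinner w x = cinner y x"
  proof (rule riesz_subspace[where K = "norm y"])
    show "0 \<in> V" unfolding V_def using appI[OF zero_mem] by (intro image_eqI[of _ _ 0]) auto
    show "x + x' \<in> V" if "x \<in> V" "x' \<in> V" for x x'
    proof -
      obtain p q where pq: "p \<in> Domain A" "q \<in> Domain A" "x = p + c *\<^sub>C (A \<cdot> p)" "x' = q + c *\<^sub>C (A \<cdot> q)"
        using \<open>x \<in> V\<close> \<open>x' \<in> V\<close> unfolding V_def by blast
      thus ?thesis unfolding V_def
        by (intro image_eqI[of _ _ "p + q"]) (auto simp: app_add scaleC_add_right intro: Domain_add)
    qed
    show "d *\<^sub>C x \<in> V" if "x \<in> V" for d x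
    proof -
      obtain p where p: "p \<in> Domain A" "x = p + c *\<^sub>C (A \<cdot> p)" using \<open>x \<in> V\<close> unfolding V_def by blast
      thus ?thesis unfolding V_def
        by (intro image_eqI[of _ _ "d *\<^sub>C p"])
          (auto simp: app_scaleC scaleC_add_right scaleC_scaleC mult.commute intro: Domain_scaleC)
    qed
  qed (auto simp: cinner_add_right cinner_scaleC_right cinner_norm)
  then obtain w where w: "w \<in> V" "\<And>x. x \<in> V \<Longrightarrow> cinner w x = cinner y x" using \<open>closure V \<subseteq> V\<close> by blast
  define d where "d = y - w"
  have orth: "cinner d (x + c *\<^sub>C (A \<cdot> x)) = 0" if "x \<in> Domain A" for x
    using w(2)[of "x + c *\<^sub>C (A \<cdot> x)"] that unfolding V_def d_def by (simp add: cinner_diff_left)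
  \<comment> \<open>Orthogonality to the range says that d is an eigenvector of the adjoint;
    self-adjointness turns it into one of A with a nonreal eigenvalue, which is impossible.\<close>
  have "(d, cnj (- 1 / c) *\<^sub>C d) \<in> A"
  proof (rule memI)
    fix x assume "x \<in> Domain A"
    from orth[OF this] have "cinner d x + c * cinner d (A \<cdot> x) = 0"
      by (simp add: cinner_add_right cinner_scaleC_right)
    hence "cinner d (A \<cdot> x) = (- 1 / c) * cinner d x" using c0 by (simp add: field_simps eq_neg_iff_add_eq_0)
    thus "cinner d (A \<cdot> x) = cinner (cnj (- 1 / c) *\<^sub>C d) x" by (simp add: cinner_scaleC_left)
  qed
  hence dD: "d \<in> Domain A" and dA: "A \<cdot> d = cnj (- 1 / c) *\<^sub>C d" using appI by auto
  have "d + (\<i> * complex_of_real (- \<epsilon>)) *\<^sub>C (A \<cdot> d) = d + (\<i> * complex_of_real (- \<epsilon>) * cnj (- 1 / c)) *\<^sub>C d"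
    by (simp add: dA scaleC_scaleC)
  also have "\<i> * complex_of_real (- \<epsilon>) * cnj (- 1 / c) = -1" using assms by (simp add: c_def field_simps)
  finally have "d + (\<i> * complex_of_real (- \<epsilon>)) *\<^sub>C (A \<cdot> d) = 0" by (simp add: scaleC_minus_left)
  hence "d = 0" using norm_le_shift[OF dD, of "- \<epsilon>"] by simp
  hence "y \<in> V" using w(1) by (simp add: d_def)
  thus ?thesis unfolding V_def c_def by blast
qed

lemma shift_inj:
  assumes "x \<in> Domain A" "y \<in> Domain A"
    "x + (\<i> * complex_of_real \<epsilon>) *\<^sub>C (A \<cdot> x) = y + (\<i> * complex_of_real \<epsilon>) *\<^sub>C (A \<cdot> y)"
  shows "x = y"
proof -
  have m: "(x - y, A \<cdot> x - A \<cdot> y) \<in> A" by (intro diff_mem app_mem assms)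
  have "(x - y) + (\<i> * complex_of_real \<epsilon>) *\<^sub>C (A \<cdot> (x - y)) = 0"
    using assms(3) unfolding appI[OF m] by (simp add: scaleC_diff_right algebra_simps)
  thus ?thesis using norm_le_shift[of "x - y" \<epsilon>] m by auto
qed

text \<open>The operator \<open>(1 + i \<epsilon> A)\<^sup>-\<^sup>1\<close>: a contraction into the
  domain that commutes with A and tends strongly to the identity as \<epsilon> tends to 0. It serves
  as a regularizer.\<close>

definition J :: "real \<Rightarrow> 'a \<Rightarrow> 'a" where
  "J \<epsilon> y = (SOME x. x \<in> Domain A \<and> x + (\<i> * complex_of_real \<epsilon>) *\<^sub>C (A \<cdot> x) = y)"

lemma J:
  assumes "\<epsilon> \<noteq> 0"
  shows "J \<epsilon> y \<in> Domain A" "J \<epsilon> y + (\<i> * complex_of_real \<epsilon>) *\<^sub>C (A \<cdot> J \<epsilon> y) = y"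
proof -
  have "\<exists>x. x \<in> Domain A \<and> x + (\<i> * complex_of_real \<epsilon>) *\<^sub>C (A \<cdot> x) = y" using shift_surj[OF assms] by blast
  from someI_ex[OF this] show "J \<epsilon> y \<in> Domain A" "J \<epsilon> y + (\<i> * complex_of_real \<epsilon>) *\<^sub>C (A \<cdot> J \<epsilon> y) = y"
    unfolding J_def by auto
qed

lemma J_unique:
  assumes "\<epsilon> \<noteq> 0" "x \<in> Domain A" "x + (\<i> * complex_of_real \<epsilon>) *\<^sub>C (A \<cdot> x) = y"
  shows "J \<epsilon> y = x"
  by (rule shift_inj[where \<epsilon> = \<epsilon>, OF J(1)[OF assms(1)] assms(2)]) (simp only: J(2)[OF assms(1)] assms(3))

lemma J_norm: "\<epsilon> \<noteq> 0 \<Longrightarrow> norm (J \<epsilon> y) \<le> norm y"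
  by (metis norm_le_shift[OF J(1)] J(2))

lemma J_add: "\<epsilon> \<noteq> 0 \<Longrightarrow> J \<epsilon> (x + y) = J \<epsilon> x + J \<epsilon> y"
proof -
  assume e: "\<epsilon> \<noteq> 0"
  show ?thesis
  proof (rule J_unique[OF e])
    show "J \<epsilon> x + J \<epsilon> y \<in> Domain A" by (intro Domain_add J e)
    have "J \<epsilon> x + J \<epsilon> y + (\<i> * complex_of_real \<epsilon>) *\<^sub>C (A \<cdot> (J \<epsilon> x + J \<epsilon> y))
       = (J \<epsilon> x + (\<i> * complex_of_real \<epsilon>) *\<^sub>C (A \<cdot> J \<epsilon> x)) + (J \<epsilon> y + (\<i> * complex_of_real \<epsilon>) *\<^sub>C (A \<cdot> J \<epsilon> y))"
      using J(1)[OF e] by (simp add: app_add scaleC_add_right)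
    thus "J \<epsilon> x + J \<epsilon> y + (\<i> * complex_of_real \<epsilon>) *\<^sub>C (A \<cdot> (J \<epsilon> x + J \<epsilon> y)) = x + y"
      by (simp only: J(2)[OF e])
  qed
qed

lemma J_commute:
  assumes "\<epsilon> \<noteq> 0" "u \<in> Domain A"
  shows "A \<cdot> J \<epsilon> u = J \<epsilon> (A \<cdot> u)"
proof -
  define c where "c = \<i> * complex_of_real \<epsilon>"
  have c0: "c \<noteq> 0" using assms by (simp add: c_def)
  define x where "x = J \<epsilon> u"
  have x: "x \<in> Domain A" "x + c *\<^sub>C (A \<cdot> x) = u" using J[OF assms(1)] by (auto simp: x_def c_def)
  have "(u - x, A \<cdot> u - A \<cdot> x) \<in> A" by (intro diff_mem app_mem x assms)
  from scaleC_mem[OF this, of "1 / c"]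
  have m: "(A \<cdot> x, (1 / c) *\<^sub>C (A \<cdot> u - A \<cdot> x)) \<in> A"
    using c0 x(2)[symmetric] by (simp add: scaleC_scaleC)
  have "J \<epsilon> (A \<cdot> u) = A \<cdot> x"
  proof (rule J_unique[OF assms(1)])
    show "A \<cdot> x \<in> Domain A" using m by auto
    show "A \<cdot> x + (\<i> * complex_of_real \<epsilon>) *\<^sub>C (A \<cdot> (A \<cdot> x)) = A \<cdot> u"
      unfolding appI[OF m] c_def[symmetric] using c0 by (simp add: scaleC_scaleC)
  qed
  thus ?thesis by (simp add: x_def)
qed

lemma J_adj:
  assumes "\<epsilon> \<noteq> 0" shows "cinner (J (- \<epsilon>) u) v = cinner u (J \<epsilon> v)"
proof -
  define x y where "x = J (- \<epsilon>) u" and "y = J \<epsilon> v"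
  have x: "x \<in> Domain A" "x + (\<i> * complex_of_real (- \<epsilon>)) *\<^sub>C (A \<cdot> x) = u"
    unfolding x_def using J[of "- \<epsilon>"] assms by auto
  have y: "y \<in> Domain A" "y + (\<i> * complex_of_real \<epsilon>) *\<^sub>C (A \<cdot> y) = v"
    unfolding y_def using J[of \<epsilon>] assms by auto
  have "cinner x (y + (\<i> * complex_of_real \<epsilon>) *\<^sub>C (A \<cdot> y)) = cinner (x + (\<i> * complex_of_real (- \<epsilon>)) *\<^sub>C (A \<cdot> x)) y"
    using symm[OF x(1) y(1)]
    by (simp add: cinner_add_left cinner_add_right cinner_scaleC_left cinner_scaleC_right)
  thus ?thesis unfolding x(2) y(2) by (simp add: x_def y_def)
qed

text \<open>On the domain the error is at most
  \<open>\<bar>\<epsilon>\<bar> * norm (A \<cdot> d)\<close>; density and the contraction property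
  do the rest.\<close>

lemma J_tendsto:
  assumes e: "\<And>n. \<epsilon> n \<noteq> 0" "\<epsilon> \<longlonglongrightarrow> 0"
  shows "(\<lambda>n. J (\<epsilon> n) u) \<longlonglongrightarrow> u"
proof (rule LIMSEQ_I)
  fix r :: real assume r: "r > 0"
  have "u \<in> closure (Domain A)" using dense by simp
  then obtain d where d: "d \<in> Domain A" "dist d u < r / 3"
    using r unfolding closure_approachable by (metis divide_pos_pos zero_less_numeral)
  have "(\<lambda>n. \<bar>\<epsilon> n\<bar> * norm (A \<cdot> d)) \<longlonglongrightarrow> \<bar>0\<bar> * norm (A \<cdot> d)" by (intro tendsto_intros e)
  hence "\<forall>\<^sub>F n in sequentially. \<bar>\<epsilon> n\<bar> * norm (A \<cdot> d) < r / 3" using r by (intro order_tendstoD(2)) auto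
  then obtain N where N: "\<And>n. n \<ge> N \<Longrightarrow> \<bar>\<epsilon> n\<bar> * norm (A \<cdot> d) < r / 3" by (auto simp: eventually_sequentially)
  have "norm (J (\<epsilon> n) u - u) < r" if "n \<ge> N" for n
  proof -
    have "J (\<epsilon> n) d - d = - ((\<i> * complex_of_real (\<epsilon> n)) *\<^sub>C J (\<epsilon> n) (A \<cdot> d))"
      using J(2)[OF e(1), of n d] unfolding J_commute[OF e(1) d(1)] by (simp add: algebra_simps)
    hence "norm (J (\<epsilon> n) d - d) = \<bar>\<epsilon> n\<bar> * norm (J (\<epsilon> n) (A \<cdot> d))" by (simp add: norm_scaleC norm_mult)
    also have "\<dots> \<le> \<bar>\<epsilon> n\<bar> * norm (A \<cdot> d)" by (intro mult_left_mono J_norm e) auto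
    finally have 1: "norm (J (\<epsilon> n) d - d) < r / 3" using N[OF that] by simp
    have 2: "norm (J (\<epsilon> n) (u - d)) \<le> norm (u - d)" by (rule J_norm[OF e(1)])
    have "J (\<epsilon> n) u = J (\<epsilon> n) (u - d) + J (\<epsilon> n) d" using J_add[OF e(1), of n "u - d" d] by simp
    hence "J (\<epsilon> n) u - u = J (\<epsilon> n) (u - d) + (J (\<epsilon> n) d - d) + (d - u)" by simp
    hence "norm (J (\<epsilon> n) u - u) = norm (J (\<epsilon> n) (u - d) + (J (\<epsilon> n) d - d) + (d - u))"
      by (rule arg_cong)
    hence "norm (J (\<epsilon> n) u - u) \<le> norm (J (\<epsilon> n) (u - d)) + norm (J (\<epsilon> n) d - d) + norm (d - u)"
      using norm_triangle_ineq[of "J (\<epsilon> n) (u - d) + (J (\<epsilon> n) d - d)" "d - u"]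
        norm_triangle_ineq[of "J (\<epsilon> n) (u - d)" "J (\<epsilon> n) d - d"] by linarith
    thus ?thesis using 1 2 d(2) by (simp add: dist_norm norm_minus_commute)
  qed
  thus "\<exists>no. \<forall>n\<ge>no. norm (J (\<epsilon> n) u - u) < r" by blast
qed

text \<open>Class C1 with an explicit constant: uniform constants survive the limit of a Neumann
  series, which bare continuity of the forms would not.\<close>

definition comm_bound :: "('a \<Rightarrow> 'a) \<Rightarrow> real \<Rightarrow> bool" where
  "comm_bound S K \<longleftrightarrow> bounded_linear S \<and> (\<forall>c x. S (c *\<^sub>C x) = c *\<^sub>C S x) \<and> K \<ge> 0 \<and>
    (\<forall>u\<in>Domain A. \<forall>v\<in>Domain A. cmod (cinner (A \<cdot> u) (S v) - cinner u (S (A \<cdot> v))) \<le> K * norm u * norm v)"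

text \<open>The bounded commutator form is represented by a vector w. Then
  \<open>w + S (A \<cdot> v)\<close> acts as \<open>A \<cdot> S v\<close> against the domain, and
  \<open>A = adjoint_op A\<close> puts \<open>S v\<close> into the domain.\<close>

lemma comm_bound_Domain:
  assumes S: "comm_bound S K" and v: "v \<in> Domain A"
  shows "S v \<in> Domain A" "norm (A \<cdot> S v - S (A \<cdot> v)) \<le> K * norm v"
proof -
  have K: "K \<ge> 0" and bd: "\<And>u. u \<in> Domain A \<Longrightarrow> cmod (cinner (A \<cdot> u) (S v) - cinner u (S (A \<cdot> v))) \<le> K * norm u * norm v"
    using S v by (auto simp: comm_bound_def)
  define f where "f u = cinner (S v) (A \<cdot> u) - cinner (S (A \<cdot> v)) u" for u
  have f: "f u = cnj (cinner (A \<cdot> u) (S v) - cinner u (S (A \<cdot> v)))" for u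
    unfolding f_def by (simp add: cinner_commute[of "S v"] cinner_commute[of "S (A \<cdot> v)"])
  have "\<exists>w\<in>closure (Domain A). \<forall>x\<in>Domain A. cinner w x = f x"
  proof (rule riesz_subspace[where K = "K * norm v"])
    show "cmod (f x) \<le> K * norm v * norm x" if "x \<in> Domain A" for x
      unfolding f complex_mod_cnj using bd[OF that] by (simp add: mult_ac)
  qed (auto simp: f_def Domain_add Domain_scaleC app_add app_scaleC cinner_add_right cinner_scaleC_right algebra_simps)
  then obtain w where w: "\<And>x. x \<in> Domain A \<Longrightarrow> cinner w x = f x" by blast
  have m: "(S v, w + S (A \<cdot> v)) \<in> A"
    by (rule memI) (simp add: cinner_add_left w f_def)
  show "S v \<in> Domain A" using m by auto
  have "norm w \<le> K * norm v"
  proof (rule norm_le_of_cinner[OF dense])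
    show "cmod (cinner u w) \<le> K * norm v * norm u" if "u \<in> Domain A" for u
      using bd[OF that] w[OF that] unfolding f cinner_commute[of u w] by (simp add: mult_ac)
  qed (use K in simp)
  thus "norm (A \<cdot> S v - S (A \<cdot> v)) \<le> K * norm v" by (simp add: appI[OF m])
qed

end

section \<open>Commutators\<close>

lemma linear_app_diff: "bounded_linear S \<Longrightarrow> S (x - y) = S x - S y"
  by (rule linear_diff[OF bounded_linear.linear])

lemma linear_app_add: "bounded_linear S \<Longrightarrow> S (x + y) = S x + S y"
  by (rule linear_add[OF bounded_linear.linear])

context selfadjoint_op
begin

text \<open>Continuity at the origin bounds the form by 1 on a small ball; homogeneity in both
  arguments extends this to a global bound.\<close>

lemma bounded_class_C1_comm_bound:
  assumes C1: "bounded_class_C1 A S" and S: "bounded_linear S" "\<And>c x. S (c *\<^sub>C x) = c *\<^sub>C S x"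
  shows "\<exists>K. comm_bound S K"
proof -
  define F where "F = (\<lambda>(u, v). cinner (A \<cdot> u) (S v) - cinner u (S (A \<cdot> v)))"
  have F0: "F (0, 0) = 0" using appI[OF zero_mem] by (simp add: F_def)
  have Fscale: "F (complex_of_real s *\<^sub>C u, complex_of_real t *\<^sub>C v) = complex_of_real (s * t) * F (u, v)"
    if "u \<in> Domain A" "v \<in> Domain A" for s t u v
    using that by (simp add: F_def app_scaleC S(2) cinner_scaleC_left cinner_scaleC_right algebra_simps)
  have "continuous_on (Domain A \<times> Domain A) F" using C1 by (simp add: bounded_class_C1_def F_def)
  hence "\<exists>d>0. \<forall>p\<in>Domain A \<times> Domain A. dist p (0, 0) < d \<longrightarrow> dist (F p) (F (0, 0)) < 1"
    by (auto simp: continuous_on_iff)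
  then obtain d where d: "d > 0" "\<And>u v. u \<in> Domain A \<Longrightarrow> v \<in> Domain A \<Longrightarrow> dist (u, v) (0, 0) < d \<Longrightarrow> cmod (F (u, v)) < 1"
    unfolding F0 by (auto simp: dist_norm)
  \<comment> \<open>Both vectors are scaled to norm \<open>d / 3\<close>, so that the pair has norm
    at most \<open>2 * d / 3 < d\<close>; undoing the two scalings gives
    \<open>9 / d\<^sup>2\<close>.\<close>
  define K where "K = 9 / d\<^sup>2"
  have bd: "cmod (F (u, v)) \<le> K * norm u * norm v" if uv: "u \<in> Domain A" "v \<in> Domain A" for u v
  proof (cases "u = 0 \<or> v = 0")
    case True
    have "S 0 = 0" using S(2)[of 0 0] by simp
    hence "F (u, v) = 0" using True appI[OF zero_mem] by (auto simp: F_def)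
    thus ?thesis using True by auto
  next
    case False
    define s t where "s = d / (3 * norm u)" and "t = d / (3 * norm v)"
    have st: "s > 0" "t > 0" using False d(1) by (auto simp: s_def t_def)
    have n: "norm (complex_of_real s *\<^sub>C u) = d / 3" "norm (complex_of_real t *\<^sub>C v) = d / 3"
    proof -
      have "norm (complex_of_real s *\<^sub>C u) = s * norm u" "norm (complex_of_real t *\<^sub>C v) = t * norm v"
        using st by (simp_all add: norm_scaleC)
      thus "norm (complex_of_real s *\<^sub>C u) = d / 3" "norm (complex_of_real t *\<^sub>C v) = d / 3"
        using False by (simp_all add: s_def t_def)
    qed
    have "dist (complex_of_real s *\<^sub>C u, complex_of_real t *\<^sub>C v) (0, 0) \<le> d / 3 + d / 3"
      unfolding dist_norm using norm_Pair_le[of "complex_of_real s *\<^sub>C u" "complex_of_real t *\<^sub>C v"] n by simp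
    hence "cmod (F (complex_of_real s *\<^sub>C u, complex_of_real t *\<^sub>C v)) < 1"
      using d(1) by (intro d(2) Domain_scaleC uv) auto
    hence "s * t * cmod (F (u, v)) < 1" unfolding Fscale[OF uv] using st by (simp add: norm_mult)
    moreover have "s * t = 1 / (K * norm u * norm v)" using False d(1) by (simp add: s_def t_def K_def power2_eq_square)
    moreover have "K * norm u * norm v > 0" using False d(1) by (simp add: K_def)
    ultimately show ?thesis by (simp add: field_simps)
  qed
  have "K \<ge> 0" by (simp add: K_def)
  thus ?thesis using bd S unfolding comm_bound_def F_def by auto
qed

text \<open>Expand the commutator as \<open>[A, R] + c [A, R] S + c R [A, S]\<close>. With
  \<open>cmod c * M \<le> 1 / 2\<close> the three terms are bounded by K, K and 2K, so the constant
  4K reproduces itself; likewise 2M for the norms.\<close>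

lemma comm_bound_iterate:
  assumes R: "comm_bound R K" and S: "comm_bound S (4 * K)"
    and M: "\<And>x. norm (R x) \<le> M * norm x" "M \<ge> 0" and SM: "\<And>x. norm (S x) \<le> 2 * M * norm x"
    and c: "cmod c * M \<le> 1 / 2"
  shows "comm_bound (\<lambda>x. R x + c *\<^sub>C R (S x)) (4 * K)"
    and "norm (R x + c *\<^sub>C R (S x)) \<le> 2 * M * norm x"
proof -
  have K: "K \<ge> 0" and Rl: "bounded_linear R" "\<And>c x. R (c *\<^sub>C x) = c *\<^sub>C R x"
    and Sl: "bounded_linear S" "\<And>c x. S (c *\<^sub>C x) = c *\<^sub>C S x"
    and Rb: "\<And>u v. u \<in> Domain A \<Longrightarrow> v \<in> Domain A \<Longrightarrow> cmod (cinner (A \<cdot> u) (R v) - cinner u (R (A \<cdot> v))) \<le> K * norm u * norm v"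
    using R S by (auto simp: comm_bound_def)
  have bl: "bounded_linear (\<lambda>x. R x + c *\<^sub>C R (S x))"
    by (intro bounded_linear_add Rl bounded_linear_compose[OF bounded_linear_scaleC] bounded_linear_compose[OF Rl(1)] Sl)
  have "cmod (cinner (A \<cdot> u) (R v + c *\<^sub>C R (S v)) - cinner u (R (A \<cdot> v) + c *\<^sub>C R (S (A \<cdot> v)))) \<le> 4 * K * norm u * norm v"
    if u: "u \<in> Domain A" and v: "v \<in> Domain A" for u v
  proof -
    note Sv = comm_bound_Domain[OF S v]
    have "cinner (A \<cdot> u) (R v + c *\<^sub>C R (S v)) - cinner u (R (A \<cdot> v) + c *\<^sub>C R (S (A \<cdot> v)))
      = (cinner (A \<cdot> u) (R v) - cinner u (R (A \<cdot> v)))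
       + c * (cinner (A \<cdot> u) (R (S v)) - cinner u (R (A \<cdot> S v))) + c * cinner u (R (A \<cdot> S v - S (A \<cdot> v)))"
      by (simp add: cinner_add_right cinner_scaleC_right linear_app_diff[OF Rl(1)] cinner_diff_right algebra_simps)
    also have "cmod \<dots> \<le> cmod (cinner (A \<cdot> u) (R v) - cinner u (R (A \<cdot> v)))
       + cmod (c * (cinner (A \<cdot> u) (R (S v)) - cinner u (R (A \<cdot> S v)))) + cmod (c * cinner u (R (A \<cdot> S v - S (A \<cdot> v))))"
      by (intro order_trans[OF norm_triangle_ineq] add_mono order_refl norm_triangle_ineq)
    also have "\<dots> \<le> K * norm u * norm v + K * norm u * norm v + 2 * K * norm u * norm v"
    proof (intro add_mono Rb u v)
      have "cmod (c * (cinner (A \<cdot> u) (R (S v)) - cinner u (R (A \<cdot> S v)))) \<le> cmod c * (K * norm u * norm (S v))"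
        unfolding norm_mult by (intro mult_left_mono Rb u Sv) simp
      also have "\<dots> \<le> cmod c * (K * norm u * (2 * M * norm v))"
        using K SM[of v] by (intro mult_left_mono mult_nonneg_nonneg) auto
      also have "\<dots> = 2 * (cmod c * M) * (K * norm u * norm v)" by (simp add: mult_ac)
      also have "\<dots> \<le> 2 * (1 / 2) * (K * norm u * norm v)"
        using K by (intro mult_right_mono mult_left_mono c mult_nonneg_nonneg) auto
      finally show "cmod (c * (cinner (A \<cdot> u) (R (S v)) - cinner u (R (A \<cdot> S v)))) \<le> K * norm u * norm v" by simp
      have "cmod (c * cinner u (R (A \<cdot> S v - S (A \<cdot> v)))) \<le> cmod c * (norm u * norm (R (A \<cdot> S v - S (A \<cdot> v))))"
        unfolding norm_mult by (intro mult_left_mono cinner_norm) simp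
      also have "\<dots> \<le> cmod c * (norm u * (M * (4 * K * norm v)))"
        using Sv(2) M(2) by (intro mult_left_mono order_trans[OF M(1)]) auto
      also have "\<dots> = 4 * (cmod c * M) * (K * norm u * norm v)" by (simp add: mult_ac)
      also have "\<dots> \<le> 4 * (1 / 2) * (K * norm u * norm v)"
        using K by (intro mult_right_mono mult_left_mono c mult_nonneg_nonneg) auto
      finally show "cmod (c * cinner u (R (A \<cdot> S v - S (A \<cdot> v)))) \<le> 2 * K * norm u * norm v" by simp
    qed
    also have "\<dots> = 4 * K * norm u * norm v" by (simp add: algebra_simps)
    finally show ?thesis .
  qed
  thus "comm_bound (\<lambda>x. R x + c *\<^sub>C R (S x)) (4 * K)"
    using K bl unfolding comm_bound_def
    by (auto simp: Rl(2) Sl(2) scaleC_add_right scaleC_scaleC mult.commute)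
  have "norm (R x + c *\<^sub>C R (S x)) \<le> norm (R x) + norm (c *\<^sub>C R (S x))" by (rule norm_triangle_ineq)
  also have "\<dots> \<le> M * norm x + cmod c * (M * (2 * M * norm x))"
    unfolding norm_scaleC
    by (intro add_mono M mult_left_mono order_trans[OF M(1)] SM) auto
  also have "cmod c * (M * (2 * M * norm x)) = 2 * (cmod c * M) * (M * norm x)" by (simp add: mult_ac)
  also have "M * norm x + \<dots> \<le> M * norm x + 2 * (1 / 2) * (M * norm x)"
    using M(2) by (intro add_left_mono mult_right_mono mult_left_mono c) auto
  finally show "norm (R x + c *\<^sub>C R (S x)) \<le> 2 * M * norm x" by simp
qed

text \<open>The Neumann series of a nearby resolvent \<open>R' = R + c R R'\<close> has uniformly bounded
  commutators.\<close>

lemma comm_bound_perturb: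
  assumes R: "comm_bound R K" and M: "\<And>x. norm (R x) \<le> M * norm x" "M \<ge> 0"
    and c: "cmod c * M \<le> 1 / 2"
    and R': "bounded_linear R'" "\<And>c x. R' (c *\<^sub>C x) = c *\<^sub>C R' x" "\<And>x. R' x = R x + c *\<^sub>C R (R' x)"
  shows "comm_bound R' (4 * K)"
proof -
  have K: "K \<ge> 0" and Rl: "bounded_linear R" using R by (auto simp: comm_bound_def)
  \<comment> \<open>Partial sums of the series, started at 0. The distance to \<open>R'\<close>
    shrinks by the factor \<open>cmod c * M \<le> 1 / 2\<close> in each step.\<close>
  define S where "S n = ((\<lambda>T x. R x + c *\<^sub>C R (T x)) ^^ n) (\<lambda>x. 0)" for n :: nat
  have S0: "S 0 = (\<lambda>x. 0)" and SSuc: "S (Suc n) = (\<lambda>x. R x + c *\<^sub>C R (S n x))" for n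
    by (simp_all add: S_def)
  have Sb: "comm_bound (S n) (4 * K) \<and> (\<forall>x. norm (S n x) \<le> 2 * M * norm x)" for n
  proof (induction n)
    case 0
    show ?case using K M(2) by (auto simp: S0 comm_bound_def)
  next
    case (Suc n)
    thus ?case unfolding SSuc using comm_bound_iterate[OF R _ M _ c, of "S n"] by blast
  qed
  have diff: "norm (R' x - S n x) \<le> (1 / 2) ^ n * norm (R' x)" for n x
  proof (induction n)
    case (Suc n)
    have "R' x - S (Suc n) x = c *\<^sub>C R (R' x - S n x)"
      by (subst R'(3)) (simp add: SSuc linear_app_diff[OF Rl] scaleC_diff_right)
    hence "norm (R' x - S (Suc n) x) = cmod c * norm (R (R' x - S n x))" by (simp add: norm_scaleC)
    also have "\<dots> \<le> cmod c * (M * norm (R' x - S n x))" by (intro mult_left_mono M) simp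
    also have "\<dots> = (cmod c * M) * norm (R' x - S n x)" by simp
    also have "\<dots> \<le> (1 / 2) * ((1 / 2) ^ n * norm (R' x))" by (intro mult_mono c Suc.IH) auto
    finally show ?case by simp
  qed (simp add: S0)
  have lim: "(\<lambda>n. S n x) \<longlonglongrightarrow> R' x" for x
  proof -
    have "(\<lambda>n. R' x - S n x) \<longlonglongrightarrow> 0"
    proof (rule Lim_null_comparison)
      show "\<forall>\<^sub>F n in sequentially. norm (R' x - S n x) \<le> (1 / 2) ^ n * norm (R' x)" by (simp add: diff)
      show "(\<lambda>n. (1 / 2) ^ n * norm (R' x)) \<longlonglongrightarrow> 0"
        by (intro tendsto_mult_left_zero LIMSEQ_realpow_zero) auto
    qed
    from tendsto_diff[OF tendsto_const[of "R' x"] this] show ?thesis by simp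
  qed
  have "cmod (cinner (A \<cdot> u) (R' v) - cinner u (R' (A \<cdot> v))) \<le> 4 * K * norm u * norm v"
    if "u \<in> Domain A" "v \<in> Domain A" for u v
  proof (rule LIMSEQ_le_const2)
    show "(\<lambda>n. cmod (cinner (A \<cdot> u) (S n v) - cinner u (S n (A \<cdot> v)))) \<longlonglongrightarrow>
        cmod (cinner (A \<cdot> u) (R' v) - cinner u (R' (A \<cdot> v)))"
      by (intro tendsto_norm tendsto_diff tendsto_cinner tendsto_const lim)
    show "\<exists>N. \<forall>n\<ge>N. cmod (cinner (A \<cdot> u) (S n v) - cinner u (S n (A \<cdot> v))) \<le> 4 * K * norm u * norm v"
      using Sb that unfolding comm_bound_def by blast
  qed
  thus ?thesis using K R' unfolding comm_bound_def by simp
qed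

end

section \<open>Resolvents of H in the functional calculus\<close>

locale commutator_setting = selfadjoint_op A + pvm E
  for A :: "'a::complex_hilbert operator" and E :: "real set \<Rightarrow> 'a \<Rightarrow> 'a" +
  fixes H :: "'a operator"
  assumes H_eq: "H = integral_pvm E complex_of_real" and H_sa: "selfadjoint H"
begin

sublocale H: selfadjoint_op H by standard (rule H_sa)

lemma resolvent_mem:
  assumes "z \<in> resolvent_set H"
  shows "resolvent H z v \<in> Domain H" "H \<cdot> resolvent H z v = v + z *\<^sub>C resolvent H z v"
    "u \<in> Domain H \<Longrightarrow> resolvent H z (H \<cdot> u - z *\<^sub>C u) = u"
proof -
  have bij: "bij_betw (\<lambda>u. H \<cdot> u - z *\<^sub>C u) (Domain H) UNIV" using assms by (simp add: resolvent_set_def)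
  show "resolvent H z v \<in> Domain H"
    unfolding resolvent_def using bij by (intro inv_into_into) (simp add: bij_betw_def)
  have "H \<cdot> resolvent H z v - z *\<^sub>C resolvent H z v = v"
    unfolding resolvent_def using bij
    by (intro f_inv_into_f[where f = "\<lambda>u. H \<cdot> u - z *\<^sub>C u"]) (simp add: bij_betw_def)
  thus "H \<cdot> resolvent H z v = v + z *\<^sub>C resolvent H z v" by (simp add: algebra_simps)
  show "u \<in> Domain H \<Longrightarrow> resolvent H z (H \<cdot> u - z *\<^sub>C u) = u"
    unfolding resolvent_def using bij
    by (intro inv_into_f_f[where f = "\<lambda>u. H \<cdot> u - z *\<^sub>C u"]) (simp_all add: bij_betw_def)
qed

lemma resolvent_scaleC:
  assumes "z \<in> resolvent_set H"
  shows "resolvent H z (c *\<^sub>C v) = c *\<^sub>C resolvent H z v"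
proof -
  note r = resolvent_mem[OF assms]
  have "resolvent H z (H \<cdot> (c *\<^sub>C resolvent H z v) - z *\<^sub>C (c *\<^sub>C resolvent H z v)) = c *\<^sub>C resolvent H z v"
    by (intro r(3) H.Domain_scaleC r(1))
  moreover have "H \<cdot> (c *\<^sub>C resolvent H z v) - z *\<^sub>C (c *\<^sub>C resolvent H z v) = c *\<^sub>C v"
    unfolding H.app_scaleC[OF r(1)] r(2) by (simp add: scaleC_add_right scaleC_scaleC mult.commute)
  ultimately show ?thesis by simp
qed

lemma Phi_res_mem:
  assumes "Im z \<noteq> 0"
  shows "Phi (res z) v \<in> Domain H" "H \<cdot> Phi (res z) v = v + z *\<^sub>C Phi (res z) v"
    "u \<in> Domain H \<Longrightarrow> Phi (res z) (H \<cdot> u - z *\<^sub>C u) = u"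
proof -
  have m: "(Phi (res z) v, v + z *\<^sub>C Phi (res z) v) \<in> H" using res_mem[OF assms] by (simp add: H_eq)
  show "Phi (res z) v \<in> Domain H" using m by auto
  show "H \<cdot> Phi (res z) v = v + z *\<^sub>C Phi (res z) v" by (rule H.appI[OF m])
  show "Phi (res z) (H \<cdot> u - z *\<^sub>C u) = u" if "u \<in> Domain H"
    using H.app_mem[OF that] by (intro res_inverse[OF assms]) (simp add: H_eq)
qed

text \<open>The point supplied by \<open>class_C1\<close> may be real, whereas the Cayley transform
  requires a nonreal one; a small vertical shift keeps the commutator bounded.\<close>

lemma class_C1_nonreal:
  assumes "class_C1 A H"
  shows "\<exists>z K. Im z \<noteq> 0 \<and> comm_bound (Phi (res z)) K"
proof -
  obtain z where z: "z \<in> resolvent_set H" "bounded_class_C1 A (resolvent H z)"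
    using assms by (auto simp: class_C1_def)
  define R where "R = resolvent H z"
  have Rbl: "bounded_linear R" using z(1) by (simp add: resolvent_set_def R_def)
  obtain K where K: "comm_bound R K"
    using bounded_class_C1_comm_bound[OF z(2)] Rbl resolvent_scaleC[OF z(1)] unfolding R_def by blast
  obtain M where M: "\<And>x. norm (R x) \<le> M * norm x" "M \<ge> 0"
    using bounded_linear.nonneg_bounded[OF Rbl] unfolding mult.commute[of "norm _"] by blast
  \<comment> \<open>Zero if z is nonreal already; the perturbation then merely identifies
    \<open>resolvent H z\<close> with \<open>Phi (res z)\<close>. Otherwise small enough for the
    Neumann series, that is \<open>\<delta> * M \<le> 1 / 2\<close>.\<close>
  define \<delta> where "\<delta> = (if Im z \<noteq> 0 then 0 else 1 / (2 * (M + 1)))"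
  have \<delta>: "\<delta> \<ge> 0" "\<delta> * M \<le> 1 / 2" using M(2) by (auto simp: \<delta>_def field_simps)
  define z' where "z' = z + \<i> * complex_of_real \<delta>"
  have z': "Im z' \<noteq> 0" using M(2) by (simp add: z'_def \<delta>_def)
  note r = bounded_borel_res[OF z']
  have "comm_bound (Phi (res z')) (4 * K)"
  proof (rule comm_bound_perturb[OF K M])
    show "cmod (\<i> * complex_of_real \<delta>) * M \<le> 1 / 2" using \<delta> by (simp add: norm_mult)
    show "bounded_linear (Phi (res z'))" by (rule Phi_bounded_linear[OF r])
    show "Phi (res z') (c *\<^sub>C x) = c *\<^sub>C Phi (res z') x" for c x by (rule Phi_linear[OF r])
    show "Phi (res z') x = R x + (\<i> * complex_of_real \<delta>) *\<^sub>C R (Phi (res z') x)" for x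
    proof -
      define y where "y = Phi (res z') x"
      have y: "y \<in> Domain H" "H \<cdot> y = x + z' *\<^sub>C y" unfolding y_def by (rule Phi_res_mem[OF z'])+
      have "y = R (H \<cdot> y - z *\<^sub>C y)" unfolding R_def using resolvent_mem(3)[OF z(1) y(1)] by simp
      also have "H \<cdot> y - z *\<^sub>C y = x + (\<i> * complex_of_real \<delta>) *\<^sub>C y"
        unfolding y(2) z'_def by (simp add: scaleC_add_left)
      also have "R \<dots> = R x + (\<i> * complex_of_real \<delta>) *\<^sub>C R y"
        unfolding R_def using resolvent_scaleC[OF z(1)] linear_app_add[OF Rbl[unfolded R_def]] by simp
      finally show ?thesis unfolding y_def .
    qed
  qed
  thus ?thesis using z' by blast
qed

text \<open>The commutator form of the adjoint at (u, v) is minus the conjugate of the original form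
  at (v, u).\<close>

lemma comm_bound_adj:
  assumes f: "bounded_borel f" and K: "comm_bound (Phi f) K"
  shows "comm_bound (Phi (\<lambda>x. cnj (f x))) K"
proof -
  note f' = bounded_borel_cnj[OF f]
  have "cmod (cinner (A \<cdot> u) (Phi (\<lambda>x. cnj (f x)) v) - cinner u (Phi (\<lambda>x. cnj (f x)) (A \<cdot> v))) \<le> K * norm u * norm v"
    if "u \<in> Domain A" "v \<in> Domain A" for u v
  proof -
    have "cinner (A \<cdot> u) (Phi (\<lambda>x. cnj (f x)) v) - cinner u (Phi (\<lambda>x. cnj (f x)) (A \<cdot> v))
      = - cnj (cinner (A \<cdot> v) (Phi f u) - cinner v (Phi f (A \<cdot> u)))"
      unfolding Phi_adj[OF f'] complex_cnj_cnj complex_cnj_diff cinner_commute[symmetric] by simp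
    hence "cmod (cinner (A \<cdot> u) (Phi (\<lambda>x. cnj (f x)) v) - cinner u (Phi (\<lambda>x. cnj (f x)) (A \<cdot> v)))
      = cmod (cinner (A \<cdot> v) (Phi f u) - cinner v (Phi f (A \<cdot> u)))"
      by (simp only: norm_minus_cancel complex_mod_cnj)
    also have "\<dots> \<le> K * norm v * norm u" using K that unfolding comm_bound_def by blast
    finally show ?thesis by (simp only: mult_ac)
  qed
  thus ?thesis using K Phi_bounded_linear[OF f'] Phi_linear(2)[OF f'] unfolding comm_bound_def by blast
qed

end

lemma cnj_res: "cnj (res z x) = res (cnj z) x" by simp

section \<open>The bounded commutator \<open>[A, R]\<close> and the form
  \<open>[A, H]\<close>\<close>

locale commutator_bounded = commutator_setting A E H
  for A :: "'a::complex_hilbert operator" and E and H +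
  fixes z :: complex and K :: real
  assumes z: "Im z \<noteq> 0" and K: "comm_bound (Phi (res z)) K"
begin

abbreviation R where "R \<equiv> Phi (res z)"
abbreviation R' where "R' \<equiv> Phi (res (cnj z))"

lemma z': "Im (cnj z) \<noteq> 0" using z by simp

lemma K': "comm_bound R' K"
  using comm_bound_adj[OF bounded_borel_res[OF z] K] unfolding cnj_res .

lemma K_nonneg: "K \<ge> 0" using K by (simp add: comm_bound_def)

lemma R_adj: "cinner u (R v) = cinner (R' u) v"
  using Phi_adj[OF bounded_borel_res[OF z], of u v] unfolding cnj_res .

lemma R_bounded_linear: "bounded_linear R" "bounded_linear R'"
  by (intro Phi_bounded_linear bounded_borel_res z z')+

lemma R_Domain: "v \<in> Domain A \<Longrightarrow> R v \<in> Domain A" "v \<in> Domain A \<Longrightarrow> R' v \<in> Domain A"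
  using comm_bound_Domain(1) K K' by auto

text \<open>With A moved from v to \<open>R' u\<close> the form makes sense for every v, so the
  bound extends from the domain by density.\<close>

lemma form_bound:
  assumes u: "u \<in> Domain A"
  shows "cmod (cinner (A \<cdot> u) (R v) - cinner (A \<cdot> R' u) v) \<le> K * norm u * norm v"
proof -
  have bd: "cmod (cinner (A \<cdot> u) (R w) - cinner (A \<cdot> R' u) w) \<le> K * norm u * norm w"
    if w: "w \<in> Domain A" for w
  proof -
    have "cinner (A \<cdot> R' u) w = cinner u (R (A \<cdot> w))"
      using symm[OF R_Domain(2)[OF u] w] by (simp add: R_adj)
    thus ?thesis using K u w by (simp add: comm_bound_def)
  qed
  have "v \<in> closure (Domain A)" using dense by simp
  then obtain f where f: "\<And>n. f n \<in> Domain A" "f \<longlonglongrightarrow> v" unfolding closure_sequential by auto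
  show ?thesis
  proof (rule LIMSEQ_le)
    show "(\<lambda>n. cmod (cinner (A \<cdot> u) (R (f n)) - cinner (A \<cdot> R' u) (f n))) \<longlonglongrightarrow>
        cmod (cinner (A \<cdot> u) (R v) - cinner (A \<cdot> R' u) v)"
      by (intro tendsto_norm tendsto_diff tendsto_cinner tendsto_const f bounded_linear.tendsto[OF R_bounded_linear(1)])
    show "(\<lambda>n. K * norm u * norm (f n)) \<longlonglongrightarrow> K * norm u * norm v" by (intro tendsto_intros f)
  qed (use bd f in blast)
qed

text \<open>The bounded operator \<open>[A, R]\<close>, in weak form.\<close>

definition C :: "'a \<Rightarrow> 'a" where
  "C v = (SOME w. \<forall>u\<in>Domain A. cinner u w = cinner (A \<cdot> u) (R v) - cinner (A \<cdot> R' u) v)"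

text \<open>The form is antilinear and bounded in u, so Riesz representation on the dense domain of
  A supplies the vector chosen in the definition.\<close>

lemma C:
  assumes "u \<in> Domain A"
  shows "cinner u (C v) = cinner (A \<cdot> u) (R v) - cinner (A \<cdot> R' u) v"
proof -
  define f where "f u = cinner (R v) (A \<cdot> u) - cinner v (A \<cdot> R' u)" for u
  have f: "f u = cnj (cinner (A \<cdot> u) (R v) - cinner (A \<cdot> R' u) v)" for u
    unfolding f_def complex_cnj_diff cinner_commute[symmetric] ..
  have "\<exists>w\<in>closure (Domain A). \<forall>x\<in>Domain A. cinner w x = f x"
  proof (rule riesz_subspace[where K = "K * norm v"])
    show "cmod (f x) \<le> K * norm v * norm x" if "x \<in> Domain A" for x
      unfolding f complex_mod_cnj using form_bound[OF that, of v] by (simp only: mult_ac)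
    show "f (x + y) = f x + f y" if "x \<in> Domain A" "y \<in> Domain A" for x y
      unfolding f_def using that
      by (simp add: app_add R_Domain cinner_add_right linear_app_add[OF R_bounded_linear(2)])
    show "f (c *\<^sub>C x) = c * f x" if "x \<in> Domain A" for c x
      unfolding f_def Phi_linear(2)[OF bounded_borel_res[OF z']] using that
      by (simp add: app_scaleC R_Domain cinner_scaleC_right right_diff_distrib)
  qed (auto intro: Domain_add Domain_scaleC)
  then obtain w where w: "\<And>x. x \<in> Domain A \<Longrightarrow> cinner w x = f x" by blast
  have "cinner x w = cinner (A \<cdot> x) (R v) - cinner (A \<cdot> R' x) v" if "x \<in> Domain A" for x
    using w[OF that] unfolding f by (metis cinner_commute complex_cnj_cnj)
  hence "\<exists>w. \<forall>u\<in>Domain A. cinner u w = cinner (A \<cdot> u) (R v) - cinner (A \<cdot> R' u) v" by blast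
  from someI_ex[OF this] assms show ?thesis unfolding C_def by blast
qed

lemma C_linear: "C (x + y) = C x + C y" "C (c *\<^sub>C x) = c *\<^sub>C C x"
proof -
  note r = bounded_borel_res[OF z]
  show "C (x + y) = C x + C y"
    by (rule cinner_eqI[OF dense])
      (simp add: C cinner_add_right Phi_linear(1)[OF r])
  show "C (c *\<^sub>C x) = c *\<^sub>C C x"
    by (rule cinner_eqI[OF dense])
      (simp add: C cinner_scaleC_right Phi_linear(2)[OF r] right_diff_distrib)
qed

lemma C_bounded_linear: "bounded_linear C"
proof (rule bounded_linear_intro[where K = K])
  show "norm (C x) \<le> norm x * K" for x
    by (rule norm_le_of_cinner[OF dense])
      (use form_bound[of _ x] K_nonneg in \<open>auto simp: C mult_ac\<close>)
qed (simp_all add: C_linear scaleR_scaleC)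

text \<open>Regularize \<open>u\<close> and \<open>v\<close> by \<open>(1 \<mp> i \<epsilon> A)\<^sup>-\<^sup>1\<close> and let \<open>\<epsilon>\<close> tend to \<open>0\<close>.\<close>

lemma C_eq:
  assumes u: "R' u \<in> Domain A" and v: "R v \<in> Domain A"
  shows "cinner u (C v) = cinner u (A \<cdot> R v) - cinner (A \<cdot> R' u) v"
proof -
  have reg: "cinner (J (-\<epsilon>) u) (C (J \<epsilon> v)) = cinner u (J \<epsilon> (A \<cdot> R v)) - cinner (J (-\<epsilon>) (A \<cdot> R' u)) v"
    if e: "\<epsilon> \<noteq> 0" for \<epsilon>
  proof -
    have e': "- \<epsilon> \<noteq> 0" using e by simp
    define c where "c = \<i> * complex_of_real \<epsilon>"
    have c0: "c \<noteq> 0" using e by (simp add: c_def)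
    have cc: "cnj c = - c" by (simp add: c_def)
    have cm: "\<i> * complex_of_real (- \<epsilon>) = - c" by (simp add: c_def)
    have Jv: "J \<epsilon> w + c *\<^sub>C (A \<cdot> J \<epsilon> w) = w" for w using J(2)[OF e, of w] by (simp add: c_def)
    have Ju: "J (-\<epsilon>) w + (- c) *\<^sub>C (A \<cdot> J (-\<epsilon>) w) = w" for w using J(2)[OF e', of w] unfolding cm .
    define ue ve where "ue = J (-\<epsilon>) u" and "ve = J \<epsilon> v"
    have D: "ue \<in> Domain A" "ve \<in> Domain A" unfolding ue_def ve_def by (intro J e e')+
    \<comment> \<open>After multiplication by c the images \<open>c A ue\<close> and
      \<open>c A ve\<close> are differences of u, ue and of v, ve. The unbounded A is thereby
      eliminated, and it returns only on \<open>R' u\<close> and \<open>R v\<close>, which lie in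
      its domain.\<close>
    have "c * cinner (A \<cdot> ue) (R ve) = cinner ((- c) *\<^sub>C (A \<cdot> ue)) (R ve)"
      by (simp add: cinner_scaleC_left cc)
    also have "(- c) *\<^sub>C (A \<cdot> ue) = u - ue" using Ju[of u] by (simp add: ue_def algebra_simps)
    finally have 1: "c * cinner (A \<cdot> ue) (R ve) = cinner u (R ve) - cinner ue (R ve)"
      by (simp add: cinner_diff_left)
    have "c * cinner (A \<cdot> R' ue) ve = c * cinner ue (R (A \<cdot> ve))"
      using symm[OF R_Domain(2)[OF D(1)] D(2)] by (simp add: R_adj)
    also have "\<dots> = cinner ue (R (c *\<^sub>C (A \<cdot> ve)))"
      unfolding Phi_linear(2)[OF bounded_borel_res[OF z]] by (simp add: cinner_scaleC_right)
    also have "c *\<^sub>C (A \<cdot> ve) = v - ve" using Jv[of v] by (simp add: ve_def algebra_simps)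
    finally have 2: "c * cinner (A \<cdot> R' ue) ve = cinner ue (R v) - cinner ue (R ve)"
      by (simp add: linear_app_diff[OF R_bounded_linear(1)] cinner_diff_right)
    have "c * cinner ue (C ve) = cinner u (R ve) - cinner ue (R v)"
      unfolding C[OF D(1)] right_diff_distrib 1 2 by simp
    also have "cinner u (R ve) = cinner (J (-\<epsilon>) (R' u)) v" unfolding R_adj ve_def J_adj[OF e] ..
    also have "cinner ue (R v) = cinner u (J \<epsilon> (R v))" unfolding ue_def J_adj[OF e] ..
    also have "J (-\<epsilon>) (R' u) = R' u + c *\<^sub>C J (-\<epsilon>) (A \<cdot> R' u)"
      using Ju[of "R' u"] unfolding J_commute[OF e' u] by (simp add: scaleC_minus_left algebra_simps)
    also have "J \<epsilon> (R v) = R v - c *\<^sub>C J \<epsilon> (A \<cdot> R v)"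
      using Jv[of "R v"] unfolding J_commute[OF e v] by (simp add: algebra_simps)
    finally have "c * cinner ue (C ve) = c * (cinner u (J \<epsilon> (A \<cdot> R v)) - cinner (J (-\<epsilon>) (A \<cdot> R' u)) v)"
      by (simp add: cinner_add_left cinner_diff_right cinner_scaleC_left cinner_scaleC_right cc R_adj
          right_diff_distrib)
    thus ?thesis using c0 by (simp add: ue_def ve_def)
  qed
  define \<epsilon> where "\<epsilon> n = 1 / real (Suc n)" for n
  have e: "\<epsilon> n \<noteq> 0" "- \<epsilon> n \<noteq> 0" for n by (simp_all add: \<epsilon>_def)
  have l: "\<epsilon> \<longlonglongrightarrow> 0" unfolding \<epsilon>_def by (intro LIMSEQ_Suc lim_1_over_n)
  have l': "(\<lambda>n. - \<epsilon> n) \<longlonglongrightarrow> 0" using tendsto_minus[OF l] by simp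
  have "(\<lambda>n. cinner (J (- \<epsilon> n) u) (C (J (\<epsilon> n) v))) \<longlonglongrightarrow> cinner u (C v)"
    by (intro tendsto_cinner bounded_linear.tendsto[OF C_bounded_linear] J_tendsto e l l')
  moreover have "(\<lambda>n. cinner u (J (\<epsilon> n) (A \<cdot> R v)) - cinner (J (- \<epsilon> n) (A \<cdot> R' u)) v) \<longlonglongrightarrow>
      cinner u (A \<cdot> R v) - cinner (A \<cdot> R' u) v"
    by (intro tendsto_diff tendsto_cinner tendsto_const J_tendsto e l l')
  ultimately show ?thesis unfolding reg[OF e(1)] by (rule LIMSEQ_unique)
qed

text \<open>The choice in \<open>commutator_form\<close> needs a witness. It is
  \<open>[A, R] = - R [A, H] R\<close> solved for \<open>[A, H]\<close>: continuous in the graph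
  topology because C is bounded. That it extends the original form is \<open>C_eq\<close>, stated
  for vectors outside the domain of A because \<open>H \<cdot> v - z *\<^sub>C v\<close> may lie
  outside it.\<close>

lemma commutator_form_eq:
  assumes u: "u \<in> Domain A \<inter> Domain H" and v: "v \<in> Domain A \<inter> Domain H"
  shows "commutator_form A H u v = cinner (A \<cdot> u) (H \<cdot> v) - cinner (H \<cdot> u) (A \<cdot> v)"
proof -
  define B where "B u v = - cinner (H \<cdot> u - cnj z *\<^sub>C u) (C (H \<cdot> v - z *\<^sub>C v))" for u v
  have "sesquilinear_on (Domain H) B"
    unfolding sesquilinear_on_def B_def
    by (simp add: H.app_add H.app_scaleC cinner_add_left cinner_add_right scaleC_add_right
        linear_app_add[OF C_bounded_linear] linear_app_diff[OF C_bounded_linear] C_linear(2)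
        cinner_diff_left cinner_diff_right cinner_scaleC_left cinner_scaleC_right algebra_simps)
  moreover have "continuous_on (H \<times> H) (\<lambda>(p, q). B (fst p) (fst q))"
  proof -
    have "continuous_on (H \<times> H) (\<lambda>x. - cinner (snd (fst x) - cnj z *\<^sub>C fst (fst x)) (C (snd (snd x) - z *\<^sub>C fst (snd x))))"
      by (intro continuous_on_minus continuous_on_cinner bounded_linear.continuous_on[OF C_bounded_linear]
          continuous_on_diff bounded_linear.continuous_on[OF bounded_linear_scaleC] continuous_intros)
    thus ?thesis
      by (rule continuous_on_eq) (auto simp: B_def H.appI)
  qed
  moreover have "B u v = cinner (A \<cdot> u) (H \<cdot> v) - cinner (H \<cdot> u) (A \<cdot> v)"
    if u: "u \<in> Domain A \<inter> Domain H" and v: "v \<in> Domain A \<inter> Domain H" for u v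
  proof -
    have Ru: "R' (H \<cdot> u - cnj z *\<^sub>C u) = u" using Phi_res_mem(3)[OF z'] u by blast
    have Rv: "R (H \<cdot> v - z *\<^sub>C v) = v" using Phi_res_mem(3)[OF z] v by blast
    have s: "cinner (A \<cdot> u) v = cinner u (A \<cdot> v)" using u v by (intro symm) auto
    have "cinner (H \<cdot> u - cnj z *\<^sub>C u) (C (H \<cdot> v - z *\<^sub>C v))
      = cinner (H \<cdot> u - cnj z *\<^sub>C u) (A \<cdot> v) - cinner (A \<cdot> u) (H \<cdot> v - z *\<^sub>C v)"
      using C_eq[of "H \<cdot> u - cnj z *\<^sub>C u" "H \<cdot> v - z *\<^sub>C v"] u v unfolding Ru Rv by simp
    thus ?thesis
      unfolding B_def by (simp add: cinner_diff_left cinner_diff_right cinner_scaleC_left cinner_scaleC_right s)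
  qed
  ultimately have "\<exists>B. sesquilinear_on (Domain H) B \<and>
     continuous_on (H \<times> H) (\<lambda>(p, q). B (fst p) (fst q)) \<and>
     (\<forall>u\<in>Domain A \<inter> Domain H. \<forall>v\<in>Domain A \<inter> Domain H.
        B u v = cinner (A \<cdot> u) (H \<cdot> v) - cinner (H \<cdot> u) (A \<cdot> v))" by blast
  from someI_ex[OF this] show ?thesis using u v unfolding commutator_form_def by blast
qed

end

section \<open>Algebra and limits of the commutation relation\<close>

context commutator_setting
begin

text \<open>For \<open>\<psi> = \<phi>' \<theta>\<close> this is the chain rule \<open>[A, \<phi>(H)] = i \<phi>'(H) \<theta>(H)\<close>.\<close>

definition commutes_to :: "(real \<Rightarrow> complex) \<Rightarrow> (real \<Rightarrow> complex) \<Rightarrow> bool" where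
  "commutes_to \<phi> \<psi> \<longleftrightarrow> bounded_borel \<phi> \<and> bounded_borel \<psi> \<and> (\<forall>u\<in>Domain A. \<forall>v\<in>Domain A.
     cinner (A \<cdot> u) (Phi \<phi> v) - cinner u (Phi \<phi> (A \<cdot> v)) = \<i> * cinner u (Phi \<psi> v))"

lemma commutes_toD:
  assumes "commutes_to \<phi> \<psi>" "u \<in> Domain A" "v \<in> Domain A"
  shows "cinner (A \<cdot> u) (Phi \<phi> v) = cinner u (Phi \<phi> (A \<cdot> v)) + \<i> * cinner u (Phi \<psi> v)"
proof -
  have "cinner (A \<cdot> u) (Phi \<phi> v) - cinner u (Phi \<phi> (A \<cdot> v)) = \<i> * cinner u (Phi \<psi> v)"
    using assms unfolding commutes_to_def by blast
  thus ?thesis by (simp add: algebra_simps)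
qed

lemma commutes_toI:
  assumes "bounded_borel \<phi>" "bounded_borel \<psi>"
    and "\<And>u v. u \<in> Domain A \<Longrightarrow> v \<in> Domain A \<Longrightarrow>
      cinner (A \<cdot> u) (Phi \<phi> v) = cinner u (Phi \<phi> (A \<cdot> v)) + \<i> * cinner u (Phi \<psi> v)"
  shows "commutes_to \<phi> \<psi>"
  unfolding commutes_to_def using assms by auto

lemma commutes_to_bb: "commutes_to \<phi> \<psi> \<Longrightarrow> bounded_borel \<phi>" "commutes_to \<phi> \<psi> \<Longrightarrow> bounded_borel \<psi>"
  by (auto simp: commutes_to_def)

text \<open>The weak identity exhibits \<open>Phi \<phi> v\<close> in the domain of the adjoint,
  hence of A. This strong form allows commutators to be iterated.\<close>

lemma commutes_to_mem:
  assumes c: "commutes_to \<phi> \<psi>" and v: "v \<in> Domain A"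
  shows "(Phi \<phi> v, Phi \<phi> (A \<cdot> v) + \<i> *\<^sub>C Phi \<psi> v) \<in> A"
proof (rule memI)
  fix u assume u: "u \<in> Domain A"
  have "cinner (A \<cdot> u) (Phi \<phi> v) = cinner u (Phi \<phi> (A \<cdot> v) + \<i> *\<^sub>C Phi \<psi> v)"
    using commutes_toD[OF c u v] by (simp add: cinner_add_right cinner_scaleC_right)
  thus "cinner (Phi \<phi> v) (A \<cdot> u) = cinner (Phi \<phi> (A \<cdot> v) + \<i> *\<^sub>C Phi \<psi> v) u"
    by (metis cinner_commute)
qed

lemma commutes_to_const: "commutes_to (\<lambda>x. c) (\<lambda>x. 0)"
  by (rule commutes_toI) (simp_all add: Phi_const cinner_scaleC_right symm)

lemma commutes_to_add:
  assumes "commutes_to \<phi> \<psi>" "commutes_to \<phi>' \<psi>'"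
  shows "commutes_to (\<lambda>x. \<phi> x + \<phi>' x) (\<lambda>x. \<psi> x + \<psi>' x)"
  using commutes_to_bb[OF assms(1)] commutes_to_bb[OF assms(2)] commutes_toD[OF assms(1)] commutes_toD[OF assms(2)]
  by (intro commutes_toI) (simp_all add: bounded_borel_add Phi_add cinner_add_right algebra_simps)

text \<open>The Leibniz rule; \<open>commutes_to_mem\<close> makes the inner factor applied to v an
  admissible vector for the outer relation.\<close>

lemma commutes_to_mult:
  assumes c1: "commutes_to \<phi> \<psi>" and c2: "commutes_to \<phi>' \<psi>'"
  shows "commutes_to (\<lambda>x. \<phi> x * \<phi>' x) (\<lambda>x. \<phi> x * \<psi>' x + \<psi> x * \<phi>' x)"
proof (rule commutes_toI)
  note b = commutes_to_bb[OF c1] commutes_to_bb[OF c2]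
  show "bounded_borel (\<lambda>x. \<phi> x * \<phi>' x)" "bounded_borel (\<lambda>x. \<phi> x * \<psi>' x + \<psi> x * \<phi>' x)"
    by (intro bounded_borel_add bounded_borel_mult b)+
  fix u v assume u: "u \<in> Domain A" and v: "v \<in> Domain A"
  note m = commutes_to_mem[OF c2 v]
  have "cinner (A \<cdot> u) (Phi \<phi> (Phi \<phi>' v)) = cinner u (Phi \<phi> (A \<cdot> Phi \<phi>' v)) + \<i> * cinner u (Phi \<psi> (Phi \<phi>' v))"
    using m by (intro commutes_toD[OF c1 u]) auto
  also have "A \<cdot> Phi \<phi>' v = Phi \<phi>' (A \<cdot> v) + \<i> *\<^sub>C Phi \<psi>' v" by (rule appI[OF m])
  finally show "cinner (A \<cdot> u) (Phi (\<lambda>x. \<phi> x * \<phi>' x) v) = cinner u (Phi (\<lambda>x. \<phi> x * \<phi>' x) (A \<cdot> v)) +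
      \<i> * cinner u (Phi (\<lambda>x. \<phi> x * \<psi>' x + \<psi> x * \<phi>' x) v)"
    using b by (simp add: Phi_mult Phi_add bounded_borel_mult Phi_linear cinner_add_right cinner_scaleC_right
        distrib_left)
qed

lemma commutes_to_cmult: "commutes_to \<phi> \<psi> \<Longrightarrow> commutes_to (\<lambda>x. c * \<phi> x) (\<lambda>x. c * \<psi> x)"
  using commutes_to_mult[OF commutes_to_const, of \<phi> \<psi> c] by simp

lemma commutes_to_cnj:
  assumes c: "commutes_to \<phi> \<psi>" shows "commutes_to (\<lambda>x. cnj (\<phi> x)) (\<lambda>x. cnj (\<psi> x))"
proof (rule commutes_toI)
  note b = commutes_to_bb[OF c]
  show b': "bounded_borel (\<lambda>x. cnj (\<phi> x))" "bounded_borel (\<lambda>x. cnj (\<psi> x))" by (intro bounded_borel_cnj b)+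
  fix u v assume u: "u \<in> Domain A" and v: "v \<in> Domain A"
  have f: "cinner x (Phi (\<lambda>x. cnj (f x)) y) = cnj (cinner y (Phi f x))" if "bounded_borel f" for f x y
    using Phi_adj[OF bounded_borel_cnj[OF that], of x y] by (simp add: cinner_commute[symmetric])
  have "cnj (cinner (A \<cdot> v) (Phi \<phi> u)) = cnj (cinner v (Phi \<phi> (A \<cdot> u)) + \<i> * cinner v (Phi \<psi> u))"
    by (rule arg_cong[OF commutes_toD[OF c v u]])
  thus "cinner (A \<cdot> u) (Phi (\<lambda>x. cnj (\<phi> x)) v) = cinner u (Phi (\<lambda>x. cnj (\<phi> x)) (A \<cdot> v)) +
     \<i> * cinner u (Phi (\<lambda>x. cnj (\<psi> x)) v)"
    unfolding f[OF b(1)] f[OF b(2)] by (simp add: algebra_simps)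
qed

text \<open>In the weak form A acts on fixed vectors only, so strong convergence of
  \<open>Phi (f n)\<close> and \<open>Phi (g n)\<close> suffices, and bounded pointwise convergence
  provides it.\<close>

lemma commutes_to_tendsto:
  assumes c: "\<And>n. commutes_to (f n) (g n)" and b: "bounded_borel \<phi>" "bounded_borel \<psi>"
    and f: "\<And>n x. cmod (f n x) \<le> K" "\<And>x. (\<lambda>n. f n x) \<longlonglongrightarrow> \<phi> x"
    and g: "\<And>n x. cmod (g n x) \<le> L" "\<And>x. (\<lambda>n. g n x) \<longlonglongrightarrow> \<psi> x"
  shows "commutes_to \<phi> \<psi>"
proof (rule commutes_toI[OF b])
  fix u v assume u: "u \<in> Domain A" and v: "v \<in> Domain A"
  note lf = Phi_tendsto[OF commutes_to_bb(1)[OF c] b(1) f] and lg = Phi_tendsto[OF commutes_to_bb(2)[OF c] b(2) g]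
  have "(\<lambda>n. cinner (A \<cdot> u) (Phi (f n) v)) \<longlonglongrightarrow> cinner (A \<cdot> u) (Phi \<phi> v)"
    by (intro tendsto_cinner tendsto_const lf)
  moreover have "(\<lambda>n. cinner u (Phi (f n) (A \<cdot> v)) + \<i> * cinner u (Phi (g n) v)) \<longlonglongrightarrow>
      cinner u (Phi \<phi> (A \<cdot> v)) + \<i> * cinner u (Phi \<psi> v)"
    by (intro tendsto_add tendsto_mult tendsto_cinner tendsto_const lf lg)
  ultimately show "cinner (A \<cdot> u) (Phi \<phi> v) = cinner u (Phi \<phi> (A \<cdot> v)) + \<i> * cinner u (Phi \<psi> v)"
    unfolding commutes_toD[OF c u v] by (rule LIMSEQ_unique)
qed

end

text \<open>Since \<open>x * res z x = 1 + z * res z x\<close> is bounded, one resolvent compensates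
  the linear growth of \<theta>.\<close>

lemma bounded_borel_growth_res:
  fixes \<theta> :: "real \<Rightarrow> real"
  assumes z: "Im z \<noteq> 0" and \<theta>: "continuous_on UNIV \<theta>" "\<And>x. \<bar>\<theta> x\<bar> \<le> a + b * \<bar>x\<bar>" and ab: "a \<ge> 0" "b \<ge> 0"
  shows "cmod (\<theta> x * res z x) \<le> a / \<bar>Im z\<bar> + b * (1 + cmod z / \<bar>Im z\<bar>)"
    and "bounded_borel (\<lambda>x. \<theta> x * res z x)"
proof -
  show bd: "cmod (\<theta> x * res z x) \<le> a / \<bar>Im z\<bar> + b * (1 + cmod z / \<bar>Im z\<bar>)" for x
  proof -
    have "cmod (\<theta> x * res z x) = \<bar>\<theta> x\<bar> * cmod (res z x)" by (simp add: norm_mult norm_divide)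
    also have "\<dots> \<le> (a + b * \<bar>x\<bar>) * cmod (res z x)" by (intro mult_right_mono \<theta>) simp
    also have "\<dots> = a * cmod (res z x) + b * cmod (complex_of_real x * res z x)"
      by (simp add: norm_mult norm_divide distrib_right add_divide_distrib)
    also have "complex_of_real x * res z x = 1 + z * res z x"
      using real_minus_nonreal[OF z, of x] by (simp add: field_simps)
    also have "a * cmod (res z x) + b * cmod (1 + z * res z x) \<le> a * (1 / \<bar>Im z\<bar>) + b * (1 + cmod z * (1 / \<bar>Im z\<bar>))"
    proof (intro add_mono mult_left_mono ab norm_res_le[OF z])
      have "cmod (1 + z * res z x) \<le> cmod 1 + cmod (z * res z x)" by (rule norm_triangle_ineq)
      also have "\<dots> \<le> 1 + cmod z * (1 / \<bar>Im z\<bar>)"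
        unfolding norm_mult norm_one by (intro add_left_mono mult_left_mono norm_res_le[OF z]) simp
      finally show "cmod (1 + z * res z x) \<le> 1 + cmod z * (1 / \<bar>Im z\<bar>)" .
    qed
    finally show ?thesis by simp
  qed
  show "bounded_borel (\<lambda>x. \<theta> x * res z x)"
    by (rule bounded_borelI[OF _ bd])
      (intro borel_measurable_continuous_onI continuous_intros \<theta> ballI real_minus_nonreal z)
qed

context commutator_bounded
begin

text \<open>The equality of forms is tested on \<open>R' u\<close> and \<open>R v\<close>, which lie
  in both domains; in \<open>H R' u = u + cnj z R' u\<close> and \<open>H R v = v + z R v\<close>
  the terms with z cancel. As \<open>- (res z)\<^sup>2\<close> is the derivative of
  \<open>res z\<close>, this is the chain rule for the resolvent.\<close>

lemma commutes_to_res: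
  fixes \<theta> :: "real \<Rightarrow> real"
  assumes \<theta>: "continuous_on UNIV \<theta>" "\<And>x. \<bar>\<theta> x\<bar> \<le> a + b * \<bar>x\<bar>" "a \<ge> 0" "b \<ge> 0"
    and form: "form_eq_operator_on (Domain H) (derived_form A H) (op_fun (\<lambda>x. complex_of_real (\<theta> x)) H)"
  shows "commutes_to (res z) (\<lambda>x. - (res z x * (\<theta> x * res z x)))"
proof (rule commutes_toI)
  note r = bounded_borel_res[OF z] and tr = bounded_borel_growth_res(2)[OF z \<theta>]
  have rtr: "bounded_borel (\<lambda>x. res z x * (\<theta> x * res z x))" by (intro bounded_borel_mult r tr)
  show "bounded_borel (res z)" "bounded_borel (\<lambda>x. - (res z x * (\<theta> x * res z x)))"
    by (intro r bounded_borel_minus rtr)+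
  have smH: "spectral_measure_of H E" using pvm H_eq by (simp add: spectral_measure_of_def)
  fix u v assume u: "u \<in> Domain A" and v: "v \<in> Domain A"
  define u' v' where "u' = R' u" and "v' = R v"
  have D: "u' \<in> Domain A" "v' \<in> Domain A" using R_Domain u v by (auto simp: u'_def v'_def)
  have Hu: "u' \<in> Domain H" "H \<cdot> u' = u + cnj z *\<^sub>C u'" unfolding u'_def by (rule Phi_res_mem[OF z'])+
  have Hv: "v' \<in> Domain H" "H \<cdot> v' = v + z *\<^sub>C v'" unfolding v'_def by (rule Phi_res_mem[OF z])+
  have "(v', Phi (\<lambda>x. complex_of_real (\<theta> x) * res z x) v) \<in> op_fun (\<lambda>x. complex_of_real (\<theta> x)) H"
    unfolding op_fun_eq_integral_pvm[OF smH] v'_def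
    by (rule Phi_mem_integral_pvm[OF _ r tr])
      (intro borel_measurable_continuous_onI continuous_intros \<theta>)
  moreover have "single_valued (op_fun (\<lambda>x. complex_of_real (\<theta> x)) H)"
    unfolding op_fun_eq_integral_pvm[OF smH] by (rule single_valued_integral_pvm)
  ultimately have th: "op_fun (\<lambda>x. complex_of_real (\<theta> x)) H \<cdot> v' = Phi (\<lambda>x. \<theta> x * res z x) v"
    by (intro app_eq)
  have "derived_form A H u' v' = cinner u' (op_fun (\<lambda>x. complex_of_real (\<theta> x)) H \<cdot> v')"
    using form Hu(1) Hv(1) unfolding form_eq_operator_on_def by blast
  hence d1: "\<i> * (- (cinner (A \<cdot> u') (H \<cdot> v') - cinner (H \<cdot> u') (A \<cdot> v'))) = cinner u' (Phi (\<lambda>x. \<theta> x * res z x) v)"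
    unfolding th derived_form_def using D Hu(1) Hv(1) by (simp add: commutator_form_eq)
  have d2: "cinner u' (Phi (\<lambda>x. \<theta> x * res z x) v) = - cinner u (Phi (\<lambda>x. - (res z x * (\<theta> x * res z x))) v)"
    unfolding Phi_minus[OF rtr] Phi_mult[OF r tr] R_adj u'_def cinner_minus_right by simp
  have d3: "cinner (A \<cdot> u') (H \<cdot> v') - cinner (H \<cdot> u') (A \<cdot> v') = cinner u' (A \<cdot> v) - cinner (A \<cdot> u) v'"
  proof -
    have "cinner (A \<cdot> u') v' = cinner u' (A \<cdot> v')" "cinner (A \<cdot> u') v = cinner u' (A \<cdot> v)"
       "cinner u (A \<cdot> v') = cinner (A \<cdot> u) v'"
      using symm[OF D] symm[OF D(1) v] symm[OF u D(2)] by simp_all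
    thus ?thesis unfolding Hu(2) Hv(2)
      by (simp add: cinner_add_left cinner_add_right cinner_scaleC_left cinner_scaleC_right)
  qed
  have d4: "cinner u' (A \<cdot> v) = cinner u (R (A \<cdot> v))" by (simp add: R_adj u'_def)
  have "\<i> * (cinner (A \<cdot> u) (R v) - cinner u (R (A \<cdot> v)))
      = \<i> * (- (cinner (A \<cdot> u') (H \<cdot> v') - cinner (H \<cdot> u') (A \<cdot> v')))"
    unfolding v'_def[symmetric] d3 d4 by simp
  also note d1
  also note d2
  finally have "\<i> * (cinner (A \<cdot> u) (R v) - cinner u (R (A \<cdot> v)))
      = - cinner u (Phi (\<lambda>x. - (res z x * (\<theta> x * res z x))) v)" .
  moreover have "X = S + \<i> * Y" if "\<i> * (X - S) = - Y" for X S Y :: complex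
    using that by (auto simp: complex_eq_iff)
  ultimately show "cinner (A \<cdot> u) (Phi (res z) v) = cinner u (Phi (res z) (A \<cdot> v)) +
     \<i> * cinner u (Phi (\<lambda>x. - (res z x * (\<theta> x * res z x))) v)"
    by blast
qed

end

text \<open>A cutoff of class C1, equal to 1 for \<open>\<bar>x\<bar> \<le> 1\<close> and to 0 for
  \<open>x\<^sup>2 \<ge> 2\<close>. It is built from \<open>(max 0 x)\<^sup>2\<close>, whose
  derivative \<open>2 * max 0 x\<close> is continuous, so that no cases have to be glued.\<close>

definition bump :: "real \<Rightarrow> real" where
  "bump x = (max 0 (1 - (max 0 (x\<^sup>2 - 1))\<^sup>2))\<^sup>2"

definition bump' :: "real \<Rightarrow> real" where
  "bump' x = 2 * max 0 (1 - (max 0 (x\<^sup>2 - 1))\<^sup>2) * (- (2 * max 0 (x\<^sup>2 - 1) * (2 * x)))"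

lemma has_derivative_max0_square:
  "((\<lambda>x::real. (max 0 x)\<^sup>2) has_real_derivative (2 * max 0 x)) (at x)"
proof -
  consider "x > 0" | "x < 0" | "x = 0" by linarith
  thus ?thesis
  proof cases
    case 1
    have "((\<lambda>x::real. x\<^sup>2) has_real_derivative (2 * x)) (at x)" by (auto intro!: derivative_eq_intros)
    moreover have "\<forall>\<^sub>F y in nhds x. y\<^sup>2 = (max 0 y)\<^sup>2"
      using eventually_nhds_in_open[of "{0<..}" x] 1 by (auto elim!: eventually_mono)
    moreover have "2 * x = 2 * max 0 x" using 1 by simp
    ultimately show ?thesis by (rule DERIV_cong_ev[OF refl, THEN iffD1, rotated 2])
  next
    case 2
    have "((\<lambda>x::real. 0) has_real_derivative 0) (at x)" by simp
    moreover have "\<forall>\<^sub>F y in nhds x. 0 = (max 0 y)\<^sup>2"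
      using eventually_nhds_in_open[of "{..<0}" x] 2 by (auto elim!: eventually_mono)
    moreover have "0 = 2 * max 0 x" using 2 by simp
    ultimately show ?thesis by (rule DERIV_cong_ev[OF refl, THEN iffD1, rotated 2])
  next
    case 3
    have "((\<lambda>h::real. (max 0 h)\<^sup>2 / h) \<longlongrightarrow> 0) (at 0)"
    proof (rule Lim_null_comparison)
      show "\<forall>\<^sub>F h in at (0::real). norm ((max 0 h)\<^sup>2 / h) \<le> \<bar>h\<bar>"
        by (rule always_eventually) (auto simp: max_def power2_eq_square)
      show "((\<lambda>h::real. \<bar>h\<bar>) \<longlongrightarrow> 0) (at 0)" by (rule tendsto_rabs_zero[OF tendsto_ident_at])
    qed
    thus ?thesis using 3 by (simp add: DERIV_def)
  qed
qed

lemma bump_derivative: "(bump has_real_derivative bump' x) (at x)"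
proof -
  have 1: "((\<lambda>x. 1 - (max 0 (x\<^sup>2 - 1))\<^sup>2) has_real_derivative - (2 * max 0 (x\<^sup>2 - 1) * (2 * x))) (at x)"
  proof -
    have "((\<lambda>x. x\<^sup>2 - 1) has_real_derivative 2 * x) (at x)" by (auto intro!: derivative_eq_intros)
    from DERIV_diff[OF DERIV_const[of 1] DERIV_chain2[OF has_derivative_max0_square this]]
    show ?thesis by simp
  qed
  show ?thesis
    unfolding bump_def bump'_def by (rule DERIV_chain2[OF has_derivative_max0_square 1])
qed

lemma continuous_bump': "continuous_on X bump'"
  unfolding bump'_def by (intro continuous_intros)

lemma continuous_bump: "continuous_on X bump"
  unfolding bump_def by (intro continuous_intros)

lemma bump_bounds: "0 \<le> bump x" "bump x \<le> 1"
proof -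
  show "0 \<le> bump x" by (simp add: bump_def)
  have "max 0 (1 - (max 0 (x\<^sup>2 - 1))\<^sup>2) \<le> 1" by simp
  from power_mono[OF this, of 2] show "bump x \<le> 1" unfolding bump_def by simp
qed

lemma bump_inside:
  assumes "\<bar>x\<bar> \<le> 1" shows "bump x = 1" "bump' x = 0"
proof -
  have "x\<^sup>2 \<le> 1" using assms by (simp add: abs_square_le_1)
  hence "max 0 (x\<^sup>2 - 1) = 0" by (simp only: max_absorb1 diff_le_0_iff_le)
  thus "bump x = 1" "bump' x = 0" by (simp_all only: bump_def bump'_def) simp_all
qed

lemma bump_outside:
  assumes "\<bar>x\<bar> \<ge> 2" shows "bump x = 0" "bump' x = 0"
proof -
  have "x\<^sup>2 \<ge> 2\<^sup>2" using assms by (metis abs_le_square_iff abs_numeral)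
  hence "max 0 (x\<^sup>2 - 1) \<ge> 1" by simp
  from power_mono[OF this, of 2] have "1 \<le> (max 0 (x\<^sup>2 - 1))\<^sup>2" by simp
  hence "max 0 (1 - (max 0 (x\<^sup>2 - 1))\<^sup>2) = 0" by (simp only: max_absorb1 diff_le_0_iff_le)
  thus "bump x = 0" "bump' x = 0" by (simp_all only: bump_def bump'_def) simp_all
qed

text \<open>Where the derivative does not vanish both maxima are at most 1 and
  \<open>\<bar>x\<bar> \<le> 2\<close>, which gives \<open>2 * (2 * (2 * 2)) = 16\<close>.\<close>

lemma bump'_bound: "\<bar>bump' x\<bar> \<le> 16"
proof (cases "max 0 (x\<^sup>2 - 1) \<le> 1 \<and> \<bar>x\<bar> \<le> 2")
  case True
  have 1: "\<bar>max 0 (1 - (max 0 (x\<^sup>2 - 1))\<^sup>2)\<bar> \<le> 1" by simp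
  have 2: "\<bar>max 0 (x\<^sup>2 - 1)\<bar> \<le> 1" using True by simp
  have "\<bar>bump' x\<bar> = 2 * \<bar>max 0 (1 - (max 0 (x\<^sup>2 - 1))\<^sup>2)\<bar> * (2 * \<bar>max 0 (x\<^sup>2 - 1)\<bar> * (2 * \<bar>x\<bar>))"
    unfolding bump'_def by (simp only: abs_mult abs_minus_cancel abs_numeral)
  also have "\<dots> \<le> 2 * 1 * (2 * 1 * (2 * 2))"
    using True by (intro mult_mono mult_left_mono 1 2) auto
  finally show ?thesis by simp
next
  case False
  have "bump' x = 0"
  proof (cases "\<bar>x\<bar> \<le> 2")
    case True
    hence "1 \<le> max 0 (x\<^sup>2 - 1)" using False by linarith
    from power_mono[OF this, of 2] have "1 \<le> (max 0 (x\<^sup>2 - 1))\<^sup>2" by simp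
    hence "max 0 (1 - (max 0 (x\<^sup>2 - 1))\<^sup>2) = 0" by (simp only: max_absorb1 diff_le_0_iff_le)
    thus ?thesis unfolding bump'_def by (rule ssubst) simp
  qed (use bump_outside(2)[of x] in simp)
  thus ?thesis by simp
qed

section \<open>The chain rule from the Cayley transform to C1 functions\<close>

locale commutator_theta = commutator_bounded A E H z K
  for A :: "'a::complex_hilbert operator" and E and H and z and K +
  fixes \<theta> :: "real \<Rightarrow> real" and a b :: real
  assumes \<theta>_cont: "continuous_on UNIV \<theta>" and \<theta>_growth: "\<And>x. \<bar>\<theta> x\<bar> \<le> a + b * \<bar>x\<bar>"
    and ab: "a \<ge> 0" "b \<ge> 0"
    and form: "form_eq_operator_on (Domain H) (derived_form A H) (op_fun (\<lambda>x. complex_of_real (\<theta> x)) H)"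
begin

lemma commutes_to_cay: "commutes_to (cay z) (\<lambda>x. \<theta> x * ((cnj z - z) * cay z x / rsq z x))"
proof -
  have "commutes_to (\<lambda>x. 1 + (z - cnj z) * res z x) (\<lambda>x. 0 + (z - cnj z) * (- (res z x * (\<theta> x * res z x))))"
    by (intro commutes_to_add commutes_to_const commutes_to_cmult commutes_to_res[OF \<theta>_cont \<theta>_growth ab form])
  moreover have "(\<lambda>x. 1 + (z - cnj z) * res z x) = cay z" by (simp add: cay_res[OF z] fun_eq_iff)
  moreover have "(\<lambda>x. 0 + (z - cnj z) * (- (res z x * (\<theta> x * res z x)))) = (\<lambda>x. \<theta> x * ((cnj z - z) * cay z x / rsq z x))"
  proof
    fix x
    have "complex_of_real x - z \<noteq> 0" "complex_of_real x - cnj z \<noteq> 0"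
      using real_minus_nonreal[OF z, of x] real_minus_nonreal[OF z', of x] by auto
    hence "cay z x / rsq z x = res z x * res z x" by (simp add: cay_def)
    hence e: "\<theta> x * ((cnj z - z) * cay z x / rsq z x) = \<theta> x * ((cnj z - z) * (res z x * res z x))"
      by (simp only: times_divide_eq_right[symmetric])
    have "0 + (w - w') * (- (r * (t * r))) = t * ((w' - w) * (r * r))" for w w' r t :: complex
      by (simp add: algebra_simps)
    from this[of z "cnj z" "res z x" "\<theta> x"]
    show "0 + (z - cnj z) * (- (res z x * (\<theta> x * res z x))) = \<theta> x * ((cnj z - z) * cay z x / rsq z x)"
      unfolding e .
  qed
  ultimately show ?thesis by simp
qed

lemma commutes_to_cay_power:
  "commutes_to (\<lambda>x. cay z x ^ n) (\<lambda>x. \<theta> x * (of_nat n * (cnj z - z) * cay z x ^ n / rsq z x))"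
proof (induction n)
  case 0
  show ?case using commutes_to_const[of 1] by simp
next
  case (Suc n)
  have alg: "w * (t * (of_nat n * c * p / q)) + t * (c * w / q) * p = t * (of_nat (Suc n) * c * (w * p) / q)"
    for w t c p q :: complex
    by (simp add: add_divide_distrib algebra_simps)
  have "(\<lambda>x. cay z x * (\<theta> x * (of_nat n * (cnj z - z) * cay z x ^ n / rsq z x)) +
       \<theta> x * ((cnj z - z) * cay z x / rsq z x) * cay z x ^ n)
     = (\<lambda>x. \<theta> x * (of_nat (Suc n) * (cnj z - z) * cay z x ^ Suc n / rsq z x))"
    unfolding power_Suc by (rule ext) (rule alg)
  with commutes_to_mult[OF commutes_to_cay Suc.IH] show ?case by (simp only: power_Suc)
qed

text \<open>Negative powers of a function of modulus 1 are conjugates of positive ones. Conjugation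
  fixes \<open>rsq z\<close> and \<theta> and reverses the sign of \<open>cnj z - z\<close>, which
  accounts for the negative exponent.\<close>

lemma commutes_to_cay_powi:
  "commutes_to (\<lambda>x. cay z x powi k) (\<lambda>x. \<theta> x * (of_int k * (cnj z - z) * cay z x powi k / rsq z x))"
proof (cases "k \<ge> 0")
  case True
  thus ?thesis using commutes_to_cay_power[of "nat k"] by (simp add: power_int_def)
next
  case False
  define n where "n = nat (- k)"
  have k: "k = - int n" using False by (simp add: n_def)
  have pw: "cnj (cay z x ^ n) = cay z x powi k" for x
    by (simp add: k power_int_minus cnj_cay[OF z] power_inverse)
  have rs: "cnj (rsq z x) = rsq z x" for x unfolding rsq_eq by simp
  have "cnj (\<theta> x * (of_nat n * (cnj z - z) * cay z x ^ n / rsq z x)) =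
     \<theta> x * (of_int k * (cnj z - z) * cay z x powi k / rsq z x)" for x
  proof -
    have "cnj (\<theta> x * (of_nat n * (cnj z - z) * cay z x ^ n / rsq z x)) =
       \<theta> x * (of_nat n * (z - cnj z) * cnj (cay z x ^ n) / cnj (rsq z x))"
      by (simp only: complex_cnj_mult complex_cnj_divide complex_cnj_diff complex_cnj_cnj
          complex_cnj_of_nat complex_cnj_complex_of_real)
    also have "\<dots> = \<theta> x * (of_nat n * (z - cnj z) * cay z x powi k / rsq z x)" unfolding pw rs ..
    also have "of_nat n * (z - cnj z) = of_int k * (cnj z - z)" unfolding k by (simp add: algebra_simps)
    finally show ?thesis .
  qed
  with commutes_to_cnj[OF commutes_to_cay_power[of n]] show ?thesis unfolding pw by simp
qed

lemma commutes_to_laurent: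
  assumes "laurent g"
  shows "\<exists>g' :: real \<Rightarrow> complex. (\<forall>x. ((\<lambda>x. g (cay z x)) has_vector_derivative g' x) (at x)) \<and>
    commutes_to (\<lambda>x. g (cay z x)) (\<lambda>x. \<theta> x * g' x)"
  using assms
proof induction
  case zero
  show ?case using commutes_to_const[of 0] by (intro exI[of _ "\<lambda>_. 0"]) auto
next
  case (monom g c k)
  then obtain g' :: "real \<Rightarrow> complex" where g': "\<And>x. ((\<lambda>x. g (cay z x)) has_vector_derivative g' x) (at x)"
    "commutes_to (\<lambda>x. g (cay z x)) (\<lambda>x. \<theta> x * g' x)" by blast
  define d where "d x = of_int k * (cnj z - z) * cay z x powi k / rsq z x" for x
  have "((\<lambda>x. g (cay z x) + c * cay z x powi k) has_vector_derivative g' x + c * d x) (at x)" for x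
    unfolding d_def
    by (intro has_vector_derivative_add has_vector_derivative_mult_right cay_has_derivative g' z)
  moreover have "commutes_to (\<lambda>x. g (cay z x) + c * cay z x powi k) (\<lambda>x. \<theta> x * g' x + c * (\<theta> x * d x))"
    unfolding d_def by (intro commutes_to_add g' commutes_to_cmult commutes_to_cay_powi)
  moreover have "(\<lambda>x. \<theta> x * g' x + c * (\<theta> x * d x)) = (\<lambda>x. \<theta> x * (g' x + c * d x))"
    by (simp add: algebra_simps)
  ultimately show ?case by (intro exI[of _ "\<lambda>x. g' x + c * d x"]) auto
qed

text \<open>\<open>laurent_C1_dense\<close> controls the derivatives with the weight
  \<open>rsq z\<close>, and \<theta> divided by this weight is bounded; hence
  \<open>\<theta> * g'\<close> tends uniformly to \<open>\<theta> * \<phi>'\<close>. The constants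
  \<open>g n 1\<close> commute with everything.\<close>

lemma commutes_to_C1_compact:
  fixes \<phi> \<phi>' :: "real \<Rightarrow> complex"
  assumes der: "\<And>x. (\<phi> has_vector_derivative \<phi>' x) (at x)"
    and c: "continuous_on UNIV \<phi>'" and supp: "\<And>x. \<bar>x\<bar> > r \<Longrightarrow> \<phi> x = 0"
    and K1: "\<And>x. cmod (\<phi> x) \<le> K1" and K2: "\<And>x. cmod (\<theta> x * \<phi>' x) \<le> K2"
  shows "commutes_to \<phi> (\<lambda>x. \<theta> x * \<phi>' x)"
proof -
  have "\<forall>n. \<exists>g g'. laurent g \<and> (\<forall>x. ((\<lambda>x. g (cay z x)) has_vector_derivative g' x) (at x)) \<and>
    (\<forall>x. cmod (g (cay z x) - g 1 - \<phi> x) \<le> 1 / Suc n) \<and> (\<forall>x. cmod (rsq z x * (g' x - \<phi>' x)) \<le> 1 / Suc n)"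
    by (intro allI laurent_C1_dense[OF z der c supp]) simp_all
  from choice[OF this] obtain g where "\<forall>n. \<exists>g'. laurent (g n) \<and>
      (\<forall>x. ((\<lambda>x. g n (cay z x)) has_vector_derivative g' x) (at x)) \<and>
      (\<forall>x. cmod (g n (cay z x) - g n 1 - \<phi> x) \<le> 1 / Suc n) \<and>
      (\<forall>x. cmod (rsq z x * (g' x - \<phi>' x)) \<le> 1 / Suc n)" ..
  note ex_g' = this
  from choice[OF ex_g'] obtain g' where gg': "\<forall>n. laurent (g n) \<and>
      (\<forall>x. ((\<lambda>x. g n (cay z x)) has_vector_derivative g' n x) (at x)) \<and>
      (\<forall>x. cmod (g n (cay z x) - g n 1 - \<phi> x) \<le> 1 / Suc n) \<and>
      (\<forall>x. cmod (rsq z x * (g' n x - \<phi>' x)) \<le> 1 / Suc n)" ..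
  have g: "\<And>n. laurent (g n)"
    and g': "\<And>n x. ((\<lambda>x. g n (cay z x)) has_vector_derivative g' n x) (at x)"
    and b1: "\<And>n x. cmod (g n (cay z x) - g n 1 - \<phi> x) \<le> 1 / Suc n"
    and b2: "\<And>n x. cmod (rsq z x * (g' n x - \<phi>' x)) \<le> 1 / Suc n"
    using gg' by blast+
  have com: "commutes_to (\<lambda>x. g n (cay z x) - g n 1) (\<lambda>x. \<theta> x * g' n x)" for n
  proof -
    obtain h :: "real \<Rightarrow> complex" where h: "\<And>x. ((\<lambda>x. g n (cay z x)) has_vector_derivative h x) (at x)"
      "commutes_to (\<lambda>x. g n (cay z x)) (\<lambda>x. \<theta> x * h x)" using commutes_to_laurent[OF g] by blast
    have "h = g' n" by (rule ext) (rule vector_derivative_unique_at[OF h(1) g'])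
    with commutes_to_add[OF h(2) commutes_to_const[of "- g n 1"]] show ?thesis by simp
  qed
  \<comment> \<open>Bounds \<open>\<bar>\<theta> x\<bar>\<close> over \<open>rsq z x\<close>: one
    resolvent absorbs the growth of \<theta>, the other is simply bounded.\<close>
  define L where "L = (a / \<bar>Im z\<bar> + b * (1 + cmod z / \<bar>Im z\<bar>)) * (1 / \<bar>Im (cnj z)\<bar>)"
  have L: "cmod (\<theta> x * res z x * res (cnj z) x) \<le> L" for x
    unfolding norm_mult[of "\<theta> x * res z x"] L_def
    by (intro mult_mono bounded_borel_growth_res(1)[OF z \<theta>_cont \<theta>_growth ab] norm_res_le z')
      (use ab in auto)
  have L0: "L \<ge> 0" using L[of 0] norm_ge_zero order_trans by blast
  have b3: "cmod (\<theta> x * g' n x - \<theta> x * \<phi>' x) \<le> L * (1 / Suc n)" for n x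
  proof -
    have nz: "complex_of_real x - z \<noteq> 0" "complex_of_real x - cnj z \<noteq> 0"
      using real_minus_nonreal[OF z, of x] real_minus_nonreal[OF z', of x] by auto
    have "\<theta> x * g' n x - \<theta> x * \<phi>' x = (\<theta> x * res z x * res (cnj z) x) * (rsq z x * (g' n x - \<phi>' x))"
    proof -
      have "t * p - t * q = (t * (1 / y) * (1 / y')) * (y * y' * (p - q))" if "y \<noteq> 0" "y' \<noteq> 0" for t p q y y' :: complex
        using that by (simp add: field_simps)
      from this[OF nz] show ?thesis .
    qed
    also have "cmod \<dots> \<le> L * (1 / Suc n)"
      unfolding norm_mult[of "\<theta> x * res z x * res (cnj z) x"] by (intro mult_mono L b2 L0) simp
    finally show ?thesis .
  qed
  have c\<phi>: "continuous_on UNIV \<phi>"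
    by (rule continuous_on_vector_derivative[OF has_vector_derivative_at_within[OF der]])
  have one: "1 / real (Suc n) \<le> 1" for n by simp
  show ?thesis
  proof (rule commutes_to_tendsto[OF com])
    show "bounded_borel \<phi>" by (rule bounded_borelI[OF borel_measurable_continuous_onI[OF c\<phi>] K1])
    show "bounded_borel (\<lambda>x. \<theta> x * \<phi>' x)"
      by (rule bounded_borelI[OF borel_measurable_continuous_onI K2]) (intro continuous_intros \<theta>_cont c)
    show "cmod (g n (cay z x) - g n 1) \<le> K1 + 1" for n x
    proof -
      have "cmod (g n (cay z x) - g n 1) \<le> cmod (g n (cay z x) - g n 1 - \<phi> x) + cmod (\<phi> x)"
        using norm_triangle_ineq[of "g n (cay z x) - g n 1 - \<phi> x" "\<phi> x"] by simp
      thus ?thesis using b1[of n x] K1[of x] one[of n] by linarith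
    qed
    show "cmod (\<theta> x * g' n x) \<le> K2 + L" for n x
    proof -
      have "cmod (\<theta> x * g' n x) \<le> cmod (\<theta> x * g' n x - \<theta> x * \<phi>' x) + cmod (\<theta> x * \<phi>' x)"
        using norm_triangle_ineq[of "\<theta> x * g' n x - \<theta> x * \<phi>' x" "\<theta> x * \<phi>' x"] by simp
      moreover have "L * (1 / real (Suc n)) \<le> L" using mult_left_mono[OF one[of n] L0] by simp
      ultimately show ?thesis using b3[of x n] K2[of x] by linarith
    qed
    show "(\<lambda>n. g n (cay z x) - g n 1) \<longlonglongrightarrow> \<phi> x" for x
    proof -
      have "(\<lambda>n. g n (cay z x) - g n 1 - \<phi> x) \<longlonglongrightarrow> 0"
        by (rule Lim_null_comparison[OF always_eventually LIMSEQ_Suc[OF lim_1_over_n]]) (use b1 in blast)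
      thus ?thesis using LIM_zero_iff by blast
    qed
    show "(\<lambda>n. \<theta> x * g' n x) \<longlonglongrightarrow> \<theta> x * \<phi>' x" for x
    proof -
      have "(\<lambda>n. L * (1 / real (Suc n))) \<longlonglongrightarrow> L * 0"
        by (intro tendsto_mult tendsto_const LIMSEQ_Suc[OF lim_1_over_n])
      hence "(\<lambda>n. L * (1 / real (Suc n))) \<longlonglongrightarrow> 0" by simp
      hence "(\<lambda>n. \<theta> x * g' n x - \<theta> x * \<phi>' x) \<longlonglongrightarrow> 0"
        by (rule Lim_null_comparison[OF always_eventually, rotated]) (use b3 in blast)
      thus ?thesis using LIM_zero_iff by blast
    qed
  qed
qed

text \<open>Truncate with \<open>bump (x / m)\<close> and let m grow. The derivative of the cutoff
  contributes \<open>bump' (x / m) / m\<close>, and its factor \<open>1 / m\<close> balances the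
  linear growth of \<theta> on the region \<open>\<bar>x\<bar> \<le> 2 * m\<close>. At each fixed x
  the truncated functions are eventually unchanged.\<close>

lemma commutes_to_C1:
  fixes \<phi> \<phi>' :: "real \<Rightarrow> complex"
  assumes der: "\<And>x. (\<phi> has_vector_derivative \<phi>' x) (at x)"
    and c: "continuous_on UNIV \<phi>'"
    and K1: "\<And>x. cmod (\<phi> x) \<le> K1" and K2: "\<And>x. cmod (\<theta> x * \<phi>' x) \<le> K2"
  shows "commutes_to \<phi> (\<lambda>x. \<theta> x * \<phi>' x)"
proof -
  define m where "m n = real (Suc n)" for n
  have m: "m n > 0" "m n \<ge> 1" for n by (auto simp: m_def)
  define f where "f n x = \<phi> x * complex_of_real (bump (x / m n))" for n x
  define f' where "f' n x = \<phi> x * complex_of_real (bump' (x / m n) / m n) + \<phi>' x * complex_of_real (bump (x / m n))" for n x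
  have c\<phi>: "continuous_on UNIV \<phi>"
    by (rule continuous_on_vector_derivative[OF has_vector_derivative_at_within[OF der]])
  have K0: "K1 \<ge> 0" "K2 \<ge> 0" using K1[of 0] K2[of 0] norm_ge_zero order_trans by blast+
  \<comment> \<open>For \<open>\<bar>x\<bar> \<le> 2 * m n\<close> one has
    \<open>\<bar>\<theta> x\<bar> / m n \<le> a + b * 2\<close>; the 16 is the bound of
    \<open>bump'\<close>.\<close>
  define L where "L = (a + b * 2) * 16"
  have L0: "L \<ge> 0" using ab by (simp add: L_def)
  have L: "\<bar>\<theta> x * (bump' (x / m n) / m n)\<bar> \<le> L" for n x
  proof (cases "\<bar>x / m n\<bar> \<ge> 2")
    case True
    thus ?thesis using bump_outside(2)[OF True] L0 by simp
  next
    case False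
    have "\<bar>\<theta> x * (bump' (x / m n) / m n)\<bar> = \<bar>\<theta> x\<bar> / m n * \<bar>bump' (x / m n)\<bar>"
      using m(1)[of n] by (simp add: abs_mult)
    also have "\<dots> \<le> (a + b * 2) * 16"
    proof (intro mult_mono bump'_bound)
      have "\<bar>\<theta> x\<bar> / m n \<le> (a + b * \<bar>x\<bar>) / m n" using m(1)[of n] by (intro divide_right_mono \<theta>_growth) simp
      also have "\<dots> = a / m n + b * \<bar>x / m n\<bar>" using m(1)[of n] by (simp add: add_divide_distrib)
      also have "\<dots> \<le> a + b * 2"
      proof (intro add_mono mult_left_mono ab)
        show "a / m n \<le> a" using mult_left_mono[OF m(2)[of n] ab(1)] m(1)[of n] by (simp add: divide_le_eq)
        show "\<bar>x / m n\<bar> \<le> 2" using False by linarith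
      qed
      finally show "\<bar>\<theta> x\<bar> / m n \<le> a + b * 2" .
    qed (use ab in auto)
    finally show ?thesis by (simp add: L_def)
  qed
  have bc: "cmod (complex_of_real (bump y)) \<le> 1" for y using bump_bounds[of y] by simp
  have fK: "cmod (f n x) \<le> K1" for n x
    unfolding f_def norm_mult using mult_mono[OF K1[of x] bc[of "x / m n"]] K0 by simp
  have f'K: "cmod (\<theta> x * f' n x) \<le> K1 * L + K2" for n x
  proof -
    have "\<theta> x * f' n x = \<phi> x * complex_of_real (\<theta> x * (bump' (x / m n) / m n)) + (\<theta> x * \<phi>' x) * complex_of_real (bump (x / m n))"
      unfolding f'_def by (simp add: algebra_simps)
    also have "cmod \<dots> \<le> cmod (\<phi> x) * \<bar>\<theta> x * (bump' (x / m n) / m n)\<bar> + cmod (\<theta> x * \<phi>' x) * cmod (complex_of_real (bump (x / m n)))"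
      by (rule order_trans[OF norm_triangle_ineq]) (simp only: norm_mult norm_of_real order_refl)
    also have "\<dots> \<le> K1 * L + K2 * 1" by (intro add_mono mult_mono K1 K2 L bc K0 L0) auto
    finally show ?thesis by simp
  qed
  have com: "commutes_to (f n) (\<lambda>x. \<theta> x * f' n x)" for n
  proof (rule commutes_to_C1_compact[where r = "2 * m n", OF _ _ _ fK f'K])
    have sc: "((\<lambda>x. bump (x / m n)) has_real_derivative bump' (x / m n) / m n) (at x)" for x
    proof -
      have "((\<lambda>x. x / m n) has_real_derivative 1 / m n) (at x)" by (rule DERIV_cdivide[OF DERIV_ident])
      from DERIV_chain2[OF bump_derivative this] show ?thesis by simp
    qed
    show "(f n has_vector_derivative f' n x) (at x)" for x
      unfolding f_def f'_def
      by (intro has_vector_derivative_mult der has_vector_derivative_of_real sc)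
    have d: "continuous_on UNIV (\<lambda>x. x / m n)" using m(1)[of n] by (intro continuous_intros) simp
    have b: "continuous_on UNIV (\<lambda>x. bump (x / m n))" "continuous_on UNIV (\<lambda>x. bump' (x / m n))"
      by (rule continuous_on_compose2[OF continuous_bump d subset_UNIV]
          continuous_on_compose2[OF continuous_bump' d subset_UNIV])+
    have "m n \<noteq> 0" using m(1)[of n] by simp
    thus "continuous_on UNIV (f' n)"
      unfolding f'_def by (intro continuous_intros c c\<phi> b) auto
    show "f n x = 0" if "\<bar>x\<bar> > 2 * m n" for x
    proof -
      have "\<bar>x / m n\<bar> \<ge> 2" using that m(1)[of n] by (simp add: field_simps)
      thus ?thesis by (simp add: f_def bump_outside)
    qed
  qed
  have ev: "\<forall>\<^sub>F n in sequentially. \<bar>x / m n\<bar> \<le> 1" for x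
  proof -
    obtain N :: nat where N: "\<bar>x\<bar> < N" using reals_Archimedean2 by blast
    have "\<bar>x / m n\<bar> \<le> 1" if "n \<ge> N" for n using N that m(1)[of n] by (simp add: m_def field_simps)
    thus ?thesis by (auto simp: eventually_sequentially)
  qed
  show ?thesis
  proof (rule commutes_to_tendsto[OF com _ _ fK _ f'K])
    show "bounded_borel \<phi>" by (rule bounded_borelI[OF borel_measurable_continuous_onI[OF c\<phi>] K1])
    show "bounded_borel (\<lambda>x. \<theta> x * \<phi>' x)"
      by (rule bounded_borelI[OF borel_measurable_continuous_onI K2]) (intro continuous_intros \<theta>_cont c)
    show "(\<lambda>n. f n x) \<longlonglongrightarrow> \<phi> x" for x
      by (rule tendsto_eventually, rule eventually_mono[OF ev[of x]]) (simp add: f_def bump_inside)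
    show "(\<lambda>n. \<theta> x * f' n x) \<longlonglongrightarrow> \<theta> x * \<phi>' x" for x
      by (rule tendsto_eventually, rule eventually_mono[OF ev[of x]]) (simp add: f'_def bump_inside)
  qed
qed

end

section \<open>Square integrability of Fourier transforms\<close>

lemma borel_measurable_cnj [measurable (raw)]:
  "f \<in> borel_measurable M \<Longrightarrow> (\<lambda>x. cnj (f x)) \<in> borel_measurable M"
  by (rule measurable_compose[OF _ borel_measurable_continuous_onI[OF continuous_on_cnj[OF continuous_on_id]]])

lemma norm_integral_le_bound:
  fixes f :: "real \<Rightarrow> complex"
  assumes "finite_measure M" "\<And>x. cmod (f x) \<le> K" "K \<ge> 0"
  shows "cmod (integral\<^sup>L M f) \<le> K * measure M (space M)"
proof -
  interpret finite_measure M by fact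
  have "cmod (integral\<^sup>L M f) \<le> integral\<^sup>L M (\<lambda>x. cmod (f x))" by (rule integral_norm_bound)
  also have "\<dots> \<le> integral\<^sup>L M (\<lambda>x. K)"
    by (rule integral_mono') (use assms in auto)
  finally show ?thesis by (simp add: mult.commute)
qed

lemma has_vector_derivative_iff_quotient:
  fixes f :: "real \<Rightarrow> 'a::real_normed_vector"
  shows "(f has_vector_derivative D) (at t) \<longleftrightarrow> ((\<lambda>h. (1 / h) *\<^sub>R (f (t + h) - f t)) \<longlongrightarrow> D) (at 0)"
proof -
  have "norm (f (t + h) - f t - h *\<^sub>R D) / norm h = norm ((1 / h) *\<^sub>R (f (t + h) - f t) - D)"
    if "h \<noteq> 0" for h
  proof -
    have "(1 / h) *\<^sub>R (f (t + h) - f t) - D = (1 / h) *\<^sub>R (f (t + h) - f t - h *\<^sub>R D)"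
      using that by (simp add: scaleR_diff_right)
    thus ?thesis by (simp only: norm_scaleR) (simp add: divide_inverse)
  qed
  hence "((\<lambda>h. norm (f (t + h) - f t - h *\<^sub>R D) / norm h) \<longlongrightarrow> 0) (at 0) \<longleftrightarrow>
      ((\<lambda>h. norm ((1 / h) *\<^sub>R (f (t + h) - f t) - D)) \<longlongrightarrow> 0) (at 0)"
    by (intro filterlim_cong refl) (auto simp: eventually_at_filter)
  thus ?thesis
    unfolding has_vector_derivative_def has_derivative_at
    by (simp add: bounded_linear_scaleR_left tendsto_norm_zero_iff LIM_zero_iff)
qed

lemma integrable_normal:
  fixes f :: "real \<Rightarrow> 'b::{banach, second_countable_topology}"
  assumes "f \<in> borel_measurable borel" "\<And>t. norm (f t) \<le> B"
  shows "integrable std_normal_distribution f"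
proof -
  interpret N: real_distribution std_normal_distribution by (rule real_dist_normal_dist)
  show ?thesis by (rule N.integrable_const_bound[where B = B]) (use assms in auto)
qed

text \<open>Fubini moves the average over t inside, where it is the characteristic function of the
  standard normal distribution at \<open>s * (x - y)\<close>.\<close>

lemma gaussian_bilinear:
  fixes M N :: "real measure" and k l :: "real \<Rightarrow> complex"
  assumes M: "finite_measure M" "sets M = sets borel" and N: "finite_measure N" "sets N = sets borel"
    and k: "bounded_borel k" and l: "bounded_borel l"
  shows "(\<integral>t. (\<integral>x. k x * iexp (s * t * x) \<partial>M) * cnj (\<integral>y. l y * iexp (s * t * y) \<partial>N) \<partial>std_normal_distribution)
    = (\<integral>x. (\<integral>y. k x * cnj (l y) * complex_of_real (exp (- (s * (x - y))\<^sup>2 / 2)) \<partial>N) \<partial>M)"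
proof -
  let ?G = "std_normal_distribution"
  interpret M: finite_measure M by fact
  interpret N: finite_measure N by fact
  interpret G: real_distribution ?G by (rule real_dist_normal_dist)
  interpret MG: pair_sigma_finite M ?G ..
  interpret NG: pair_sigma_finite N ?G ..
  note [measurable_cong] = M(2) N(2)
  obtain K where K: "k \<in> borel_measurable borel" "\<And>x. cmod (k x) \<le> K" "K \<ge> 0" using bounded_borelE[OF k] by blast
  obtain L where L: "l \<in> borel_measurable borel" "\<And>x. cmod (l x) \<le> L" "L \<ge> 0" using bounded_borelE[OF l] by blast
  note [measurable] = K(1) L(1)
  define m where "m t = (\<integral>y. l y * iexp (s * t * y) \<partial>N)" for t
  have [measurable]: "m \<in> borel_measurable borel" unfolding m_def by measurable
  have mb: "cmod (m t) \<le> L * measure N (space N)" for t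
    unfolding m_def by (rule norm_integral_le_bound[OF N(1) _ L(3)]) (simp add: norm_mult L)
  have ib: "integrable (P \<Otimes>\<^sub>M ?G) (case_prod f)"
    if P: "finite_measure P" and m: "case_prod f \<in> borel_measurable (P \<Otimes>\<^sub>M ?G)" and b: "\<And>x t. cmod (f x t) \<le> B"
    for f :: "real \<Rightarrow> real \<Rightarrow> complex" and B and P :: "real measure"
  proof -
    interpret PG: finite_measure "P \<Otimes>\<^sub>M ?G"
      by (rule finite_measure_pair_measure[OF G.finite_measure_axioms P])
    show ?thesis by (rule PG.integrable_const_bound[OF _ m, of B]) (use b in auto)
  qed
  have "(\<integral>t. (\<integral>x. k x * iexp (s * t * x) \<partial>M) * cnj (m t) \<partial>?G) = (\<integral>t. (\<integral>x. k x * iexp (s * t * x) * cnj (m t) \<partial>M) \<partial>?G)"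
    by simp
  also have "\<dots> = (\<integral>x. (\<integral>t. k x * iexp (s * t * x) * cnj (m t) \<partial>?G) \<partial>M)"
  proof (rule MG.Fubini_integral, rule ib[OF M(1)])
    show "cmod (k x * iexp (s * t * x) * cnj (m t)) \<le> K * (L * measure N (space N))" for x t
      using mult_mono[OF K(2)[of x] mb[of t] K(3)] by (simp add: norm_mult)
  qed measurable
  also have "\<dots> = (\<integral>x. (\<integral>y. k x * cnj (l y) * complex_of_real (exp (- (s * (x - y))\<^sup>2 / 2)) \<partial>N) \<partial>M)"
  proof (rule Bochner_Integration.integral_cong[OF refl])
    fix x
    have "(\<integral>t. k x * iexp (s * t * x) * cnj (m t) \<partial>?G) = (\<integral>t. (\<integral>y. k x * cnj (l y) * iexp (s * (x - y) * t) \<partial>N) \<partial>?G)"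
    proof (rule Bochner_Integration.integral_cong[OF refl])
      fix t
      have "k x * iexp (s * t * x) * cnj (m t) = (\<integral>y. k x * iexp (s * t * x) * cnj (l y * iexp (s * t * y)) \<partial>N)"
        unfolding m_def by (simp del: complex_cnj_mult)
      also have "\<dots> = (\<integral>y. k x * cnj (l y) * iexp (s * (x - y) * t) \<partial>N)"
      proof (rule Bochner_Integration.integral_cong[OF refl])
        fix y
        have "iexp (s * t * x) * cnj (iexp (s * t * y)) = iexp (s * (x - y) * t)"
          by (simp add: exp_cnj exp_add[symmetric] algebra_simps)
        thus "k x * iexp (s * t * x) * cnj (l y * iexp (s * t * y)) = k x * cnj (l y) * iexp (s * (x - y) * t)"
          by (simp add: mult_ac)
      qed
      finally show "k x * iexp (s * t * x) * cnj (m t) = (\<integral>y. k x * cnj (l y) * iexp (s * (x - y) * t) \<partial>N)" .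
    qed
    also have "\<dots> = (\<integral>y. (\<integral>t. k x * cnj (l y) * iexp (s * (x - y) * t) \<partial>?G) \<partial>N)"
    proof (rule NG.Fubini_integral, rule ib[OF N(1)])
      show "cmod (k x * cnj (l y) * iexp (s * (x - y) * t)) \<le> K * L" for y t
        using mult_mono[OF K(2)[of x] L(2)[of y] K(3)] by (simp add: norm_mult)
    qed measurable
    also have "\<dots> = (\<integral>y. k x * cnj (l y) * complex_of_real (exp (- (s * (x - y))\<^sup>2 / 2)) \<partial>N)"
    proof (rule Bochner_Integration.integral_cong[OF refl])
      fix y
      have "(\<integral>t. iexp (s * (x - y) * t) \<partial>?G) = complex_of_real (exp (- (s * (x - y))\<^sup>2 / 2))"
        using char_std_normal_distribution unfolding char_def by meson
      thus "(\<integral>t. k x * cnj (l y) * iexp (s * (x - y) * t) \<partial>?G)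
          = k x * cnj (l y) * complex_of_real (exp (- (s * (x - y))\<^sup>2 / 2))" by simp
    qed
    finally show "(\<integral>t. k x * iexp (s * t * x) * cnj (m t) \<partial>?G)
        = (\<integral>y. k x * cnj (l y) * complex_of_real (exp (- (s * (x - y))\<^sup>2 / 2)) \<partial>N)" .
  qed
  finally show ?thesis unfolding m_def .
qed

text \<open>After rescaling, s times the Gaussian average of \<open>F (s * t)\<close> is the
  integral of F against \<open>\<rho> (t / s)\<close>, which tends to the positive constant
  \<open>\<rho> 0\<close> as s grows. Fatou's lemma recovers the integral of F, while
  \<open>\<rho> \<le> \<rho> 0\<close> bounds the side of G uniformly in s.\<close>

lemma integrable_of_gaussian_le:
  fixes F G :: "real \<Rightarrow> real"
  assumes F: "F \<in> borel_measurable borel" "\<And>t. 0 \<le> F t" "\<And>t. F t \<le> B"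
    and G: "integrable lborel G" "\<And>t. 0 \<le> G t" "\<And>t. G t \<le> B"
    and le: "\<And>s. s > 0 \<Longrightarrow> (\<integral>t. F (s * t) \<partial>std_normal_distribution) \<le> C * (\<integral>t. G (s * t) \<partial>std_normal_distribution)"
    and C: "C \<ge> 0"
  shows "integrable lborel F"
proof -
  let ?N = "std_normal_distribution"
  interpret N: real_distribution ?N by (rule real_dist_normal_dist)
  define \<rho> where "\<rho> = std_normal_density"
  have \<rho>: "\<rho> \<in> borel_measurable borel" "\<And>x. 0 \<le> \<rho> x" "\<And>x. \<rho> x \<le> \<rho> 0" "continuous_on UNIV \<rho>" "\<rho> 0 > 0"
    unfolding \<rho>_def std_normal_density_def by (auto intro!: continuous_intros divide_right_mono)
  have Gm: "G \<in> borel_measurable borel" using G(1) by (simp add: borel_measurable_integrable)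
  note [measurable] = F(1) Gm \<rho>(1)
  have scale: "(\<integral>\<^sup>+t. ennreal (H t) * ennreal (\<rho> (t / s)) \<partial>lborel) = ennreal s * ennreal (\<integral>t. H (s * t) \<partial>?N)"
    if s: "s > 0" and H: "H \<in> borel_measurable borel" "\<And>t. 0 \<le> H t" "\<And>t. H t \<le> B" for H s
  proof -
    note [measurable] = H(1)
    have "integrable ?N (\<lambda>t. H (s * t))"
      by (rule N.integrable_const_bound[where B = B]) (use H in auto)
    hence "ennreal (\<integral>t. H (s * t) \<partial>?N) = (\<integral>\<^sup>+t. ennreal (H (s * t)) \<partial>?N)"
      using H(2) by (intro nn_integral_eq_integral[symmetric]) auto
    also have "\<dots> = (\<integral>\<^sup>+t. ennreal (\<rho> t) * ennreal (H (s * t)) \<partial>lborel)"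
      unfolding \<rho>_def by (rule nn_integral_density) auto
    also have "\<dots> = \<bar>1 / s\<bar> * (\<integral>\<^sup>+t. ennreal (\<rho> (0 + 1 / s * t)) * ennreal (H (s * (0 + 1 / s * t))) \<partial>lborel)"
      using s by (intro nn_integral_real_affine) auto
    also have "(\<lambda>t. ennreal (\<rho> (0 + 1 / s * t)) * ennreal (H (s * (0 + 1 / s * t)))) = (\<lambda>t. ennreal (H t) * ennreal (\<rho> (t / s)))"
      using s by (simp add: mult.commute)
    finally have "ennreal s * ennreal (\<integral>t. H (s * t) \<partial>?N) = (ennreal s * ennreal \<bar>1 / s\<bar>) * (\<integral>\<^sup>+t. ennreal (H t) * ennreal (\<rho> (t / s)) \<partial>lborel)"
      by (simp add: mult.assoc)
    also have "ennreal s * ennreal \<bar>1 / s\<bar> = 1" using s by (simp add: ennreal_mult[symmetric])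
    finally show ?thesis by simp
  qed
  have step: "(\<integral>\<^sup>+t. ennreal (F t) * ennreal (\<rho> (t / s)) \<partial>lborel) \<le> ennreal C * (ennreal (\<rho> 0) * (\<integral>\<^sup>+t. ennreal (G t) \<partial>lborel))"
    if s: "s > 0" for s
  proof -
    have Gp: "(\<integral>t. G (s * t) \<partial>?N) \<ge> 0" using G(2) by (intro integral_nonneg_AE) auto
    have "(\<integral>\<^sup>+t. ennreal (F t) * ennreal (\<rho> (t / s)) \<partial>lborel) = ennreal s * ennreal (\<integral>t. F (s * t) \<partial>?N)"
      by (rule scale[OF s F])
    also have "\<dots> \<le> ennreal s * ennreal (C * (\<integral>t. G (s * t) \<partial>?N))"
      by (intro mult_left_mono ennreal_leI le s) simp
    also have "\<dots> = ennreal C * (ennreal s * ennreal (\<integral>t. G (s * t) \<partial>?N))"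
      using C Gp by (simp add: ennreal_mult mult_ac)
    also have "ennreal s * ennreal (\<integral>t. G (s * t) \<partial>?N) = (\<integral>\<^sup>+t. ennreal (G t) * ennreal (\<rho> (t / s)) \<partial>lborel)"
      by (rule scale[OF s Gm G(2,3), symmetric])
    also have "\<dots> \<le> (\<integral>\<^sup>+t. ennreal (\<rho> 0) * ennreal (G t) \<partial>lborel)"
      using \<rho>(3) by (intro nn_integral_mono) (auto simp: mult.commute intro!: mult_left_mono ennreal_leI)
    also have "\<dots> = ennreal (\<rho> 0) * (\<integral>\<^sup>+t. ennreal (G t) \<partial>lborel)" by (rule nn_integral_cmult) auto
    finally show ?thesis by (simp add: mult_left_mono)
  qed
  define D where "D = ennreal C * (ennreal (\<rho> 0) * (\<integral>\<^sup>+t. ennreal (G t) \<partial>lborel))"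
  have Dfin: "D < \<infinity>" unfolding D_def using G(1,2) by (simp add: nn_integral_eq_integral ennreal_mult_less_top)
  have lim: "(\<lambda>n. ennreal (F t) * ennreal (\<rho> (t / real (Suc n)))) \<longlonglongrightarrow> ennreal (F t) * ennreal (\<rho> 0)" for t
  proof -
    have "(\<lambda>n. t * (1 / real (Suc n))) \<longlonglongrightarrow> t * 0" by (intro tendsto_mult tendsto_const LIMSEQ_Suc[OF lim_1_over_n])
    hence "(\<lambda>n. t / real (Suc n)) \<longlonglongrightarrow> 0" by simp
    moreover have "isCont \<rho> 0" using \<rho>(4) by (simp add: continuous_on_eq_continuous_at)
    ultimately have "(\<lambda>n. \<rho> (t / real (Suc n))) \<longlonglongrightarrow> \<rho> 0" by (rule isCont_tendsto_compose[rotated])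
    hence "(\<lambda>n. F t * \<rho> (t / real (Suc n))) \<longlonglongrightarrow> F t * \<rho> 0" by (intro tendsto_mult tendsto_const)
    hence "(\<lambda>n. ennreal (F t * \<rho> (t / real (Suc n)))) \<longlonglongrightarrow> ennreal (F t * \<rho> 0)" by (rule tendsto_ennrealI)
    thus ?thesis using F(2) \<rho>(2) by (simp add: ennreal_mult)
  qed
  have "(\<integral>\<^sup>+t. ennreal (F t) * ennreal (\<rho> 0) \<partial>lborel) = (\<integral>\<^sup>+t. liminf (\<lambda>n. ennreal (F t) * ennreal (\<rho> (t / real (Suc n)))) \<partial>lborel)"
    using lim_imp_Liminf[OF sequentially_bot lim] by simp
  also have "\<dots> \<le> liminf (\<lambda>n. \<integral>\<^sup>+t. ennreal (F t) * ennreal (\<rho> (t / real (Suc n))) \<partial>lborel)"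
    by (rule nn_integral_liminf) measurable
  also have "\<dots> \<le> D"
  proof -
    have "liminf (\<lambda>n. \<integral>\<^sup>+t. ennreal (F t) * ennreal (\<rho> (t / real (Suc n))) \<partial>lborel) \<le> liminf (\<lambda>n::nat. D)"
      by (intro Liminf_mono always_eventually allI) (simp only: D_def, rule step, simp)
    thus ?thesis by (simp add: Liminf_const)
  qed
  finally have "(\<integral>\<^sup>+t. ennreal (F t) \<partial>lborel) * ennreal (\<rho> 0) < \<infinity>"
    using Dfin by (simp add: nn_integral_multc)
  hence "(\<integral>\<^sup>+t. ennreal (F t) \<partial>lborel) < \<infinity>" using \<rho>(5) by (auto simp: ennreal_mult_less_top ennreal_mult_eq_top_iff less_top)
  thus ?thesis using F(2) by (intro integrableI_nonneg) auto
qed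

section \<open>Fourier transforms of the scalar measures\<close>

context pvm
begin

text \<open>The Fourier-Stieltjes transform of k times \<open>mu w\<close>. The functions q of the
  overview are \<open>ft f u\<close>, and \<open>psi\<close> is the case
  \<open>k = 1\<close>.\<close>

definition ft :: "(real \<Rightarrow> complex) \<Rightarrow> 'a \<Rightarrow> real \<Rightarrow> complex" where
  "ft k w t = (\<integral>x. k x * iexp (t * x) \<partial>mu w)"

lemma bounded_borel_iexp: "bounded_borel (\<lambda>x. iexp (t * x))"
  by (rule bounded_borelI[where K = 1]) auto

lemma ft_Phi:
  assumes "bounded_borel k"
  shows "ft k w t = cinner w (Phi (\<lambda>x. k x * iexp (t * x)) w)"
  unfolding ft_def using assms by (intro Phi_integral[symmetric] bounded_borel_mult bounded_borel_iexp)

lemma ft_bound: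
  assumes "\<And>x. cmod (k x) \<le> K" "K \<ge> 0"
  shows "cmod (ft k w t) \<le> K * (norm w)\<^sup>2"
proof -
  have "cmod (ft k w t) \<le> K * measure (mu w) (space (mu w))"
    unfolding ft_def by (rule norm_integral_le_bound[OF finite_measure_mu _ assms(2)]) (simp add: norm_mult assms)
  thus ?thesis by (simp add: measure_mu)
qed

lemma ft_measurable:
  assumes "bounded_borel k" shows "ft k w \<in> borel_measurable borel"
proof -
  interpret finite_measure "mu w" by (rule finite_measure_mu)
  note [measurable] = bounded_borel_meas[OF assms]
  show ?thesis unfolding ft_def by measurable
qed

text \<open>The Gaussian average of \<open>|ft k w|\<^sup>2\<close> is a double integral against a positive kernel, hence
  monotone in the measure; this takes the place of Plancherel's theorem.\<close>

definition gauss :: "real \<Rightarrow> 'a \<Rightarrow> 'a \<Rightarrow> real" where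
  "gauss s v w = (\<integral>x. (\<integral>y. exp (- (s * (x - y))\<^sup>2 / 2) \<partial>mu w) \<partial>mu v)"

lemma integrable_mu_real:
  fixes f :: "real \<Rightarrow> real"
  assumes "f \<in> borel_measurable borel" "\<And>x. \<bar>f x\<bar> \<le> K"
  shows "integrable (mu v) f"
  by (rule finite_measure.integrable_const_bound[OF finite_measure_mu, where B = K])
    (use assms in \<open>auto simp: measurable_cong_sets[OF sets_mu refl]\<close>)

lemma gauss_inner:
  "(\<lambda>x. \<integral>y. exp (- (s * (x - y))\<^sup>2 / 2) \<partial>mu w) \<in> borel_measurable borel"
  "0 \<le> (\<integral>y. exp (- (s * (x - y))\<^sup>2 / 2) \<partial>mu w)"
  "(\<integral>y. exp (- (s * (x - y))\<^sup>2 / 2) \<partial>mu w) \<le> (norm w)\<^sup>2"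
proof -
  interpret finite_measure "mu w" by (rule finite_measure_mu)
  show "(\<lambda>x. \<integral>y. exp (- (s * (x - y))\<^sup>2 / 2) \<partial>mu w) \<in> borel_measurable borel" by measurable
  show "0 \<le> (\<integral>y. exp (- (s * (x - y))\<^sup>2 / 2) \<partial>mu w)" by simp
  have "(\<integral>y. exp (- (s * (x - y))\<^sup>2 / 2) \<partial>mu w) \<le> (\<integral>y. 1 \<partial>mu w)"
    by (rule integral_mono') auto
  thus "(\<integral>y. exp (- (s * (x - y))\<^sup>2 / 2) \<partial>mu w) \<le> (norm w)\<^sup>2" by (simp add: measure_mu)
qed

lemma gauss_eq:
  "complex_of_real (gauss s v w) = (\<integral>t. ft (\<lambda>_. 1) v (s * t) * cnj (ft (\<lambda>_. 1) w (s * t)) \<partial>std_normal_distribution)"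
  unfolding ft_def
  by (subst gaussian_bilinear[OF finite_measure_mu sets_mu finite_measure_mu sets_mu])
    (simp_all add: gauss_def integral_complex_of_real)

lemma integrable_ft_sq:
  assumes "bounded_borel k" shows "integrable std_normal_distribution (\<lambda>t. (cmod (ft k w (s * t)))\<^sup>2)"
proof -
  note [measurable] = ft_measurable[OF assms, of w]
  obtain K where K: "\<And>x. cmod (k x) \<le> K" "K \<ge> 0" using bounded_borelE[OF assms] by blast
  show ?thesis
    by (rule integrable_normal[where B = "(K * (norm w)\<^sup>2)\<^sup>2"])
      (auto intro!: power_mono ft_bound K)
qed

lemma gauss_diag:
  "gauss s w w = (\<integral>t. (cmod (ft (\<lambda>_. 1) w (s * t)))\<^sup>2 \<partial>std_normal_distribution)"
proof -
  have "complex_of_real (gauss s w w) = (\<integral>t. complex_of_real ((cmod (ft (\<lambda>_. 1) w (s * t)))\<^sup>2) \<partial>std_normal_distribution)"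
    unfolding gauss_eq complex_norm_square ..
  thus ?thesis unfolding integral_complex_of_real of_real_eq_iff .
qed

text \<open>On the Fourier side the mixed term is the average of a product, so that
  \<open>2 * a * b \<le> a\<^sup>2 + b\<^sup>2\<close> applies pointwise.\<close>

lemma gauss_off_diag: "gauss s v w \<le> (gauss s v v + gauss s w w) / 2"
proof -
  let ?v = "\<lambda>t. ft (\<lambda>_. 1) v (s * t)" and ?w = "\<lambda>t. ft (\<lambda>_. 1) w (s * t)"
  have 1: "bounded_borel (\<lambda>_. 1)" by simp
  have "gauss s v w \<le> cmod (complex_of_real (gauss s v w))" by simp
  also have "\<dots> \<le> (\<integral>t. cmod (?v t * cnj (?w t)) \<partial>std_normal_distribution)"
    unfolding gauss_eq by (rule integral_norm_bound)
  also have "\<dots> \<le> (\<integral>t. ((cmod (?v t))\<^sup>2 + (cmod (?w t))\<^sup>2) / 2 \<partial>std_normal_distribution)"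
  proof (rule integral_mono')
    show "integrable std_normal_distribution (\<lambda>t. ((cmod (?v t))\<^sup>2 + (cmod (?w t))\<^sup>2) / 2)"
      by (intro integrable_divide Bochner_Integration.integrable_add integrable_ft_sq 1)
    show "cmod (?v t * cnj (?w t)) \<le> ((cmod (?v t))\<^sup>2 + (cmod (?w t))\<^sup>2) / 2" for t
      using zero_le_power2[of "cmod (?v t) - cmod (?w t)"] by (simp add: norm_mult power2_diff)
  qed simp
  also have "\<dots> = (gauss s v v + gauss s w w) / 2"
    unfolding gauss_diag by (simp add: Bochner_Integration.integral_add integrable_ft_sq)
  finally show ?thesis .
qed

text \<open>The integral of f is the squared norm of \<open>Phi\<close> applied to the square root
  of f, which is subject to the triangle inequality; no mixed measure appears.\<close>

lemma integral_mu_add_le: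
  fixes f :: "real \<Rightarrow> real"
  assumes f: "f \<in> borel_measurable borel" "\<And>x. 0 \<le> f x" "\<And>x. f x \<le> K"
  shows "(\<integral>x. f x \<partial>mu (u + v)) \<le> 2 * (\<integral>x. f x \<partial>mu u) + 2 * (\<integral>x. f x \<partial>mu v)"
proof -
  define g where "g x = complex_of_real (sqrt (f x))" for x
  have g: "bounded_borel g"
  proof (rule bounded_borelI[where K = "sqrt K"])
    note [measurable] = f(1)
    show "g \<in> borel_measurable borel" unfolding g_def by measurable
  qed (use f in \<open>auto simp: g_def\<close>)
  have i: "(\<integral>x. f x \<partial>mu w) = (norm (Phi g w))\<^sup>2" for w
    unfolding Phi_norm[OF g] using f(2) by (simp add: g_def)
  have "norm (Phi g (u + v)) \<le> norm (Phi g u) + norm (Phi g v)"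
    unfolding Phi_linear(1)[OF g] by (rule norm_triangle_ineq)
  hence "(norm (Phi g (u + v)))\<^sup>2 \<le> (norm (Phi g u) + norm (Phi g v))\<^sup>2" by (intro power_mono) auto
  also have "\<dots> \<le> 2 * (norm (Phi g u))\<^sup>2 + 2 * (norm (Phi g v))\<^sup>2"
    using zero_le_power2[of "norm (Phi g u) - norm (Phi g v)"] by (simp add: power2_sum power2_diff)
  finally show ?thesis unfolding i .
qed

text \<open>Splitting each of the two measures costs a factor 2, so all four terms occur with factor
  4; the two mixed ones together are at most the sum of the diagonal ones, which brings 4 to
  8.\<close>

lemma gauss_add_le: "gauss s (u + v) (u + v) \<le> 8 * (gauss s u u + gauss s v v)"
proof -
  let ?k = "\<lambda>x y. exp (- (s * (x - y))\<^sup>2 / 2)"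
  have k: "(\<lambda>y. ?k x y) \<in> borel_measurable borel" "0 \<le> ?k x y" "?k x y \<le> 1" for x y by auto
  have int: "integrable (mu w) (\<lambda>x. \<integral>y. ?k x y \<partial>mu w')" for w w'
    by (rule integrable_mu_real[OF gauss_inner(1)]) (use gauss_inner(2,3) in \<open>simp add: abs_of_nonneg\<close>)
  have "gauss s (u + v) (u + v) \<le> (\<integral>x. 2 * (\<integral>y. ?k x y \<partial>mu u) + 2 * (\<integral>y. ?k x y \<partial>mu v) \<partial>mu (u + v))"
    unfolding gauss_def
    by (intro integral_mono int Bochner_Integration.integrable_add integrable_mult_right integral_mu_add_le[OF k])
  also have "\<dots> = 2 * gauss s (u + v) u + 2 * gauss s (u + v) v"
    unfolding gauss_def
    by (subst Bochner_Integration.integral_add[OF integrable_mult_right[OF int] integrable_mult_right[OF int]]) simp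
  finally have 1: "gauss s (u + v) (u + v) \<le> 2 * gauss s (u + v) u + 2 * gauss s (u + v) v" .
  have 2: "gauss s (u + v) u \<le> 2 * gauss s u u + 2 * gauss s v u"
    unfolding gauss_def by (rule integral_mu_add_le[OF gauss_inner])
  have 3: "gauss s (u + v) v \<le> 2 * gauss s u v + 2 * gauss s v v"
    unfolding gauss_def by (rule integral_mu_add_le[OF gauss_inner])
  show ?thesis using 1 2 3 gauss_off_diag[of s u v] gauss_off_diag[of s v u] by argo
qed

text \<open>Because the Gaussian kernel is nonnegative, the weight \<open>k x * cnj (k y)\<close>
  may be replaced by its bound \<open>K\<^sup>2\<close> inside the double integral. This is why
  bounded multipliers preserve square integrability.\<close>

lemma ft_gauss_le:
  assumes k: "bounded_borel k" "\<And>x. cmod (k x) \<le> K" "K \<ge> 0"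
  shows "(\<integral>t. (cmod (ft k w (s * t)))\<^sup>2 \<partial>std_normal_distribution) \<le> K\<^sup>2 * gauss s w w"
proof -
  interpret finite_measure "mu w" by (rule finite_measure_mu)
  let ?e = "\<lambda>x y. exp (- (s * (x - y))\<^sup>2 / 2)"
  let ?f = "\<lambda>x y. k x * cnj (k y) * complex_of_real (?e x y)"
  note [measurable] = bounded_borel_meas[OF k(1)]
  have b: "cmod (?f x y) \<le> K\<^sup>2 * ?e x y" for x y
    unfolding norm_mult power2_eq_square complex_mod_cnj
    by (intro mult_mono k) (auto intro: k(3))
  have ie: "integrable (mu w) (\<lambda>y. ?e x y)" for x by (rule integrable_mu_real[where K = 1]) auto
  have inner: "cmod (\<integral>y. ?f x y \<partial>mu w) \<le> K\<^sup>2 * (\<integral>y. ?e x y \<partial>mu w)" for x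
  proof -
    have "cmod (\<integral>y. ?f x y \<partial>mu w) \<le> (\<integral>y. cmod (?f x y) \<partial>mu w)" by (rule integral_norm_bound)
    also have "\<dots> \<le> (\<integral>y. K\<^sup>2 * ?e x y \<partial>mu w)"
      by (rule integral_mono') (use b ie in auto)
    finally show ?thesis by simp
  qed
  have "complex_of_real (\<integral>t. (cmod (ft k w (s * t)))\<^sup>2 \<partial>std_normal_distribution)
      = (\<integral>t. ft k w (s * t) * cnj (ft k w (s * t)) \<partial>std_normal_distribution)"
    unfolding complex_norm_square[symmetric] by (rule integral_complex_of_real[symmetric])
  also have "\<dots> = (\<integral>x. (\<integral>y. ?f x y \<partial>mu w) \<partial>mu w)"
    unfolding ft_def by (rule gaussian_bilinear[OF finite_measure_mu sets_mu finite_measure_mu sets_mu k(1) k(1)])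
  finally have e: "complex_of_real (\<integral>t. (cmod (ft k w (s * t)))\<^sup>2 \<partial>std_normal_distribution)
      = (\<integral>x. (\<integral>y. ?f x y \<partial>mu w) \<partial>mu w)" .
  have "(\<integral>t. (cmod (ft k w (s * t)))\<^sup>2 \<partial>std_normal_distribution)
      \<le> cmod (complex_of_real (\<integral>t. (cmod (ft k w (s * t)))\<^sup>2 \<partial>std_normal_distribution))" by simp
  also have "\<dots> \<le> (\<integral>x. cmod (\<integral>y. ?f x y \<partial>mu w) \<partial>mu w)" unfolding e by (rule integral_norm_bound)
  also have "\<dots> \<le> (\<integral>x. K\<^sup>2 * (\<integral>y. ?e x y \<partial>mu w) \<partial>mu w)"
  proof (rule integral_mono'[OF _ inner])
    show "integrable (mu w) (\<lambda>x. K\<^sup>2 * (\<integral>y. ?e x y \<partial>mu w))"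
      by (intro integrable_mult_right integrable_mu_real[OF gauss_inner(1)])
        (use gauss_inner(2,3) in \<open>simp add: abs_of_nonneg\<close>)
  qed (use gauss_inner(2) in simp)
  also have "\<dots> = K\<^sup>2 * gauss s w w" by (simp add: gauss_def)
  finally show ?thesis .
qed

text \<open>Two stability properties in one: sums of vectors, as needed for
  \<open>u + \<i> *\<^sub>C (A \<cdot> u)\<close>, and insertion of a bounded function of H. The
  comparison of Gaussian averages is turned into integrability with constant
  \<open>8 * K\<^sup>2\<close>.\<close>

lemma integrable_ft_sq_add:
  assumes u: "integrable lborel (\<lambda>t. (cmod (ft (\<lambda>_. 1) u t))\<^sup>2)"
    and v: "integrable lborel (\<lambda>t. (cmod (ft (\<lambda>_. 1) v t))\<^sup>2)" and k: "bounded_borel k"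
  shows "integrable lborel (\<lambda>t. (cmod (ft k (u + v) t))\<^sup>2)"
proof -
  obtain K where K: "\<And>x. cmod (k x) \<le> K" "K \<ge> 0" using bounded_borelE[OF k] by blast
  define B where "B = max ((K * (norm (u + v))\<^sup>2)\<^sup>2) ((1 * (norm u)\<^sup>2)\<^sup>2 + (1 * (norm v)\<^sup>2)\<^sup>2)"
  have 1: "bounded_borel (\<lambda>_. 1)" by simp
  have sq: "(cmod (ft l w t))\<^sup>2 \<le> (L * (norm w)\<^sup>2)\<^sup>2" if "\<And>x. cmod (l x) \<le> L" "L \<ge> 0"
    for l :: "real \<Rightarrow> complex" and L w t
    by (intro power_mono ft_bound that) simp
  note [measurable] = ft_measurable[OF k]
  show ?thesis
  proof (rule integrable_of_gaussian_le[where B = B and C = "8 * K\<^sup>2"])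
    show "integrable lborel (\<lambda>t. (cmod (ft (\<lambda>_. 1) u t))\<^sup>2 + (cmod (ft (\<lambda>_. 1) v t))\<^sup>2)"
      by (intro Bochner_Integration.integrable_add u v)
    show "(cmod (ft k (u + v) t))\<^sup>2 \<le> B" for t
      using sq[OF K, where w = "u + v"] unfolding B_def by (rule max.coboundedI1)
    show "(cmod (ft (\<lambda>_. 1) u t))\<^sup>2 + (cmod (ft (\<lambda>_. 1) v t))\<^sup>2 \<le> B" for t
      unfolding B_def by (intro max.coboundedI2 add_mono sq) simp_all
    show "(\<integral>t. (cmod (ft k (u + v) (s * t)))\<^sup>2 \<partial>std_normal_distribution) \<le>
       8 * K\<^sup>2 * (\<integral>t. (cmod (ft (\<lambda>_. 1) u (s * t)))\<^sup>2 + (cmod (ft (\<lambda>_. 1) v (s * t)))\<^sup>2 \<partial>std_normal_distribution)" for s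
    proof -
      have "(\<integral>t. (cmod (ft k (u + v) (s * t)))\<^sup>2 \<partial>std_normal_distribution) \<le> K\<^sup>2 * gauss s (u + v) (u + v)"
        by (rule ft_gauss_le[OF k K])
      also have "\<dots> \<le> K\<^sup>2 * (8 * (gauss s u u + gauss s v v))" by (intro mult_left_mono gauss_add_le) simp
      also have "gauss s u u + gauss s v v = (\<integral>t. (cmod (ft (\<lambda>_. 1) u (s * t)))\<^sup>2 + (cmod (ft (\<lambda>_. 1) v (s * t)))\<^sup>2 \<partial>std_normal_distribution)"
        unfolding gauss_diag by (rule Bochner_Integration.integral_add[symmetric]) (intro integrable_ft_sq 1)+
      finally show ?thesis by (simp add: mult_ac)
    qed
  qed (use K(2) in auto)
qed

lemma ft_zero: "bounded_borel k \<Longrightarrow> ft k 0 t = 0"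
  by (simp add: ft_Phi)

lemma integrable_ft_sq_single:
  assumes "integrable lborel (\<lambda>t. (cmod (ft (\<lambda>_. 1) u t))\<^sup>2)" "bounded_borel k"
  shows "integrable lborel (\<lambda>t. (cmod (ft k u t))\<^sup>2)"
  using integrable_ft_sq_add[OF assms(1) _ assms(2), of 0] by (simp add: ft_zero)

text \<open>The scalar measure depends on norms only. This passes from \<open>A \<cdot> u\<close> to
  i times it.\<close>

lemma ft_unimodular:
  assumes "cmod c = 1" shows "ft k (c *\<^sub>C w) t = ft k w t"
proof -
  have "mu (c *\<^sub>C w) = mu w"
    by (rule measure_eqI) (auto simp: emeasure_mu E_scaleC norm_scaleC assms)
  thus ?thesis by (simp add: ft_def)
qed

lemma ft_has_derivative:
  fixes k :: "real \<Rightarrow> complex"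
  assumes k: "bounded_borel k" and xk: "bounded_borel (\<lambda>x. x * k x)"
  shows "(ft k w has_vector_derivative \<i> * ft (\<lambda>x. x * k x) w t) (at t)"
proof -
  note [measurable] = bounded_borel_meas[OF k] bounded_borel_meas[OF xk]
  interpret finite_measure "mu w" by (rule finite_measure_mu)
  obtain K where K: "\<And>x. cmod (x * k x) \<le> K" "K \<ge> 0" using bounded_borelE[OF xk] by blast
  have int: "integrable (mu w) (\<lambda>x. k x * iexp (t * x))" for t
    by (intro integrable_mu bounded_borel_mult k bounded_borel_iexp)
  have "((\<lambda>h. (1 / h) *\<^sub>R (ft k w (t + h) - ft k w t)) \<longlongrightarrow> \<i> * ft (\<lambda>x. x * k x) w t) (at 0)"
  proof (subst tendsto_at_iff_sequentially, intro allI impI)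
    fix h :: "nat \<Rightarrow> real" assume h: "\<forall>i. h i \<in> UNIV - {0}" "h \<longlonglongrightarrow> 0"
    have h0: "h i \<noteq> 0" for i using h(1) by auto
    have d: "(1 / h i) *\<^sub>R (ft k w (t + h i) - ft k w t)
       = (\<integral>x. k x * iexp (t * x) * ((1 / h i) *\<^sub>R (iexp (h i * x) - 1)) \<partial>mu w)" for i
    proof -
      have "ft k w (t + h i) - ft k w t = (\<integral>x. k x * iexp ((t + h i) * x) - k x * iexp (t * x) \<partial>mu w)"
        unfolding ft_def by (rule Bochner_Integration.integral_diff[symmetric]) (rule int)+
      hence "(1 / h i) *\<^sub>R (ft k w (t + h i) - ft k w t) = (\<integral>x. (1 / h i) *\<^sub>R (k x * iexp ((t + h i) * x) - k x * iexp (t * x)) \<partial>mu w)"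
        by simp
      also have "\<dots> = (\<integral>x. k x * iexp (t * x) * ((1 / h i) *\<^sub>R (iexp (h i * x) - 1)) \<partial>mu w)"
      proof (rule Bochner_Integration.integral_cong[OF refl])
        fix x
        have "iexp ((t + h i) * x) = iexp (t * x) * iexp (h i * x)"
          by (simp add: exp_add[symmetric] algebra_simps)
        thus "(1 / h i) *\<^sub>R (k x * iexp ((t + h i) * x) - k x * iexp (t * x)) = k x * iexp (t * x) * ((1 / h i) *\<^sub>R (iexp (h i * x) - 1))"
          by (simp add: scaleR_conv_of_real algebra_simps)
      qed
      finally show ?thesis .
    qed
    have "(\<lambda>i. \<integral>x. k x * iexp (t * x) * ((1 / h i) *\<^sub>R (iexp (h i * x) - 1)) \<partial>mu w) \<longlonglongrightarrow>
        (\<integral>x. k x * iexp (t * x) * (\<i> * x) \<partial>mu w)"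
    proof (rule integral_dominated_convergence[where w = "\<lambda>x. K"])
      show "AE x in mu w. (\<lambda>i. k x * iexp (t * x) * ((1 / h i) *\<^sub>R (iexp (h i * x) - 1))) \<longlonglongrightarrow> k x * iexp (t * x) * (\<i> * x)"
      proof (intro AE_I2 tendsto_mult tendsto_const)
        fix x
        have "((\<lambda>s. iexp (s * x)) has_vector_derivative (\<i> * x) * iexp (0 * x)) (at 0)"
        proof -
          have "((\<lambda>s. exp (\<i> * x * s)) has_field_derivative (\<i> * x) * exp (\<i> * x * complex_of_real 0)) (at (complex_of_real 0))"
            by (auto intro!: derivative_eq_intros)
          from has_vector_derivative_real_field[OF this] show ?thesis by (simp add: mult_ac)
        qed
        hence "((\<lambda>s. (1 / s) *\<^sub>R (iexp (s * x) - 1)) \<longlongrightarrow> \<i> * x) (at 0)"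
          unfolding has_vector_derivative_iff_quotient by simp
        thus "(\<lambda>i. (1 / h i) *\<^sub>R (iexp (h i * x) - 1)) \<longlonglongrightarrow> \<i> * x"
          using h unfolding tendsto_at_iff_sequentially by (auto simp: o_def)
      qed
      show "AE x in mu w. norm (k x * iexp (t * x) * ((1 / h i) *\<^sub>R (iexp (h i * x) - 1))) \<le> K" for i
      proof (rule AE_I2)
        fix x
        \<comment> \<open>This estimate dominates the difference quotient by the modulus of
          \<open>x * k x\<close>, uniformly in the step.\<close>
        have "cmod (iexp (h i * x) - 1) \<le> \<bar>h i * x\<bar>" using iexp_approx1[of "h i * x" 0] by simp
        hence "\<bar>1 / h i\<bar> * cmod (iexp (h i * x) - 1) \<le> \<bar>1 / h i\<bar> * \<bar>h i * x\<bar>" by (intro mult_left_mono) auto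
        also have "\<dots> = \<bar>x\<bar>" using h0[of i] by (simp add: abs_mult)
        finally have "cmod (k x) * (\<bar>1 / h i\<bar> * cmod (iexp (h i * x) - 1)) \<le> cmod (k x) * \<bar>x\<bar>" by (intro mult_left_mono) auto
        also have "\<dots> \<le> K" using K(1)[of x] by (simp add: norm_mult mult.commute)
        finally show "norm (k x * iexp (t * x) * ((1 / h i) *\<^sub>R (iexp (h i * x) - 1))) \<le> K"
          by (simp only: norm_mult norm_scaleR norm_exp_i_times mult_1_right)
      qed
    qed auto
    moreover have "(\<integral>x. k x * iexp (t * x) * (\<i> * x) \<partial>mu w) = \<i> * ft (\<lambda>x. x * k x) w t"
    proof -
      have "\<i> * ft (\<lambda>x. x * k x) w t = (\<integral>x. \<i> * (x * k x * iexp (t * x)) \<partial>mu w)" unfolding ft_def by simp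
      also have "\<dots> = (\<integral>x. k x * iexp (t * x) * (\<i> * x) \<partial>mu w)"
        by (rule Bochner_Integration.integral_cong[OF refl]) (simp add: mult_ac)
      finally show ?thesis by simp
    qed
    ultimately show "((\<lambda>h. (1 / h) *\<^sub>R (ft k w (t + h) - ft k w t)) \<circ> h) \<longlonglongrightarrow> \<i> * ft (\<lambda>x. x * k x) w t"
      unfolding o_def d by simp
  qed
  thus ?thesis unfolding has_vector_derivative_iff_quotient .
qed

end

section \<open>Decay\<close>

text \<open>The derivative of \<open>t |F t|\<^sup>2\<close> is bounded by the integrable function \<open>2 |F|\<^sup>2 + |t F'|\<^sup>2\<close>.\<close>

lemma square_decay:
  fixes F F' G :: "real \<Rightarrow> complex"
  assumes der: "\<And>t. (F has_vector_derivative F' t) (at t)" and G: "\<And>t. complex_of_real t * F' t = G t"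
    and iF: "integrable lborel (\<lambda>t. (cmod (F t))\<^sup>2)" and iG: "integrable lborel (\<lambda>t. (cmod (G t))\<^sup>2)"
  shows "\<exists>C\<ge>0. \<forall>t\<ge>0. t * (cmod (F t))\<^sup>2 \<le> C"
proof -
  define S where "S t = 2 * (cmod (F t))\<^sup>2 + (cmod (G t))\<^sup>2" for t
  have "integrable lborel S" unfolding S_def by (intro Bochner_Integration.integrable_add integrable_mult_right iF iG)
  hence iS: "S integrable_on UNIV" by (rule integrable_on_lborel)
  have S0: "S t \<ge> 0" for t by (simp add: S_def)
  have "t * (cmod (F t))\<^sup>2 \<le> integral UNIV S" if t: "t \<ge> 0" for t
  proof -
    define h where "h s = s * (F s \<bullet> F s)" for s
    define h' where "h' s = F s \<bullet> F s + s * (2 * (F s \<bullet> F' s))" for s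
    have hd: "(h has_vector_derivative h' s) (at s within {0..t})" for s
    proof -
      have "((\<lambda>s. F s \<bullet> F s) has_vector_derivative (F s \<bullet> F' s + F' s \<bullet> F s)) (at s)"
        by (rule bounded_bilinear.has_vector_derivative[OF bounded_bilinear_inner der der])
      from has_vector_derivative_mult[OF has_vector_derivative_id this]
      have "((\<lambda>s. s * (F s \<bullet> F s)) has_vector_derivative (s * (F s \<bullet> F' s + F' s \<bullet> F s) + 1 * (F s \<bullet> F s))) (at s)"
        by simp
      hence "(h has_vector_derivative h' s) (at s)"
        unfolding h_def h'_def by (simp add: inner_commute algebra_simps)
      thus ?thesis by (rule has_vector_derivative_at_within)
    qed
    have I: "(h' has_integral (h t - h 0)) {0..t}"
      by (rule fundamental_theorem_of_calculus[OF t hd])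
    have iSt: "S integrable_on {0..t}" by (rule integrable_on_subinterval[OF iS]) simp
    have le: "h' s \<le> S s" for s
    proof -
      have "s * (2 * (F s \<bullet> F' s)) = 2 * (F s \<bullet> G s)"
        unfolding G[symmetric] by (simp add: scaleR_conv_of_real[symmetric])
      also have "\<dots> \<le> F s \<bullet> F s + G s \<bullet> G s"
        using inner_ge_zero[of "F s - G s"] by (simp add: inner_diff_left inner_diff_right inner_commute)
      finally show ?thesis by (simp add: h'_def S_def power2_norm_eq_inner)
    qed
    have "h t - h 0 \<le> integral {0..t} S"
      by (rule has_integral_le[OF I integrable_integral[OF iSt] le])
    also have "\<dots> \<le> integral UNIV S" by (rule integral_subset_le[OF _ iSt iS]) (use S0 in auto)
    finally show ?thesis by (simp add: h_def power2_norm_eq_inner)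
  qed
  moreover have "integral UNIV S \<ge> 0" using iS S0 by (intro integral_nonneg) auto
  ultimately show ?thesis by blast
qed

lemma compact_support_bounded:
  fixes f :: "real \<Rightarrow> real"
  assumes "continuous_on UNIV f" "\<And>x. \<bar>x\<bar> \<ge> 2 \<Longrightarrow> f x = 0"
  shows "\<exists>K\<ge>0. \<forall>x. \<bar>f x\<bar> \<le> K"
proof -
  have "bounded (f ` {-2..2})"
    by (intro compact_imp_bounded compact_continuous_image continuous_on_subset[OF assms(1)]) auto
  then obtain K where "\<forall>y\<in>f ` {-2..2}. norm y \<le> K" unfolding bounded_iff by blast
  hence K: "\<bar>f x\<bar> \<le> K" if "x \<in> {-2..2}" for x using that by simp
  have "\<bar>f x\<bar> \<le> max K 0" for x
  proof (cases "x \<in> {-2..2}")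
    case True thus ?thesis using K[OF True] by simp
  next
    case False
    hence "\<bar>x\<bar> \<ge> 2" by auto
    thus ?thesis using assms(2) by simp
  qed
  thus ?thesis by (intro exI[of _ "max K 0"]) auto
qed

lemma bounded_borel_continuous_real:
  fixes f :: "real \<Rightarrow> real"
  assumes "continuous_on UNIV f" "\<And>x. \<bar>f x\<bar> \<le> K"
  shows "bounded_borel (\<lambda>x. complex_of_real (f x))"
  by (rule bounded_borelI[where K = K])
    (use assms in \<open>auto intro!: borel_measurable_continuous_onI continuous_intros\<close>)

text \<open>The chain rule for \<open>\<kappa> x * iexp (t * x)\<close>: differentiating the
  exponential produces the factor t together with \<open>\<theta> * \<kappa>\<close>,
  differentiating \<kappa> the first term on the right. The commutator at u is a mixed term of the
  quadratic expression q, and polarization with the vector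
  \<open>u + \<i> *\<^sub>C (A \<cdot> u)\<close> writes it through diagonal values.\<close>

lemma (in commutator_theta) time_commutator:
  fixes \<kappa> \<kappa>' :: "real \<Rightarrow> real"
  assumes der: "\<And>x. (\<kappa> has_real_derivative \<kappa>' x) (at x)" and c: "continuous_on UNIV \<kappa>'"
    and K1: "\<And>x. \<bar>\<kappa> x\<bar> \<le> K1" and K2: "\<And>x. \<bar>\<theta> x * \<kappa>' x\<bar> \<le> K2" and K3: "\<And>x. \<bar>\<theta> x * \<kappa> x\<bar> \<le> K3"
    and u: "u \<in> Domain A"
  shows "complex_of_real t * ft (\<lambda>x. complex_of_real (\<theta> x * \<kappa> x)) u t =
    \<i> * ft (\<lambda>x. complex_of_real (\<theta> x * \<kappa>' x)) u t -
    \<i> * (ft (\<lambda>x. complex_of_real (\<kappa> x)) (u + \<i> *\<^sub>C (A \<cdot> u)) t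
        - ft (\<lambda>x. complex_of_real (\<kappa> x)) u t - ft (\<lambda>x. complex_of_real (\<kappa> x)) (A \<cdot> u) t)"
proof -
  have c\<kappa>: "continuous_on UNIV \<kappa>" by (rule DERIV_continuous_on[OF DERIV_subset[OF der subset_UNIV]])
  define \<phi> where "\<phi> x = complex_of_real (\<kappa> x) * iexp (t * x)" for x
  define \<phi>' where "\<phi>' x = complex_of_real (\<kappa> x) * (\<i> * complex_of_real t * iexp (t * x)) + complex_of_real (\<kappa>' x) * iexp (t * x)" for x
  have k: "bounded_borel (\<lambda>x. complex_of_real (\<kappa> x))" "bounded_borel (\<lambda>x. complex_of_real (\<theta> x * \<kappa>' x))"
     "bounded_borel (\<lambda>x. complex_of_real (\<theta> x * \<kappa> x))"
    by (rule bounded_borel_continuous_real[OF _ K1] bounded_borel_continuous_real[OF _ K2]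
        bounded_borel_continuous_real[OF _ K3]; intro continuous_intros c\<kappa> c \<theta>_cont)+
  have eqn: "\<theta> x * \<phi>' x = complex_of_real (\<theta> x * \<kappa>' x) * iexp (t * x) + \<i> * complex_of_real t * (complex_of_real (\<theta> x * \<kappa> x) * iexp (t * x))" for x
    by (simp add: \<phi>'_def algebra_simps)
  have com: "commutes_to \<phi> (\<lambda>x. \<theta> x * \<phi>' x)"
  proof (rule commutes_to_C1)
    show "(\<phi> has_vector_derivative \<phi>' x) (at x)" for x
    proof -
      have "((\<lambda>y. exp (\<i> * t * y)) has_field_derivative (\<i> * t) * exp (\<i> * t * complex_of_real x)) (at (complex_of_real x))"
        by (auto intro!: derivative_eq_intros)
      from has_vector_derivative_real_field[OF this]
      have "((\<lambda>x. iexp (t * x)) has_vector_derivative (\<i> * complex_of_real t * iexp (t * x))) (at x)"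
        by (simp add: mult_ac)
      from has_vector_derivative_mult[OF has_vector_derivative_of_real[OF der] this]
      show ?thesis unfolding \<phi>_def \<phi>'_def .
    qed
    show "continuous_on UNIV \<phi>'" unfolding \<phi>'_def by (intro continuous_intros c\<kappa> c)
    show "cmod (\<phi> x) \<le> K1" for x using K1[of x] by (simp add: \<phi>_def norm_mult)
    show "cmod (\<theta> x * \<phi>' x) \<le> K2 + \<bar>t\<bar> * K3" for x
    proof -
      have "cmod (\<theta> x * \<phi>' x) \<le> cmod (complex_of_real (\<theta> x * \<kappa>' x) * iexp (t * x)) + cmod (\<i> * complex_of_real t * (complex_of_real (\<theta> x * \<kappa> x) * iexp (t * x)))"
        unfolding eqn by (rule norm_triangle_ineq)
      also have "\<dots> = \<bar>\<theta> x * \<kappa>' x\<bar> + \<bar>t\<bar> * \<bar>\<theta> x * \<kappa> x\<bar>"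
        by (simp only: norm_mult norm_of_real norm_exp_i_times norm_ii mult_1 mult_1_right abs_mult)
      also have "\<dots> \<le> K2 + \<bar>t\<bar> * K3" by (intro add_mono mult_left_mono K2 K3) simp
      finally show ?thesis .
    qed
  qed
  define v where "v = A \<cdot> u"
  have \<phi>b: "bounded_borel \<phi>" unfolding \<phi>_def by (intro bounded_borel_mult k bounded_borel_iexp)
  define q where "q w = cinner w (Phi \<phi> w)" for w
  have qft: "q w = ft (\<lambda>x. complex_of_real (\<kappa> x)) w t" for w
    unfolding q_def \<phi>_def by (rule ft_Phi[OF k(1), symmetric])
  define X where "X = cinner v (Phi \<phi> u) - cinner u (Phi \<phi> v)"
  have pol: "q (u + \<i> *\<^sub>C v) = q u + q v - \<i> * X"
    unfolding q_def X_def
    by (simp add: Phi_linear[OF \<phi>b] cinner_add_left cinner_add_right cinner_scaleC_left cinner_scaleC_right algebra_simps)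
  have "X = \<i> * cinner u (Phi (\<lambda>x. \<theta> x * \<phi>' x) u)"
    unfolding X_def v_def using commutes_toD[OF com u u] by simp
  also have "Phi (\<lambda>x. \<theta> x * \<phi>' x) u = Phi (\<lambda>x. complex_of_real (\<theta> x * \<kappa>' x) * iexp (t * x)) u
     + (\<i> * complex_of_real t) *\<^sub>C Phi (\<lambda>x. complex_of_real (\<theta> x * \<kappa> x) * iexp (t * x)) u"
  proof -
    have b: "bounded_borel (\<lambda>x. complex_of_real (\<theta> x * \<kappa>' x) * iexp (t * x))" "bounded_borel (\<lambda>x. complex_of_real (\<theta> x * \<kappa> x) * iexp (t * x))"
      by (intro bounded_borel_mult k bounded_borel_iexp)+
    show ?thesis unfolding eqn Phi_add[OF b(1) bounded_borel_cmult[OF b(2)]] Phi_cmult[OF b(2)] ..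
  qed
  also have "cinner u \<dots> = ft (\<lambda>x. complex_of_real (\<theta> x * \<kappa>' x)) u t + \<i> * complex_of_real t * ft (\<lambda>x. complex_of_real (\<theta> x * \<kappa> x)) u t"
    unfolding ft_Phi[OF k(2)] ft_Phi[OF k(3)] by (simp only: cinner_add_right cinner_scaleC_right)
  finally have X: "X = \<i> * ft (\<lambda>x. complex_of_real (\<theta> x * \<kappa>' x)) u t - complex_of_real t * ft (\<lambda>x. complex_of_real (\<theta> x * \<kappa> x)) u t"
    by (simp add: distrib_left mult.assoc[symmetric])
  have "\<i> * (q (u + \<i> *\<^sub>C v) - q u - q v) = X" unfolding pol by (simp add: algebra_simps)
  thus ?thesis using X unfolding qft v_def by (simp add: algebra_simps)
qed

lemma (in pvm) ft_minus: "cmod (ft (\<lambda>_. 1) w (- t)) = cmod (ft (\<lambda>_. 1) w t)"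
proof -
  have "ft (\<lambda>_. 1) w (- t) = (\<integral>x. cnj (1 * iexp (t * x)) \<partial>mu w)"
    unfolding ft_def by (intro Bochner_Integration.integral_cong) (auto simp: exp_cnj)
  also have "\<dots> = cnj (ft (\<lambda>_. 1) w t)" unfolding ft_def by (rule Bochner_Integration.integral_cnj)
  finally show ?thesis by simp
qed

lemma bracket_powr_bounds:
  assumes "t \<ge> 0"
  shows "t \<le> 1 \<Longrightarrow> 1 \<le> sqrt 2 * bracket t powr (- 1 / 2)"
    and "t \<ge> 1 \<Longrightarrow> t powr (- 1 / 2) \<le> sqrt 2 * bracket t powr (- 1 / 2)"
proof -
  have b: "bracket t = sqrt (1 + t\<^sup>2)" by (simp add: bracket_def powr_half_sqrt)
  have pos: "bracket t > 0" unfolding b by (simp add: add_pos_nonneg)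
  have s2: "sqrt 2 = (1 / 2) powr (- 1 / 2)" by (simp add: powr_minus_divide powr_half_sqrt real_sqrt_divide)
  \<comment> \<open>One inequality serves both claims, with \<open>y = 1\<close> and
    \<open>y = t\<close>: each time \<open>bracket t \<le> 2 * y\<close>, and the 2 becomes
    \<open>sqrt 2\<close>.\<close>
  have *: "y powr (- 1 / 2) \<le> sqrt 2 * bracket t powr (- 1 / 2)" if "bracket t \<le> 2 * y" "y > 0" for y
  proof -
    have "y powr (- 1 / 2) \<le> (1 / 2 * bracket t) powr (- 1 / 2)"
      using that pos by (intro powr_mono2') auto
    also have "\<dots> = sqrt 2 * bracket t powr (- 1 / 2)" unfolding s2 using pos by (intro powr_mult)
    finally show ?thesis .
  qed
  show "1 \<le> sqrt 2 * bracket t powr (- 1 / 2)" if "t \<le> 1"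
  proof -
    have "1 + t\<^sup>2 \<le> 2\<^sup>2" using that assms abs_square_le_1[of t] by simp
    hence "bracket t \<le> 2" unfolding b by (intro real_le_lsqrt) auto
    thus ?thesis using *[of 1] by simp
  qed
  show "t powr (- 1 / 2) \<le> sqrt 2 * bracket t powr (- 1 / 2)" if "t \<ge> 1"
  proof (rule *)
    have "1 \<le> t\<^sup>2" using that by (rule one_le_power)
    moreover have "(2 * t)\<^sup>2 = 4 * t\<^sup>2" by (simp add: power_mult_distrib)
    ultimately have "1 + t\<^sup>2 \<le> (2 * t)\<^sup>2" by linarith
    thus "bracket t \<le> 2 * t" unfolding b using that by (intro real_le_lsqrt) auto
  qed (use that in simp)
qed

section \<open>Decay near and away from the possible zero of \<theta>\<close>

context commutator_theta
begin

lemma decay: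
  assumes d\<theta>: "\<And>x. (\<theta> has_real_derivative \<theta>' x) (at x)" and c\<theta>': "continuous_on UNIV \<theta>'" and b\<theta>': "\<And>x. \<bar>\<theta>' x\<bar> \<le> M"
    and low: "\<forall>\<epsilon>>0. \<exists>c>0. \<forall>x. \<bar>x\<bar> \<ge> \<epsilon> \<longrightarrow> \<bar>\<theta> x\<bar> \<ge> c"
    and dg: "\<And>x. (g has_real_derivative g' x) (at x)" and cg': "continuous_on UNIV g'"
    and g: "\<And>x. \<theta> x \<noteq> 0 \<Longrightarrow> g x = x / \<theta> x"
    and u: "u \<in> Domain A"
    and Eu: "integrable lborel (\<lambda>t. (cmod (ft (\<lambda>_. 1) u t))\<^sup>2)"
    and EAu: "integrable lborel (\<lambda>t. (cmod (ft (\<lambda>_. 1) (A \<cdot> u) t))\<^sup>2)"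
  shows "\<exists>C. \<forall>t. cmod (ft (\<lambda>_. 1) u t) \<le> C * bracket t powr (- 1 / 2)"
proof -
  define v where "v = A \<cdot> u"
  define w where "w = u + \<i> *\<^sub>C v"
  obtain c where c: "c > 0" "\<And>x. \<bar>x\<bar> \<ge> 1 \<Longrightarrow> \<bar>\<theta> x\<bar> \<ge> c" using low[rule_format, of 1] by auto
  have \<theta>0: "\<theta> x \<noteq> 0" if "x \<noteq> 0" for x
  proof -
    obtain d where "d > 0" "\<And>y. \<bar>y\<bar> \<ge> \<bar>x\<bar> \<Longrightarrow> \<bar>\<theta> y\<bar> \<ge> d" using low[rule_format, of "\<bar>x\<bar>"] \<open>x \<noteq> 0\<close> by auto
    from this(2)[of x] this(1) show ?thesis by auto
  qed
  have M0: "M \<ge> 0" using b\<theta>'[of 0] by linarith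
  have cg: "continuous_on UNIV g" by (rule DERIV_continuous_on[OF DERIV_subset[OF dg subset_UNIV]])

  have near: "\<exists>C\<ge>0. \<forall>t\<ge>0. t * (cmod (ft (\<lambda>x. complex_of_real (bump x)) u t))\<^sup>2 \<le> C"
  proof -
    \<comment> \<open>Chosen such that \<open>\<theta> x * \<kappa> x = x * bump x\<close>, whose
      transform is the derivative of F up to the factor i; the extension g keeps \<kappa> of class
      C1 at 0.\<close>
    define \<kappa> where "\<kappa> x = bump x * g x" for x
    define \<kappa>' where "\<kappa>' x = bump x * g' x + bump' x * g x" for x
    have d: "(\<kappa> has_real_derivative \<kappa>' x) (at x)" for x
      unfolding \<kappa>_def \<kappa>'_def using DERIV_mult[OF bump_derivative dg, of x] by (simp add: algebra_simps)
    have cc: "continuous_on UNIV \<kappa>" "continuous_on UNIV \<kappa>'"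
      unfolding \<kappa>_def \<kappa>'_def by (intro continuous_intros continuous_bump continuous_bump' cg cg')+
    have out: "\<kappa> x = 0" "\<kappa>' x = 0" if "\<bar>x\<bar> \<ge> 2" for x
      using bump_outside[OF that] by (simp_all add: \<kappa>_def \<kappa>'_def)
    obtain K1 where K1: "\<And>x. \<bar>\<kappa> x\<bar> \<le> K1" using compact_support_bounded[OF cc(1) out(1)] by blast
    have "continuous_on UNIV (\<lambda>x. \<theta> x * \<kappa>' x)" by (intro continuous_intros \<theta>_cont cc)
    then obtain K2 where K2: "\<And>x. \<bar>\<theta> x * \<kappa>' x\<bar> \<le> K2"
      using compact_support_bounded[of "\<lambda>x. \<theta> x * \<kappa>' x"] out(2) by auto
    have "continuous_on UNIV (\<lambda>x. \<theta> x * \<kappa> x)" by (intro continuous_intros \<theta>_cont cc)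
    then obtain K3 where K3: "\<And>x. \<bar>\<theta> x * \<kappa> x\<bar> \<le> K3"
      using compact_support_bounded[of "\<lambda>x. \<theta> x * \<kappa> x"] out(1) by auto
    \<comment> \<open>A zero of \<theta> can only occur at \<open>x = 0\<close>, where both sides
      vanish whatever the value of g.\<close>
    have \<theta>\<kappa>: "\<theta> x * \<kappa> x = x * bump x" for x
      using \<theta>0[of x] g[of x] by (cases "\<theta> x = 0") (auto simp: \<kappa>_def)
    have k: "bounded_borel (\<lambda>x. complex_of_real (\<kappa> x))" "bounded_borel (\<lambda>x. complex_of_real (\<theta> x * \<kappa>' x))"
      "bounded_borel (\<lambda>x. complex_of_real (\<theta> x * \<kappa> x))" "bounded_borel (\<lambda>x. complex_of_real (bump x))"
      by (rule bounded_borel_continuous_real[OF _ K1] bounded_borel_continuous_real[OF _ K2]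
          bounded_borel_continuous_real[OF _ K3] bounded_borel_continuous_real[of bump 1];
          use bump_bounds in \<open>auto intro!: continuous_intros cc \<theta>_cont continuous_bump\<close>)+
    have bx: "bounded_borel (\<lambda>x. complex_of_real x * complex_of_real (bump x))"
      using k(3) unfolding \<theta>\<kappa> by simp
    define F where "F = ft (\<lambda>x. complex_of_real (bump x)) u"
    define F' where "F' t = \<i> * ft (\<lambda>x. complex_of_real x * complex_of_real (bump x)) u t" for t
    define P where "P = ft (\<lambda>x. complex_of_real (\<theta> x * \<kappa>' x)) u"
    define Q where "Q = ft (\<lambda>x. complex_of_real (\<kappa> x))"
    \<comment> \<open>The right-hand side of \<open>time_commutator\<close> times i. Each of its
      four transforms is square integrable, the one at w by the stability of E(H) under
      sums.\<close>
    define G where "G t = \<i> * (\<i> * P t - \<i> * (Q w t - Q u t - Q v t))" for t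
    have Eiv: "integrable lborel (\<lambda>t. (cmod (ft (\<lambda>_. 1) (\<i> *\<^sub>C v) t))\<^sup>2)"
      using EAu unfolding v_def by (simp add: ft_unimodular)
    have iP: "integrable lborel (\<lambda>t. (cmod (P t))\<^sup>2)" unfolding P_def by (rule integrable_ft_sq_single[OF Eu k(2)])
    have iQ: "integrable lborel (\<lambda>t. (cmod (Q w t))\<^sup>2)" "integrable lborel (\<lambda>t. (cmod (Q u t))\<^sup>2)" "integrable lborel (\<lambda>t. (cmod (Q v t))\<^sup>2)"
      unfolding Q_def w_def v_def
      by (rule integrable_ft_sq_add[OF Eu Eiv[unfolded v_def] k(1)] integrable_ft_sq_single[OF Eu k(1)]
          integrable_ft_sq_single[OF EAu k(1)])+
    have "\<exists>C\<ge>0. \<forall>t\<ge>0. t * (cmod (F t))\<^sup>2 \<le> C"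
    proof (rule square_decay[where F' = F' and G = G])
      show "(F has_vector_derivative F' t) (at t)" for t
        unfolding F_def F'_def by (rule ft_has_derivative[OF k(4) bx])
      show "complex_of_real t * F' t = G t" for t
      proof -
        have "complex_of_real t * ft (\<lambda>x. complex_of_real (\<theta> x * \<kappa> x)) u t = \<i> * P t - \<i> * (Q w t - Q u t - Q v t)"
          unfolding P_def Q_def w_def v_def by (rule time_commutator[OF d cc(2) K1 K2 K3 u])
        hence "complex_of_real t * ft (\<lambda>x. complex_of_real x * complex_of_real (bump x)) u t = \<i> * P t - \<i> * (Q w t - Q u t - Q v t)"
          unfolding \<theta>\<kappa> by simp
        thus ?thesis unfolding F'_def G_def by (simp add: mult.left_commute)
      qed
      show "integrable lborel (\<lambda>t. (cmod (F t))\<^sup>2)" unfolding F_def by (rule integrable_ft_sq_single[OF Eu k(4)])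
      show "integrable lborel (\<lambda>t. (cmod (G t))\<^sup>2)"
      proof (rule Bochner_Integration.integrable_bound)
        show "integrable lborel (\<lambda>t. 4 * ((cmod (P t))\<^sup>2 + (cmod (Q w t))\<^sup>2 + (cmod (Q u t))\<^sup>2 + (cmod (Q v t))\<^sup>2))"
          by (intro integrable_mult_right Bochner_Integration.integrable_add iP iQ)
        note [measurable] = ft_measurable[OF k(2)] ft_measurable[OF k(1)]
        show "(\<lambda>t. (cmod (G t))\<^sup>2) \<in> borel_measurable lborel" unfolding G_def P_def Q_def by measurable
        show "AE t in lborel. norm ((cmod (G t))\<^sup>2) \<le> norm (4 * ((cmod (P t))\<^sup>2 + (cmod (Q w t))\<^sup>2 + (cmod (Q u t))\<^sup>2 + (cmod (Q v t))\<^sup>2))"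
        proof (rule AE_I2)
          fix t
          define a b c d where abcd: "a = cmod (P t)" "b = cmod (Q w t)" "c = cmod (Q u t)" "d = cmod (Q v t)"
          have "cmod (G t) = cmod (P t - (Q w t - Q u t - Q v t))"
            unfolding G_def right_diff_distrib[symmetric] norm_mult by simp
          also have "\<dots> \<le> a + b + c + d"
            using norm_triangle_ineq4[of "P t" "Q w t - Q u t - Q v t"] norm_triangle_ineq4[of "Q w t - Q u t" "Q v t"]
              norm_triangle_ineq4[of "Q w t" "Q u t"] unfolding abcd by linarith
          finally have "(cmod (G t))\<^sup>2 \<le> (a + b + c + d)\<^sup>2" by (rule power_mono) simp
          also have "\<dots> \<le> 4 * (a\<^sup>2 + b\<^sup>2 + c\<^sup>2 + d\<^sup>2)"
          proof -
            have "4 * (a\<^sup>2 + b\<^sup>2 + c\<^sup>2 + d\<^sup>2) - (a + b + c + d)\<^sup>2 = (a - b)\<^sup>2 + (a - c)\<^sup>2 + (a - d)\<^sup>2 + (b - c)\<^sup>2 + (b - d)\<^sup>2 + (c - d)\<^sup>2"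
              by (simp add: power2_eq_square algebra_simps)
            moreover have "\<dots> \<ge> 0" by simp
            ultimately show ?thesis by linarith
          qed
          finally show "norm ((cmod (G t))\<^sup>2) \<le> norm (4 * ((cmod (P t))\<^sup>2 + (cmod (Q w t))\<^sup>2 + (cmod (Q u t))\<^sup>2 + (cmod (Q v t))\<^sup>2))"
            unfolding abcd by simp
        qed
      qed
    qed
    thus ?thesis unfolding F_def .
  qed

  have away: "\<exists>C\<ge>0. \<forall>t\<ge>0. t * cmod (ft (\<lambda>x. complex_of_real (1 - bump x)) u t) \<le> C"
  proof -
    \<comment> \<open>On \<open>\<bar>x\<bar> \<le> 1\<close> the numerators of both quotients
      vanish, so a zero of \<theta> at 0 does no harm and the quotients are 0 there.\<close>
    define \<eta> where "\<eta> x = (1 - bump x) / \<theta> x" for x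
    define \<eta>' where "\<eta>' x = (- bump' x * \<theta> x - (1 - bump x) * \<theta>' x) / (\<theta> x * \<theta> x)" for x
    have inside: "\<eta> x = 0" "\<eta>' x = 0" if "\<bar>x\<bar> \<le> 1" for x
      using bump_inside[OF that] by (simp_all add: \<eta>_def \<eta>'_def)
    have d: "(\<eta> has_real_derivative \<eta>' x) (at x)" for x
    proof (cases "x = 0")
      case True
      have "((\<lambda>_. 0) has_real_derivative \<eta>' x) (at x)" using inside(2)[of x] True by simp
      thus ?thesis
      proof (rule has_field_derivative_transform_within_open)
        show "open {-1<..<1::real}" "x \<in> {-1<..<1}" using True by auto
        show "0 = \<eta> y" if "y \<in> {-1<..<1}" for y using that inside(1)[of y] by auto
      qed
    next
      case False
      have "((\<lambda>x. 1 - bump x) has_real_derivative - bump' x) (at x)"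
        using DERIV_diff[OF DERIV_const[of 1] bump_derivative, of x] by simp
      from DERIV_divide[OF this d\<theta> \<theta>0[OF False]] show ?thesis unfolding \<eta>_def \<eta>'_def .
    qed
    have c\<eta>': "continuous_on UNIV \<eta>'"
    proof -
      \<comment> \<open>Two overlapping open sets cover the line: near 0 the function is constant,
        elsewhere its denominator does not vanish.\<close>
      have "continuous_on {-1<..<1} \<eta>'"
        by (rule continuous_on_eq[OF continuous_on_const[of _ 0]]) (use inside(2) in auto)
      moreover have "continuous_on {x. x \<noteq> 0} \<eta>'"
        unfolding \<eta>'_def using \<theta>0
        by (intro continuous_intros continuous_bump continuous_bump' continuous_on_subset[OF \<theta>_cont]
            continuous_on_subset[OF c\<theta>']) auto
      moreover have "open {x::real. x \<noteq> 0}" by (simp add: open_Collect_neq)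
      ultimately have "continuous_on ({-1<..<1} \<union> {x. x \<noteq> 0}) \<eta>'"
        by (intro continuous_on_open_Un) auto
      moreover have "{-1<..<1} \<union> {x::real. x \<noteq> 0} = UNIV" by auto
      ultimately show ?thesis by simp
    qed
    have bb: "\<bar>1 - bump x\<bar> \<le> 1" for x using bump_bounds[of x] by simp
    have K1: "\<bar>\<eta> x\<bar> \<le> 1 / c" for x
    proof (cases "\<bar>x\<bar> \<le> 1")
      case False
      hence "\<bar>\<eta> x\<bar> \<le> 1 / c" unfolding \<eta>_def abs_divide using c bb[of x] by (intro frac_le) auto
      thus ?thesis .
    qed (use inside c(1) in auto)
    have \<theta>\<eta>: "\<theta> x * \<eta> x = 1 - bump x" for x
    proof (cases "x = 0")
      case True thus ?thesis using bump_inside[of 0] by (simp add: \<eta>_def)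
    next
      case False thus ?thesis using \<theta>0[OF False] by (simp add: \<eta>_def)
    qed
    have K3: "\<bar>\<theta> x * \<eta> x\<bar> \<le> 1" for x unfolding \<theta>\<eta> by (rule bb)
    \<comment> \<open>Outside the unit interval the summands are \<open>- bump'\<close>, bounded by
      16, and \<open>(1 - bump) * \<theta>' / \<theta>\<close>, bounded by
      \<open>M / c\<close>.\<close>
    have K2: "\<bar>\<theta> x * \<eta>' x\<bar> \<le> 16 + 1 * M / c" for x
    proof (cases "\<bar>x\<bar> \<le> 1")
      case True thus ?thesis using inside(2)[OF True] M0 c(1) by simp
    next
      case False
      hence "x \<noteq> 0" by auto
      hence "\<theta> x * \<eta>' x = - bump' x - (1 - bump x) * \<theta>' x / \<theta> x"
        using \<theta>0 by (simp add: \<eta>'_def field_simps)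
      also have "\<bar>\<dots>\<bar> \<le> \<bar>bump' x\<bar> + \<bar>1 - bump x\<bar> * \<bar>\<theta>' x\<bar> / \<bar>\<theta> x\<bar>"
        using abs_triangle_ineq4[of "- bump' x" "(1 - bump x) * \<theta>' x / \<theta> x"] by (simp add: abs_mult abs_divide)
      also have "\<dots> \<le> 16 + 1 * M / c"
        using False c M0 by (intro add_mono bump'_bound frac_le mult_mono bb b\<theta>') auto
      finally show ?thesis .
    qed
    \<comment> \<open>Here boundedness of the transforms suffices: each contributes the bound of its
      multiplier times the squared norm of its vector, by \<open>ft_bound\<close>.\<close>
    define C where "C = (16 + 1 * M / c) * (norm u)\<^sup>2 + (1 / c) * ((norm w)\<^sup>2 + (norm u)\<^sup>2 + (norm v)\<^sup>2)"
    have "t * cmod (ft (\<lambda>x. complex_of_real (1 - bump x)) u t) \<le> C" if t: "t \<ge> 0" for t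
    proof -
      let ?P = "ft (\<lambda>x. complex_of_real (\<theta> x * \<eta>' x)) u t" and ?Q = "\<lambda>w. ft (\<lambda>x. complex_of_real (\<eta> x)) w t"
      have "complex_of_real t * ft (\<lambda>x. complex_of_real (1 - bump x)) u t = \<i> * ?P - \<i> * (?Q w - ?Q u - ?Q v)"
        using time_commutator[OF d c\<eta>' K1 K2 K3 u, of t] unfolding \<theta>\<eta> w_def v_def .
      hence "cmod (complex_of_real t * ft (\<lambda>x. complex_of_real (1 - bump x)) u t) = cmod (\<i> * (?P - (?Q w - ?Q u - ?Q v)))"
        by (simp only: right_diff_distrib)
      hence "t * cmod (ft (\<lambda>x. complex_of_real (1 - bump x)) u t) = cmod (?P - (?Q w - ?Q u - ?Q v))"
        using t unfolding norm_mult by simp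
      also have "\<dots> \<le> cmod ?P + (cmod (?Q w) + cmod (?Q u) + cmod (?Q v))"
        using norm_triangle_ineq4[of ?P "?Q w - ?Q u - ?Q v"] norm_triangle_ineq4[of "?Q w - ?Q u" "?Q v"]
          norm_triangle_ineq4[of "?Q w" "?Q u"] by linarith
      also have "\<dots> \<le> (16 + 1 * M / c) * (norm u)\<^sup>2 + ((1 / c) * (norm w)\<^sup>2 + (1 / c) * (norm u)\<^sup>2 + (1 / c) * (norm v)\<^sup>2)"
        using c(1) M0 by (intro add_mono ft_bound) (use K1 K2 in \<open>simp_all only: norm_of_real\<close>, auto)
      finally show ?thesis by (simp add: C_def algebra_simps)
    qed
    moreover have "C \<ge> 0" using c(1) M0 by (simp add: C_def)
    ultimately show ?thesis by blast
  qed

  obtain C1 where C1: "C1 \<ge> 0" "\<And>t. t \<ge> 0 \<Longrightarrow> t * (cmod (ft (\<lambda>x. complex_of_real (bump x)) u t))\<^sup>2 \<le> C1"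
    using near by blast
  obtain C2 where C2: "C2 \<ge> 0" "\<And>t. t \<ge> 0 \<Longrightarrow> t * cmod (ft (\<lambda>x. complex_of_real (1 - bump x)) u t) \<le> C2"
    using away by blast
  \<comment> \<open>The first summand covers the part near 0, the second the part away from it,
    where \<open>1 / t \<le> 1 / sqrt t\<close> for \<open>t \<ge> 1\<close>; the last covers
    \<open>t \<le> 1\<close>, where \<open>ft_bound\<close> is used.\<close>
  define D where "D = sqrt C1 + C2 + (norm u)\<^sup>2"
  have D0: "D \<ge> 0" using C1(1) C2(1) by (simp add: D_def)
  have pos: "cmod (ft (\<lambda>_. 1) u t) \<le> (D * sqrt 2) * bracket t powr (- 1 / 2)" if t: "t \<ge> 0" for t
  proof (cases "t \<le> 1")
    case True
    have "cmod (ft (\<lambda>_. 1) u t) \<le> 1 * (norm u)\<^sup>2" by (rule ft_bound) simp_all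
    also have "\<dots> \<le> D * 1" using C1(1) C2(1) by (simp add: D_def)
    also have "\<dots> \<le> D * (sqrt 2 * bracket t powr (- 1 / 2))"
      by (intro mult_left_mono bracket_powr_bounds(1)[OF t True] D0)
    finally show ?thesis by (simp add: mult.assoc)
  next
    case False
    hence t1: "t \<ge> 1" "t > 0" by auto
    have tp: "t powr (- 1 / 2) = 1 / sqrt t" using t1 by (simp add: powr_minus_divide powr_half_sqrt)
    have "cmod (ft (\<lambda>x. complex_of_real (bump x)) u t) = sqrt ((cmod (ft (\<lambda>x. complex_of_real (bump x)) u t))\<^sup>2)" by simp
    also have "\<dots> \<le> sqrt (C1 / t)"
      using C1(2)[of t] t1 by (intro real_sqrt_le_mono) (simp add: pos_le_divide_eq mult.commute)
    finally have n: "cmod (ft (\<lambda>x. complex_of_real (bump x)) u t) \<le> sqrt C1 * t powr (- 1 / 2)"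
      unfolding tp by (simp add: real_sqrt_divide)
    have "cmod (ft (\<lambda>x. complex_of_real (1 - bump x)) u t) \<le> C2 / t"
      using C2(2)[of t] t1 by (simp add: pos_le_divide_eq mult.commute)
    also have "\<dots> \<le> C2 / sqrt t"
      using t1 C2(1) real_le_lsqrt[of t t] by (intro divide_left_mono) (auto simp: power2_eq_square)
    finally have f: "cmod (ft (\<lambda>x. complex_of_real (1 - bump x)) u t) \<le> C2 * t powr (- 1 / 2)" unfolding tp by simp
    have cb: "continuous_on UNIV (\<lambda>x. 1 - bump x)" by (intro continuous_intros continuous_bump)
    have kb: "bounded_borel (\<lambda>x. complex_of_real (bump x))" "bounded_borel (\<lambda>x. complex_of_real (1 - bump x))"
      by (rule bounded_borel_continuous_real[OF continuous_bump, of 1] bounded_borel_continuous_real[OF cb, of 1];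
          use bump_bounds in auto)+
    have "ft (\<lambda>_. 1) u t = (\<integral>x. complex_of_real (bump x) * iexp (t * x) + complex_of_real (1 - bump x) * iexp (t * x) \<partial>mu u)"
      unfolding ft_def by (intro Bochner_Integration.integral_cong) (auto simp: algebra_simps)
    also have "\<dots> = ft (\<lambda>x. complex_of_real (bump x)) u t + ft (\<lambda>x. complex_of_real (1 - bump x)) u t"
      unfolding ft_def
      by (intro Bochner_Integration.integral_add integrable_mu bounded_borel_mult kb bounded_borel_iexp)
    finally have "cmod (ft (\<lambda>_. 1) u t) \<le> cmod (ft (\<lambda>x. complex_of_real (bump x)) u t) + cmod (ft (\<lambda>x. complex_of_real (1 - bump x)) u t)"
      using norm_triangle_ineq by simp
    also have "\<dots> \<le> sqrt C1 * t powr (- 1 / 2) + C2 * t powr (- 1 / 2)" by (intro add_mono n f)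
    also have "\<dots> \<le> D * t powr (- 1 / 2)" by (simp add: D_def distrib_right)
    also have "\<dots> \<le> D * (sqrt 2 * bracket t powr (- 1 / 2))"
      by (intro mult_left_mono bracket_powr_bounds(2)[OF t t1(1)] D0)
    finally show ?thesis by (simp add: mult.assoc)
  qed
  have "cmod (ft (\<lambda>_. 1) u t) \<le> (D * sqrt 2) * bracket t powr (- 1 / 2)" for t
  \<comment> \<open>Negative times follow by conjugation, since the scalar measure is
    positive.\<close>
  proof (cases "t \<ge> 0")
    case False
    have "bracket (- t) = bracket t" by (simp add: bracket_def)
    thus ?thesis using pos[of "- t"] False by (simp add: ft_minus)
  qed (rule pos)
  thus ?thesis by blast
qed

end

theorem theorem4p8:
  fixes A H :: "'a::complex_hilbert operator"
    and \<theta> :: "real \<Rightarrow> real"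
    and u :: 'a
  assumes "selfadjoint A" and "selfadjoint H"
    and "class_C1 A H"
    and "\<theta> C1_differentiable_on UNIV" and "bounded (range (deriv \<theta>))"
    and "form_eq_operator_on (Domain H) (derived_form A H)
           (op_fun (\<lambda>x. complex_of_real (\<theta> x)) H)"
    and "\<forall>\<epsilon>>0. \<exists>c>0. \<forall>x. \<bar>x\<bar> \<ge> \<epsilon> \<longrightarrow> \<bar>\<theta> x\<bar> \<ge> c"
    and "\<exists>g. g C1_differentiable_on UNIV \<and> (\<forall>x. \<theta> x \<noteq> 0 \<longrightarrow> g x = x / \<theta> x)"
    and "u \<in> Domain A" and "u \<in> E_space H" and "A \<cdot> u \<in> E_space H"
  shows "\<exists>C. \<forall>t. cmod (psi H u t) \<le> C * bracket t powr (- 1 / 2)"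
proof -
  interpret H: selfadjoint_op H by standard (rule assms(2))
  \<comment> \<open>Origin of the spectral measure: the equality of forms includes that the domain
    of H lies in that of \<theta>(H), so the graph of the latter is nonempty, and membership in it
    asserts the existence of E.\<close>
  have "0 \<in> Domain (op_fun (\<lambda>x. complex_of_real (\<theta> x)) H)"
    using assms(6) H.Domain_zero unfolding form_eq_operator_on_def by blast
  then obtain E where E: "spectral_measure_of H E" unfolding op_fun_def by blast
  interpret commutator_setting A E H
    using E assms(1,2) by unfold_locales (auto simp: spectral_measure_of_def)
  obtain z K where zK: "Im z \<noteq> 0" "comm_bound (Phi (res z)) K" using class_C1_nonreal[OF assms(3)] by blast
  obtain \<theta>' where \<theta>': "\<And>x. (\<theta> has_real_derivative \<theta>' x) (at x)" "continuous_on UNIV \<theta>'"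
    using assms(4) unfolding C1_differentiable_on_def has_real_derivative_iff_has_vector_derivative by blast
  obtain g g' where g: "\<And>x. (g has_real_derivative g' x) (at x)" "continuous_on UNIV g'"
    "\<And>x. \<theta> x \<noteq> 0 \<Longrightarrow> g x = x / \<theta> x"
    using assms(8) unfolding C1_differentiable_on_def has_real_derivative_iff_has_vector_derivative by blast
  obtain M where M: "\<And>x. \<bar>\<theta>' x\<bar> \<le> M"
    using assms(5) DERIV_imp_deriv[OF \<theta>'(1)] by (auto simp: bounded_iff)
  have M0: "M \<ge> 0" using M[of 0] by linarith
  \<comment> \<open>The bounded derivative gives linear growth, the form in which it enters the
    chain rule.\<close>
  have growth: "\<bar>\<theta> x\<bar> \<le> \<bar>\<theta> 0\<bar> + M * \<bar>x\<bar>" for x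
  proof -
    have "norm (\<theta> x - \<theta> 0) \<le> M * norm (x - 0)"
      by (rule field_differentiable_bound[where S = UNIV and f' = \<theta>'])
        (use \<theta>'(1) M in \<open>auto intro: DERIV_subset\<close>)
    thus ?thesis by simp
  qed
  interpret commutator_theta A E H z K \<theta> "\<bar>\<theta> 0\<bar>" M
  proof unfold_locales
    show "continuous_on UNIV \<theta>" by (rule DERIV_continuous_on[OF DERIV_subset[OF \<theta>'(1) subset_UNIV]])
  qed (use zK growth M0 assms(6) in auto)
  have psi: "psi H w t = ft (\<lambda>_. 1) w t" for w t
    unfolding psi_def exp_i_def op_fun_eq_integral_pvm[OF E] ft_Phi[OF bounded_borel_const]
    by (simp add: Phi_def)
  have "integrable lborel (\<lambda>t. (cmod (ft (\<lambda>_. 1) u t))\<^sup>2)" "integrable lborel (\<lambda>t. (cmod (ft (\<lambda>_. 1) (A \<cdot> u) t))\<^sup>2)"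
    using assms(10,11) unfolding E_space_def psi by simp_all
  from decay[OF \<theta>' M assms(7) g assms(9) this] show ?thesis unfolding psi .
qed

end
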